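(* Consider the sparse sequence model with independent $X_i\sim f_{\theta_i}$, $1\le i\le n$, in the asymptotics $n\to\infty$, $s_n\to\infty$, $n/s_n\to\infty$, and grant Assumption 1.A (stated in the context) with sequences $a_n^*,\delta_n$. For $\theta\in\mathbb R^n$ with $|S_\theta|=s_n$ put $\Lambda_n(\theta)=s_n^{-1}\sum_{i\in S_\theta}F_{|\theta_i|}(a_n^* )$, and consider the condition on a level $\alpha_n$: $$\frac{3n\overline F_0(a_n^* )}{s_n(1-\Lambda_n(\theta))}\le\alpha_n\le\min\Big\{1,\frac{n\overline F_0(a_n^*-\delta_n)}{s_n}\Big\}\quad\text{for } n\text{ large enough}.\qquad(\ast)$$ Then the Benjamini–Hochberg procedure $\varphi=\varphi^{BH}_{\alpha_n}$ taken at a level $\alpha=\alpha_n$ obeying $(\ast)$ satisfies, for all $\theta\in\mathbb R^n$ with $|S_\theta|=s_n$, for $n$ large enough, $$\mathfrak R(\theta,\varphi)\le\Lambda_n(\theta)+\alpha_n+\exp\Big(-\frac{(1-\Lambda_n(\theta))^2}{32}s_n\Big).$$ It follows that, for $\boldsymbol a=(a_1,\dots,a_{s_n})$ with $a_j>0$, and with $\Lambda_n(\boldsymbol a)$ and $\Theta(\boldsymbol a,s_n)$ as defined in the context, the BH procedure achieves the asymptotic minimax risk $\inf_\psi\sup_{\theta\in\Theta(\boldsymbol a,s_n)}\mathfrak R(\theta,\psi)=\Lambda_n(\boldsymbol a)+o(1)$ (infimum over all multiple testing procedures): $$\sup_{\theta\in\Theta(\boldsymbol a,s_n)}\mathfrak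 R(\theta,\varphi)\le\Lambda_n(\boldsymbol a)+o(1).$$ In addition, if $\Lambda_n(\boldsymbol a)$ is bounded away from $1$, one has the concrete expression $\alpha_n+\exp\big(-(1-\Lambda_n(\boldsymbol a))^2s_n/32\big)$ for the $o(1)$ terms. Finally, if one instead grants Assumption 1.B, the same bounds hold with $\Lambda_n(\cdot)$ replaced by $2\Lambda_n(\cdot)-1$.
   Context: Model: $(f_a:a\in\mathbb R)$ is a family of probability densities on $\mathbb R$, $F_a(x)=\int_{-\infty}^xf_a(t)\,dt$, $\overline F_a=1-F_a$. For $\theta\in\mathbb R^n$ deterministic, $X_1,\dots,X_n$ are independent with $X_i\sim f_{\theta_i}$; $P_\theta,E_\theta$ denote the law and expectation. $(s_n)$ is a sequence of integers with $0\le s_n\le n$, and $S_\theta=\{i:\theta_i\ne0\}$. Assumption 1. There is a constant $L$ such that each $F_a$ is $L$-Lipschitz. There exist sequences of positive numbers $a_n^*\to\infty$, $\delta_n\to0$ such that $(n/s_n)\overline F_0(a_n^*-\delta_n)\to\infty$ and $(n/s_n)\overline F_0(a_n^* )\to0$. The density $f_0$ is continuous and positive on $\mathbb R$. Further, one of the following holds: (A) $f_{-a}(-x)=f_a(x)$ for all $a,x\in\mathbb R$; $\overline F_a(x)$ is increasing in $a\in\mathbb R$; and for $a>0$, $f_a(x)/f_0(x)$ is increasing in $x\in\mathbb R$. (B) $f_a(-x)=f_a(x)$ for all $a,x\in\mathbb R$; $\overline F_a(x)$ is increasing in $a>0$ for $x>0$; and for $a\ne0$, $f_a(x)/f_0(x)$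 is increasing in $x>0$. "Assumption 1.A" (resp. "1.B") means Assumption 1 with (A) (resp. (B)). Signal classes: for $\boldsymbol a=(a_1,\dots,a_{s_n})$ (implicitly indexed by $n$) with all $a_j>0$, $\Lambda_n(\boldsymbol a)=s_n^{-1}\sum_{j=1}^{s_n}F_{a_j}(a_n^* )$ and $\Theta(\boldsymbol a,s_n)=\{\theta\in\mathbb R^n:\ |S_\theta|\le s_n,\ \exists\, i_1,\dots,i_{s_n}\text{ all distinct},\ |\theta_{i_j}|\ge a_j,\ 1\le j\le s_n\}$. A multiple testing procedure is a measurable $\varphi:\mathbb R^n\to\{0,1\}^n$ (depending on $n$). $\mathrm{FDR}(\theta,\varphi)=E_\theta\left[\frac{\sum_i\mathbf 1\{\theta_i=0\}\varphi_i(X)}{1\vee\sum_i\varphi_i(X)}\right]$, $\mathrm{FNR}(\theta,\varphi)=E_\theta\left[\frac{\sum_i\mathbf 1\{\theta_i\ne0\}(1-\varphi_i(X))}{1\vee|S_\theta|}\right]$, $\mathfrak R=\mathrm{FDR}+\mathrm{FNR}$. BH procedure at level $\alpha$: $\varphi^{BH}_{\alpha,i}(X)=\mathbf 1\{|X_i|\ge\hat t\}$, with $\hat t=\min\{t\in\mathbb R\cup\{+\infty\}:\ n^{-1}\sum_{i=1}^n\mathbf 1\{|X_i|\ge t\}\ge 2\overline F_0(t)/\alpha\}$.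
   Formalization: Under Assumption 1.B it is also assumed that F_{-a}=F_a for all a (else negative signals can be undetectable and the bound fails); the Λ_n(a)+o(1) claim for BH is stated for levels α_n→0 (α_n=1 obeys (∗) but has FDR→1). *)

theory Defs
  imports "HOL-Probability.Probability"
begin

definition density_family :: "(real \<Rightarrow> real \<Rightarrow> real) \<Rightarrow> bool" where
  "density_family f \<longleftrightarrow>
     (\<forall>a. (\<forall>x. 0 \<le> f a x) \<and> has_bochner_integral lborel (f a) 1)"

definition df :: "(real \<Rightarrow> real \<Rightarrow> real) \<Rightarrow> real \<Rightarrow> real \<Rightarrow> real" where
  "df f a x = (LINT t:{..x}|lborel. f a t)"

definition tail :: "(real \<Rightarrow> real \<Rightarrow> real) \<Rightarrow> real \<Rightarrow> real \<Rightarrow> real" where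
  "tail f a x = 1 - df f a x"

text \<open>Throughout, ``increasing'' is read in the weak sense.\<close>

definition assumption_1 ::
  "(real \<Rightarrow> real \<Rightarrow> real) \<Rightarrow> (nat \<Rightarrow> nat) \<Rightarrow> (nat \<Rightarrow> real) \<Rightarrow> (nat \<Rightarrow> real) \<Rightarrow> bool" where
  "assumption_1 f s astar \<delta> \<longleftrightarrow>
     (\<exists>L. \<forall>a. L-lipschitz_on UNIV (df f a)) \<and>
     (\<forall>n. 0 < astar n) \<and> (\<forall>n. 0 < \<delta> n) \<and>
     filterlim astar at_top sequentially \<and> \<delta> \<longlonglongrightarrow> 0 \<and>
     filterlim (\<lambda>n. real n / real (s n) * tail f 0 (astar n - \<delta> n)) at_top sequentially \<and>
     (\<lambda>n. real n / real (s n) * tail f 0 (astar n)) \<longlonglongrightarrow> 0 \<and>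
     continuous_on UNIV (f 0) \<and> (\<forall>x. 0 < f 0 x)"

definition assumption_1A ::
  "(real \<Rightarrow> real \<Rightarrow> real) \<Rightarrow> (nat \<Rightarrow> nat) \<Rightarrow> (nat \<Rightarrow> real) \<Rightarrow> (nat \<Rightarrow> real) \<Rightarrow> bool" where
  "assumption_1A f s astar \<delta> \<longleftrightarrow>
     assumption_1 f s astar \<delta> \<and>
     (\<forall>a x. f (- a) (- x) = f a x) \<and>
     (\<forall>x. mono (\<lambda>a. tail f a x)) \<and>
     (\<forall>a>0. mono (\<lambda>x. f a x / f 0 x))"

definition assumption_1B ::
  "(real \<Rightarrow> real \<Rightarrow> real) \<Rightarrow> (nat \<Rightarrow> nat) \<Rightarrow> (nat \<Rightarrow> real) \<Rightarrow> (nat \<Rightarrow> real) \<Rightarrow> bool" where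
  "assumption_1B f s astar \<delta> \<longleftrightarrow>
     assumption_1 f s astar \<delta> \<and>
     (\<forall>a x. f a (- x) = f a x) \<and>
     (\<forall>x>0. mono_on {0<..} (\<lambda>a. tail f a x)) \<and>
     (\<forall>a. a \<noteq> 0 \<longrightarrow> mono_on {0<..} (\<lambda>x. f a x / f 0 x))"

text \<open>
  Vectors in the \<open>n\<close>-dimensional space are extensional functions on \<open>{1..n}\<close>.
\<close>

definition vectors :: "nat \<Rightarrow> (nat \<Rightarrow> real) set" where
  "vectors n = {1..n} \<rightarrow>\<^sub>E UNIV"

definition nonzero :: "nat \<Rightarrow> (nat \<Rightarrow> real) \<Rightarrow> nat set" where
  "nonzero n \<theta> = {i \<in> {1..n}. \<theta> i \<noteq> 0}"

definition law ::
  "(real \<Rightarrow> real \<Rightarrow> real) \<Rightarrow> nat \<Rightarrow> (nat \<Rightarrow> real) \<Rightarrow> (nat \<Rightarrow> real) measure" where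
  "law f n \<theta> = (\<Pi>\<^sub>M i\<in>{1..n}. density lborel (\<lambda>x. ennreal (f (\<theta> i) x)))"

definition procedures :: "nat \<Rightarrow> ((nat \<Rightarrow> real) \<Rightarrow> nat \<Rightarrow> nat) set" where
  "procedures n =
     ((\<Pi>\<^sub>M i\<in>{1..n}. (borel :: real measure)) \<rightarrow>\<^sub>M (\<Pi>\<^sub>M i\<in>{1..n}. count_space {0, 1}))"

definition FDR ::
  "(real \<Rightarrow> real \<Rightarrow> real) \<Rightarrow> nat \<Rightarrow> (nat \<Rightarrow> real) \<Rightarrow> ((nat \<Rightarrow> real) \<Rightarrow> nat \<Rightarrow> nat) \<Rightarrow> real" where
  "FDR f n \<theta> \<phi> =
     (LINT x|law f n \<theta>.
        (\<Sum>i\<in>{1..n}. of_bool (\<theta> i = 0) * real (\<phi> x i)) / max 1 (\<Sum>i\<in>{1..n}. real (\<phi> x i)))"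

definition FNR ::
  "(real \<Rightarrow> real \<Rightarrow> real) \<Rightarrow> nat \<Rightarrow> (nat \<Rightarrow> real) \<Rightarrow> ((nat \<Rightarrow> real) \<Rightarrow> nat \<Rightarrow> nat) \<Rightarrow> real" where
  "FNR f n \<theta> \<phi> =
     (LINT x|law f n \<theta>.
        (\<Sum>i\<in>{1..n}. of_bool (\<theta> i \<noteq> 0) * (1 - real (\<phi> x i))) / max 1 (real (card (nonzero n \<theta>))))"

definition risk ::
  "(real \<Rightarrow> real \<Rightarrow> real) \<Rightarrow> nat \<Rightarrow> (nat \<Rightarrow> real) \<Rightarrow> ((nat \<Rightarrow> real) \<Rightarrow> nat \<Rightarrow> nat) \<Rightarrow> real" where
  "risk f n \<theta> \<phi> = FDR f n \<theta> \<phi> + FNR f n \<theta> \<phi>"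

text \<open>
  The point \<open>\<infinity>\<close> always satisfies the defining inequality of the threshold, both sides being \<open>0\<close>
  there. For \<open>0 < \<alpha> \<le> 1\<close> and \<open>n \<ge> 1\<close> the set of admissible \<open>t\<close> is closed and bounded below
  (the tail of \<open>f 0\<close> being continuous), so its least element exists.
\<close>

definition BH_threshold ::
  "(real \<Rightarrow> real \<Rightarrow> real) \<Rightarrow> nat \<Rightarrow> real \<Rightarrow> (nat \<Rightarrow> real) \<Rightarrow> ereal" where
  "BH_threshold f n \<alpha> x =
     (LEAST t. t = \<infinity> \<or>
        (\<exists>r. t = ereal r \<and>
             real (card {i \<in> {1..n}. r \<le> \<bar>x i\<bar>}) / real n \<ge> 2 * tail f 0 r / \<alpha>))"

definition BH ::
  "(real \<Rightarrow> real \<Rightarrow> real) \<Rightarrow> nat \<Rightarrow> real \<Rightarrow> (nat \<Rightarrow> real) \<Rightarrow> nat \<Rightarrow> nat" where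
  "BH f n \<alpha> x = (\<lambda>i\<in>{1..n}. of_bool (BH_threshold f n \<alpha> x \<le> ereal \<bar>x i\<bar>))"

text \<open>
  In the following definitions \<open>k\<close> stands for \<open>s n\<close>, \<open>t\<close> for \<open>astar n\<close>, and \<open>a\<close> for the
  \<open>n\<close>-th row \<open>a 1, \<dots>, a k\<close> of the array of signal strengths.
\<close>

definition Lambda_vec ::
  "(real \<Rightarrow> real \<Rightarrow> real) \<Rightarrow> nat \<Rightarrow> real \<Rightarrow> nat \<Rightarrow> (nat \<Rightarrow> real) \<Rightarrow> real" where
  "Lambda_vec f k t n \<theta> = (\<Sum>i\<in>nonzero n \<theta>. df f \<bar>\<theta> i\<bar> t) / real k"

definition Lambda_sig ::
  "(real \<Rightarrow> real \<Rightarrow> real) \<Rightarrow> nat \<Rightarrow> real \<Rightarrow> (nat \<Rightarrow> real) \<Rightarrow> real" where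
  "Lambda_sig f k t a = (\<Sum>j\<in>{1..k}. df f (a j) t) / real k"

definition signal_class :: "nat \<Rightarrow> nat \<Rightarrow> (nat \<Rightarrow> real) \<Rightarrow> (nat \<Rightarrow> real) set" where
  "signal_class n k a =
     {\<theta> \<in> vectors n. card (nonzero n \<theta>) \<le> k \<and>
        (\<exists>\<iota>. inj_on \<iota> {1..k} \<and> \<iota> ` {1..k} \<subseteq> {1..n} \<and> (\<forall>j\<in>{1..k}. a j \<le> \<bar>\<theta> (\<iota> j)\<bar>))}"

text \<open>
  All risks lie in \<open>[0, 2]\<close> and the signal class is nonempty when \<open>k \<le> n\<close>, so the real-valued
  suprema and infima below are genuine ones.
\<close>

definition worst_risk ::
  "(real \<Rightarrow> real \<Rightarrow> real) \<Rightarrow> nat \<Rightarrow> nat \<Rightarrow> (nat \<Rightarrow> real) \<Rightarrow> ((nat \<Rightarrow> real) \<Rightarrow> nat \<Rightarrow> nat) \<Rightarrow> real" where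
  "worst_risk f n k a \<phi> = (SUP \<theta>\<in>signal_class n k a. risk f n \<theta> \<phi>)"

definition minimax_risk ::
  "(real \<Rightarrow> real \<Rightarrow> real) \<Rightarrow> nat \<Rightarrow> nat \<Rightarrow> (nat \<Rightarrow> real) \<Rightarrow> real" where
  "minimax_risk f n k a = (INF \<psi>\<in>procedures n. worst_risk f n k a \<psi>)"

text \<open>
  The two-sided condition on the level \<open>\<alpha>\<close>, where \<open>l\<close> stands for the value of \<open>\<Lambda>\<close> (respectively
  \<open>2\<Lambda> - 1\<close>). Under the standing assumptions \<open>f 0\<close> is positive and \<open>tail f a t \<ge> tail f 0 t > 0\<close>
  for \<open>a, t > 0\<close>, so \<open>l < 1\<close> and the denominator does not vanish once \<open>k > 0\<close>.
\<close>

definition level_condition ::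
  "(real \<Rightarrow> real \<Rightarrow> real) \<Rightarrow> nat \<Rightarrow> real \<Rightarrow> real \<Rightarrow> nat \<Rightarrow> real \<Rightarrow> real \<Rightarrow> bool" where
  "level_condition f k t d n l \<alpha> \<longleftrightarrow>
     3 * real n * tail f 0 t / (real k * (1 - l)) \<le> \<alpha> \<and>
     \<alpha> \<le> min 1 (real n * tail f 0 (t - d) / real k)"

end

theory Submission
  imports Defs
begin

text \<open>
  Upper bound. Under independence the leave-one-out argument gives false discovery rate at most
  \<open>\<alpha>\<close> for the BH procedure. By Hoeffding's inequality the number of signals with
  \<open>\<bar>X\<^sub>i\<bar> \<ge> a\<^sub>n\<^sup>*\<close> is at least two thirds of its mean, except with exponentially small
  probability; the lower bound on \<open>\<alpha>\<close> then makes \<open>a\<^sub>n\<^sup>*\<close> admissible, so BH misses at most the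
  signals with \<open>\<bar>X\<^sub>i\<bar> < a\<^sub>n\<^sup>*\<close>.

  Lower bound. Cut \<open>{1..n}\<close> into \<open>s\<close> blocks of size \<open>m\<close>, about \<open>n/s\<close>, and put the signal
  \<open>a\<^sub>j\<close> at a uniform position of block \<open>j\<close>. A procedure rejecting more than \<open>K s\<close> hypotheses
  has false discovery proportion at least \<open>1 - 1/K\<close>, so one may cap the number of rejections at
  \<open>K s\<close>. Below the threshold \<open>t = a\<^sub>n\<^sup>* - \<delta>\<^sub>n\<close> the likelihood ratio is at most
  \<open>1 / tail f 0 t = o(m)\<close>. Hence the sum of the truncated likelihood ratios over a block
  concentrates, and a signal lying below \<open>t\<close> is hidden among the nulls of its block: it is found
  with probability at most \<open>o(1)\<close> times one plus the expected number of rejections in the block.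
  So the power is asymptotically at most that of rejecting everything above \<open>t\<close>.
\<close>

section \<open>The noise distributions\<close>

text \<open>Both symmetry cases run through one argument with a factor \<open>\<kappa>\<close>: a
  signal is seen beyond \<open>t\<close> with probability at least \<open>\<kappa>\<close> times a
  one-sided tail, and some region of mass at most \<open>\<kappa>\<close> times that tail carries
  all large values of the likelihood ratio. The second fact comes from monotonicity: the ratio at
  \<open>t\<close>, times \<open>tail f 0 t\<close>, is at most \<open>tail f a t\<close>, hence at
  most 1.

  The number of rejections in a single block cannot be controlled, only the total. The power bound
  of a block is therefore made linear in the expected number of rejections there, so that summing
  over blocks needs the cap on the total alone.

  No moments of the likelihood ratio are assumed under the null. Truncation supplies them: a
  nonnegative variable bounded by \<open>c\<close> has second moment at most \<open>c\<close> times
  its mean.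

  \<open>\<Lambda>\<close> may tend to 1, and then the exponential term need not vanish. The bounds
  that are uniform in the signal strengths use a dichotomy with the trivial bound
  \<open>1 + \<alpha>\<close> on the risk of BH.\<close>

abbreviation noise :: "(real \<Rightarrow> real \<Rightarrow> real) \<Rightarrow> real \<Rightarrow> real measure" where
  "noise f a \<equiv> density lborel (\<lambda>x. ennreal (f a x))"

locale noise_model =
  fixes f :: "real \<Rightarrow> real \<Rightarrow> real" and L :: real
  assumes dens: "density_family f"
    and sym0: "f 0 (- x) = f 0 x"
    and pos0: "0 < f 0 x"
    and lip: "L-lipschitz_on UNIV (df f a)"
begin

lemma density_nonneg: "0 \<le> f a x"
  using dens by (auto simp: density_family_def)

lemma has_integral_density: "has_bochner_integral lborel (f a) 1"
  using dens by (auto simp: density_family_def)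

lemma measurable_density [measurable]: "f a \<in> borel_measurable borel"
  using has_integral_density[of a] by (auto simp: has_bochner_integral_iff)

lemma nn_integral_density: "(\<integral>\<^sup>+x. ennreal (f a x) \<partial>lborel) = 1"
  using has_integral_density[of a] density_nonneg
  by (subst nn_integral_eq_integral) (auto simp: has_bochner_integral_iff)

lemma prob_space_noise: "prob_space (noise f a)"
  by (rule prob_spaceI) (simp add: emeasure_density nn_integral_density)

lemma measure_noise:
  assumes [measurable]: "A \<in> sets borel"
  shows "measure (noise f a) A = (LINT x:A|lborel. f a x)"
proof -
  have "integrable lborel (\<lambda>x. indicator A x * f a x)"
    using integrable_mult_indicator[of A lborel "f a"] has_integral_density[of a]
    by (simp add: has_bochner_integral_iff)
  then have "emeasure (noise f a) A = ennreal (LINT x:A|lborel. f a x)"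
    unfolding set_lebesgue_integral_def
    by (subst nn_integral_eq_integral[symmetric])
       (auto simp: emeasure_density density_nonneg ennreal_mult' mult.commute
             split: split_indicator intro!: nn_integral_cong)
  then show ?thesis
    by (auto simp: measure_def set_lebesgue_integral_def density_nonneg intro!: integral_nonneg_AE)
qed

lemma df_measure: "df f a x = measure (noise f a) {..x}"
  by (simp add: df_def measure_noise)

lemma tail_measure: "tail f a x = measure (noise f a) {x<..}"
proof -
  interpret prob_space "noise f a" by (rule prob_space_noise)
  have "{x<..} = UNIV - {..x}" by auto
  then show ?thesis using prob_compl[of "{..x}"] by (simp add: tail_def df_measure)
qed

lemma noise_null_singleton: "measure (noise f a) {x} = 0"
  by (simp add: measure_def emeasure_density nn_integral_0_iff_AE
        AE_iff_measurable[where N="{x}"] split: split_indicator)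

lemma tail_measure_ge: "tail f a x = measure (noise f a) {x..}"
proof -
  interpret prob_space "noise f a" by (rule prob_space_noise)
  have "{x..} = {x} \<union> {x<..}" by auto
  then show ?thesis
    by (subst \<open>{x..} = _\<close>, subst finite_measure_Union) (auto simp: tail_measure noise_null_singleton)
qed

lemma tail_nonneg: "0 \<le> tail f a x" and tail_le_1: "tail f a x \<le> 1"
  using prob_space.prob_le_1[OF prob_space_noise] by (auto simp: tail_measure)

lemma tail_antimono: "x \<le> y \<Longrightarrow> tail f a y \<le> tail f a x"
  unfolding tail_measure
  by (rule finite_measure.finite_measure_mono)
     (auto intro: prob_space.finite_measure prob_space_noise)

text \<open>The Lipschitz constant enters the final error here: the lower bound works at the
  threshold \<open>astar n - \<delta> n\<close>, and moving its tails to \<open>astar n\<close>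
  costs \<open>L * \<delta> n\<close>.\<close>

lemma tail_shift:
  assumes "0 \<le> d" shows "tail f a (x - d) \<le> tail f a x + L * d"
  using lipschitz_onD[OF lip, of "x - d" x a] assms by (auto simp: tail_def dist_real_def)

lemma measurable_df [measurable]: "df f a \<in> borel_measurable borel"
  by (intro borel_measurable_continuous_onI lipschitz_on_continuous_on[OF lip])

lemma measurable_tail [measurable]: "tail f a \<in> borel_measurable borel"
  unfolding tail_def[abs_def] by measurable

lemma continuous_tail: "continuous_on UNIV (tail f a)"
  unfolding tail_def[abs_def]
  by (intro continuous_intros lipschitz_on_continuous_on[OF lip])

text \<open>Two parameters \<open>a\<close> and \<open>b\<close> because case (A) reflects
  \<open>f a\<close> into \<open>f (- a)\<close>, while case (B) reflects it into itself.\<close>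

lemma noise_reflect:
  assumes [measurable]: "A \<in> sets borel" and r: "\<And>x. f a (- x) = f b x"
  shows "measure (noise f a) (uminus ` A) = measure (noise f b) A"
proof -
  have eq: "uminus ` A = uminus -` A"
    by (auto simp: image_iff) (metis minus_minus)
  have [measurable]: "uminus -` A \<in> sets borel"
    using measurable_sets[of uminus borel borel A] by simp
  have "emeasure (noise f a) (uminus -` A) = (\<integral>\<^sup>+x. ennreal (f a x) * indicator (uminus -` A) x \<partial>lborel)"
    by (simp add: emeasure_density)
  also have "\<dots> = (\<integral>\<^sup>+x. ennreal (f a (-x)) * indicator (uminus -` A) (- x) \<partial>lborel)"
    by (subst nn_integral_real_affine[where c="-1" and t=0]) (auto simp: one_ennreal_def[symmetric])
  also have "\<dots> = emeasure (noise f b) A"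
    by (simp add: emeasure_density r indicator_def)
  finally show ?thesis by (simp add: measure_def eq)
qed

lemma two_sided_tail:
  assumes r: "\<And>x. f a (- x) = f a x" and t: "0 < t"
  shows "measure (noise f a) {x. t \<le> \<bar>x\<bar>} = 2 * tail f a t"
proof -
  interpret prob_space "noise f a" by (rule prob_space_noise)
  have "uminus ` {t..} = {..-t}" by simp
  with noise_reflect[of "{t..}" a a, OF _ r] have "measure (noise f a) {..-t} = tail f a t"
    by (simp add: tail_measure_ge)
  moreover have "{x. t \<le> \<bar>x\<bar>} = {..-t} \<union> {t..}" by auto
  ultimately show ?thesis
    by (subst \<open>{x. t \<le> \<bar>x\<bar>} = _\<close>, subst finite_measure_Union) (use t in \<open>auto simp: tail_measure_ge\<close>)
qed

lemma tail_symmetric_0: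
  assumes r: "\<And>x. f a (- x) = f a x"
  shows "tail f a 0 = 1 / 2"
proof -
  have "uminus ` {0::real<..} = {..<0}" by simp
  with noise_reflect[of "{0<..}" a a, OF _ r] have 1: "measure (noise f a) {..<0} = tail f a 0"
    by (simp add: tail_measure)
  interpret prob_space "noise f a" by (rule prob_space_noise)
  have "{0..} = UNIV - {..<0::real}" by auto
  then have "tail f a 0 = 1 - measure (noise f a) {..<0}"
    using prob_compl[of "{..<0}"] by (simp add: tail_measure_ge)
  with 1 show ?thesis by simp
qed

lemmas tail0_0 = tail_symmetric_0[OF sym0]

lemma measure_noise_pos:
  assumes "x < y" shows "0 < measure (noise f 0) {x<..<y}"
proof (rule ccontr)
  assume "\<not> ?thesis"
  then have "measure (noise f 0) {x<..<y} = 0"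
    by (simp add: measure_nonneg order_antisym not_less)
  then have "emeasure (noise f 0) {x<..<y} = 0"
    by (simp add: finite_measure.emeasure_eq_measure[OF prob_space.finite_measure[OF prob_space_noise]])
  then have "AE z in lborel. ennreal (f 0 z) * indicator {x<..<y} z = 0"
    by (subst nn_integral_0_iff_AE[symmetric]) (simp_all add: emeasure_density)
  then have "AE z in lborel. z \<notin> {x<..<y}"
  proof eventually_elim
    case (elim z)
    then show ?case using pos0[of z] by (simp add: indicator_def split: if_splits)
  qed
  then have "emeasure lborel {x<..<y} = 0"
    by (subst (asm) AE_iff_measurable[where N="{x<..<y}"]) auto
  then show False using assms by simp
qed

text \<open>Every interval has positive mass because \<open>f 0\<close> is positive. Strictness
  turns a level of the tail into an exact threshold in \<open>null_pvalue\<close> and makes the tail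
  positive everywhere.\<close>

lemma tail0_strict: assumes "x < y" shows "tail f 0 y < tail f 0 x"
proof -
  interpret prob_space "noise f 0" by (rule prob_space_noise)
  have "measure (noise f 0) ({x<..<y} \<union> {y..}) = measure (noise f 0) {x<..<y} + tail f 0 y"
    by (subst finite_measure_Union) (auto simp: tail_measure_ge)
  moreover have "measure (noise f 0) ({x<..<y} \<union> {y..}) \<le> tail f 0 x"
    unfolding tail_measure using assms by (intro finite_measure_mono) auto
  ultimately show ?thesis using measure_noise_pos[OF assms] by simp
qed

lemma tail0_pos: "0 < tail f 0 x"
  using tail0_strict[of x "x + 1"] tail_nonneg[of 0 "x + 1"] by simp

lemma tail_tendsto_0: "(tail f a \<longlongrightarrow> 0) at_top"
proof -
  interpret prob_space "noise f a" by (rule prob_space_noise)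
  interpret real_distribution "noise f a" by standard auto
  have "(cdf (noise f a) \<longlongrightarrow> 1) at_top" by (rule cdf_lim_at_top_prob)
  then have "((\<lambda>x. 1 - cdf (noise f a) x) \<longlongrightarrow> 1 - 1) at_top" by (intro tendsto_intros)
  moreover have "tail f a = (\<lambda>x. 1 - cdf (noise f a) x)"
    by (auto simp: tail_def df_measure cdf_def)
  ultimately show ?thesis by simp
qed

text \<open>The two-sided p-value of a null is exactly uniform: continuity yields a point
  \<open>t\<close> where the tail equals \<open>u / 2\<close>, strict monotonicity turns the event
  into \<open>t \<le> \<bar>y\<bar>\<close>, and symmetry gives that event mass
  \<open>u\<close>.\<close>

lemma null_pvalue:
  assumes "0 < u" "u \<le> 1"
  shows "measure (noise f 0) {y. 2 * tail f 0 \<bar>y\<bar> \<le> u} = u"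
proof -
  obtain t where t: "0 \<le> t" "2 * tail f 0 t = u"
  proof -
    have "eventually (\<lambda>x. tail f 0 x < u / 2) at_top"
      by (rule order_tendstoD(2)[OF tail_tendsto_0]) (use assms in simp)
    then obtain c where "\<And>x. c \<le> x \<Longrightarrow> tail f 0 x < u / 2"
      by (auto simp: eventually_at_top_linorder)
    then have b: "tail f 0 (max c 0) < u / 2" "0 \<le> max c 0" by auto
    have "\<exists>t\<ge>0. t \<le> max c 0 \<and> tail f 0 t = u / 2"
      by (rule IVT2') (use b assms tail0_0 continuous_on_subset[OF continuous_tail] in auto)
    then show ?thesis using that by auto
  qed
  have iff: "2 * tail f 0 \<bar>y\<bar> \<le> u \<longleftrightarrow> t \<le> \<bar>y\<bar>" for y
  proof (cases "t \<le> \<bar>y\<bar>")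
    case True
    then show ?thesis using t tail_antimono[OF True, of 0] by simp
  next
    case False
    then show ?thesis using t tail0_strict[of "\<bar>y\<bar>" t] by simp
  qed
  have set_eq: "{y. 2 * tail f 0 \<bar>y\<bar> \<le> u} = {y. t \<le> \<bar>y\<bar>}" by (simp only: iff)
  show ?thesis
  \<comment> \<open>\<open>two_sided_tail\<close> needs a positive threshold. The point
    \<open>t = 0\<close> corresponds to \<open>u = 1\<close>, where the event is the whole
    line.\<close>
  proof (cases "t = 0")
    case True
    then have "u = 1" using t tail0_0 by simp
    then show ?thesis using True prob_space.prob_space[OF prob_space_noise[of 0]]
      unfolding set_eq by simp
  next
    case False
    then show ?thesis using t two_sided_tail[of 0 t] sym0 unfolding set_eq by simp
  qed
qed

end

section \<open>The BH procedure as a step-up procedure\<close>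

text \<open>The number of rejections in the usual ordered p-value form of BH. The value 0 always
  qualifies, so the maximum is over a nonempty finite set.\<close>

definition step_up :: "nat \<Rightarrow> real \<Rightarrow> (nat \<Rightarrow> real) \<Rightarrow> nat" where
  "step_up n \<alpha> p = Max {r. r \<le> n \<and> r \<le> card {k \<in> {1..n}. p k \<le> \<alpha> * real r / real n}}"

lemma card_filter_le: "card {k \<in> {1..n}. P k} \<le> n"
proof -
  have "card {k \<in> {1..n}. P k} \<le> card {1..n}" by (intro card_mono) auto
  then show ?thesis by simp
qed

lemma step_up_ge:
  "r \<le> card {k \<in> {1..n}. p k \<le> \<alpha> * real r / real n} \<Longrightarrow> r \<le> step_up n \<alpha> p"
  unfolding step_up_def using card_filter_le[of n] by (intro Max_ge) (auto intro: order_trans)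

lemma step_up_le: "step_up n \<alpha> p \<le> n"
  and step_up_le_card: "step_up n \<alpha> p \<le> card {k \<in> {1..n}. p k \<le> \<alpha> * real (step_up n \<alpha> p) / real n}"
proof -
  let ?S = "{r. r \<le> n \<and> r \<le> card {k \<in> {1..n}. p k \<le> \<alpha> * real r / real n}}"
  have "Max ?S \<in> ?S" by (rule Max_in) auto
  then show "step_up n \<alpha> p \<le> n"
    "step_up n \<alpha> p \<le> card {k \<in> {1..n}. p k \<le> \<alpha> * real (step_up n \<alpha> p) / real n}"
    by (simp_all add: step_up_def)
qed

text \<open>If more than \<open>step_up n \<alpha> p\<close> p-values lay below the cutoff, their
  number would itself qualify, since passing to it only raises the cutoff; this contradicts
  maximality.\<close>

lemma card_step_up:
  assumes "0 \<le> \<alpha>"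
  shows "card {k \<in> {1..n}. p k \<le> \<alpha> * real (step_up n \<alpha> p) / real n} = step_up n \<alpha> p"
    (is "?c = ?R")
proof (rule antisym)
  have "\<alpha> * real ?R / real n \<le> \<alpha> * real ?c / real n"
    using assms step_up_le_card[of n \<alpha> p] by (intro divide_right_mono mult_left_mono) auto
  then show "?c \<le> ?R"
    by (intro step_up_ge card_mono) (auto intro: order_trans)
qed (rule step_up_le_card)

text \<open>On the event that \<open>i\<close> is rejected, the number of rejections is a function of the other
  p-values only; this is what makes the false discovery rate computable by conditioning.\<close>

lemma step_up_leave_one_out:
  assumes "0 \<le> \<alpha>" "0 \<le> p i" and i: "p i \<le> \<alpha> * real (step_up n \<alpha> p) / real n"
  shows "step_up n \<alpha> (p(i := 0)) = step_up n \<alpha> p" (is "?R' = ?R")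
proof (rule antisym)
  show le: "?R \<le> ?R'"
    using assms by (intro step_up_ge order_trans[OF step_up_le_card] card_mono) auto
  have "\<alpha> * real ?R / real n \<le> \<alpha> * real ?R' / real n"
    using assms le by (intro divide_right_mono mult_left_mono) auto
  with i have "p i \<le> \<alpha> * real ?R' / real n" by simp
  then show "?R' \<le> ?R"
    by (intro step_up_ge order_trans[OF step_up_le_card] card_mono) (auto split: if_splits)
qed

text \<open>Applied with the \<open>i\<close>-th p-value set to 0, this keeps the leave-one-out
  count positive, so that one may divide by it.\<close>

lemma step_up_pos:
  assumes "0 \<le> \<alpha>" "i \<in> {1..n}" "p i = 0" shows "1 \<le> step_up n \<alpha> p"
proof (rule step_up_ge)
  have "card {i} \<le> card {k \<in> {1..n}. p k \<le> \<alpha> * real 1 / real n}"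
    using assms by (intro card_mono) auto
  then show "1 \<le> card {k \<in> {1..n}. p k \<le> \<alpha> * real 1 / real n}" by simp
qed

lemma measurable_step_up [measurable]:
  assumes [measurable]: "\<And>k. k \<in> {1..n} \<Longrightarrow> (\<lambda>x. p x k) \<in> borel_measurable M"
  shows "(\<lambda>x. step_up n \<alpha> (p x)) \<in> M \<rightarrow>\<^sub>M count_space UNIV"
proof -
  have [measurable]: "Measurable.pred M (\<lambda>x. k \<in> {1..n} \<and> p x k \<le> c)" for k c
    by (cases "k \<in> {1..n}") auto
  show ?thesis unfolding step_up_def by simp
qed

context noise_model
begin

section \<open>P-values and the existence of the BH threshold\<close>

definition pval :: "real \<Rightarrow> real" where
  "pval y = 2 * tail f 0 \<bar>y\<bar>"

lemma pval_nonneg: "0 \<le> pval y"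
  by (simp add: pval_def tail_nonneg)

lemma measurable_pval [measurable]: "pval \<in> borel_measurable borel"
  unfolding pval_def[abs_def] by measurable

text \<open>\<open>LEAST\<close> carries information only once a least element is known to exist;
  here it comes from closedness and a lower bound for the set of admissible reals.\<close>

lemma BH_threshold_least:
  fixes x :: "nat \<Rightarrow> real"
  assumes \<alpha>: "0 < \<alpha>" "\<alpha> \<le> 1" and n: "0 < n"
  defines "admissible \<equiv> \<lambda>t. t = \<infinity> \<or> (\<exists>r. t = ereal r \<and>
     2 * tail f 0 r / \<alpha> \<le> real (card {i \<in> {1..n}. r \<le> \<bar>x i\<bar>}) / real n)"
  shows "admissible (BH_threshold f n \<alpha> x)" "admissible t \<Longrightarrow> BH_threshold f n \<alpha> x \<le> t"
proof -
  have thr: "BH_threshold f n \<alpha> x = (LEAST t. admissible t)"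
    by (simp add: BH_threshold_def admissible_def)
  have "\<exists>t. admissible t \<and> (\<forall>u. admissible u \<longrightarrow> t \<le> u)"
  proof (cases "\<exists>r. admissible (ereal r)")
    case False
    have "\<infinity> \<le> u" if "admissible u" for u
    proof -
      from that have "u = \<infinity> \<or> (\<exists>r. u = ereal r)" by (auto simp: admissible_def)
      with that False show ?thesis by auto
    qed
    moreover have "admissible \<infinity>" by (simp add: admissible_def)
    ultimately show ?thesis by blast
  next
    case True
    define C where "C = {r. admissible (ereal r)}"
    \<comment> \<open>The count of exceedances jumps in \<open>r\<close>. Fixing a set
      \<open>A\<close> of exceeding coordinates replaces it by a constant, which exhibits
      \<open>C\<close> as a finite union of closed sets.\<close>
    have C_eq: "C = (\<Union>A\<in>Pow {1..n}. {r. \<forall>k\<in>A. r \<le> \<bar>x k\<bar>} \<inter>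
                       {r. 2 * tail f 0 r / \<alpha> \<le> real (card A) / real n})" (is "_ = ?U")
    proof (intro set_eqI iffI)
      fix r assume "r \<in> C"
      then show "r \<in> ?U"
        by (intro UN_I[of "{i \<in> {1..n}. r \<le> \<bar>x i\<bar>}"]) (auto simp: C_def admissible_def)
    next
      fix r assume "r \<in> ?U"
      then obtain A where A: "A \<subseteq> {1..n}" "\<forall>k\<in>A. r \<le> \<bar>x k\<bar>"
        "2 * tail f 0 r / \<alpha> \<le> real (card A) / real n" by auto
      have "card A \<le> card {i \<in> {1..n}. r \<le> \<bar>x i\<bar>}" using A by (intro card_mono) auto
      then have "real (card A) / real n \<le> real (card {i \<in> {1..n}. r \<le> \<bar>x i\<bar>}) / real n"
        by (intro divide_right_mono) auto
      with A show "r \<in> C" by (auto simp: C_def admissible_def)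
    qed
    have "closed C" unfolding C_eq
    proof (intro closed_UN ballI closed_Int)
      fix A assume "A \<in> Pow {1..n}"
      have "{r. \<forall>k\<in>A. r \<le> \<bar>x k\<bar>} = (\<Inter>k\<in>A. {..\<bar>x k\<bar>})" by auto
      then show "closed {r. \<forall>k\<in>A. r \<le> \<bar>x k\<bar>}" by (simp add: closed_INT)
      show "closed {r. 2 * tail f 0 r / \<alpha> \<le> real (card A) / real n}"
        using \<alpha> by (intro closed_Collect_le continuous_intros continuous_tail) auto
    qed simp
    moreover have "C \<noteq> {}" using True by (auto simp: C_def)
    \<comment> \<open>For negative \<open>r\<close> the tail exceeds its value \<open>1 / 2\<close>
      at 0, so with \<open>\<alpha> \<le> 1\<close> the required proportion would exceed 1.\<close>
    moreover have lower: "0 \<le> r" if "r \<in> C" for r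
    proof (rule ccontr)
      assume "\<not> 0 \<le> r"
      then have "1 < 2 * tail f 0 r" using tail0_strict[of r 0] tail0_0 by simp
      also have "\<dots> \<le> 2 * tail f 0 r / \<alpha>"
        using \<alpha> tail_nonneg[of 0 r] by (simp add: field_simps mult_left_le_one_le)
      also have "\<dots> \<le> real (card {i \<in> {1..n}. r \<le> \<bar>x i\<bar>}) / real n"
        using that by (simp add: C_def admissible_def)
      also have "\<dots> \<le> 1" using card_filter_le[of n "\<lambda>i. r \<le> \<bar>x i\<bar>"] n by simp
      finally show False by simp
    qed
    moreover have "bdd_below C" using lower by (rule bdd_belowI)
    ultimately have "Inf C \<in> C" "\<And>r. r \<in> C \<Longrightarrow> Inf C \<le> r"
      using closed_contains_Inf cInf_lower by auto
    then show ?thesis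
      by (intro exI[of _ "ereal (Inf C)"]) (auto simp: C_def admissible_def)
  qed
  then obtain t0 where t0: "admissible t0" "\<And>u. admissible u \<Longrightarrow> t0 \<le> u" by blast
  then have "BH_threshold f n \<alpha> x = t0" unfolding thr by (intro Least_equality) auto
  with t0 show "admissible (BH_threshold f n \<alpha> x)" "admissible t \<Longrightarrow> BH_threshold f n \<alpha> x \<le> t"
    by auto
qed

text \<open>Passes from the threshold form of BH to the step-up form, where the leave-one-out
  argument is available. The number of observations beyond an admissible threshold satisfies the
  step-up criterion.\<close>

lemma BH_threshold_le_iff:
  assumes \<alpha>: "0 < \<alpha>" "\<alpha> \<le> 1" and i: "i \<in> {1..n}"
  shows "BH_threshold f n \<alpha> x \<le> ereal \<bar>x i\<bar> \<longleftrightarrow>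
    pval (x i) \<le> \<alpha> * real (step_up n \<alpha> (\<lambda>k. pval (x k))) / real n"
    (is "?T \<le> _ \<longleftrightarrow> _ \<le> \<alpha> * real ?R / real n")
proof
  have n: "0 < n" using i by auto
  note least = BH_threshold_least[OF \<alpha> n, where x = x]
  {
    assume le: "?T \<le> ereal \<bar>x i\<bar>"
    then obtain r where r: "?T = ereal r"
      "2 * tail f 0 r / \<alpha> \<le> real (card {k \<in> {1..n}. r \<le> \<bar>x k\<bar>}) / real n"
      using least(1) by auto
    let ?m = "card {k \<in> {1..n}. r \<le> \<bar>x k\<bar>}"
    have m: "2 * tail f 0 r \<le> \<alpha> * real ?m / real n"
      using r(2) \<alpha> by (simp add: field_simps)
    have p: "pval (x k) \<le> \<alpha> * real ?m / real n" if "r \<le> \<bar>x k\<bar>" for k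
      using tail_antimono[OF that, of 0] m by (simp add: pval_def)
    have "?m \<le> ?R"
      using p by (intro step_up_ge card_mono) auto
    then have "\<alpha> * real ?m / real n \<le> \<alpha> * real ?R / real n"
      using \<alpha> by (intro divide_right_mono mult_left_mono) auto
    with p[of i] le r(1) show "pval (x i) \<le> \<alpha> * real ?R / real n" by simp
  next
    assume le: "pval (x i) \<le> \<alpha> * real ?R / real n"
    let ?A = "{k \<in> {1..n}. pval (x k) \<le> \<alpha> * real ?R / real n}"
    \<comment> \<open>Conversely, the smallest rejected \<open>\<bar>x k\<bar>\<close> is
      admissible: its own p-value is below the cutoff, and at least \<open>step_up\<close> many
      observations lie at or above it.\<close>
    define r where "r = Min ((\<lambda>k. \<bar>x k\<bar>) ` ?A)"
    have A: "finite ?A" "i \<in> ?A" using i le by auto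
    then have "r \<in> (\<lambda>k. \<bar>x k\<bar>) ` ?A" unfolding r_def by (intro Min_in) auto
    then obtain j where j: "j \<in> ?A" "r = \<bar>x j\<bar>" by auto
    have rle: "r \<le> \<bar>x k\<bar>" if "k \<in> ?A" for k unfolding r_def using A that by (intro Min_le) auto
    have "?R \<le> card ?A" by (rule step_up_le_card)
    also have "card ?A \<le> card {k \<in> {1..n}. r \<le> \<bar>x k\<bar>}" using rle by (intro card_mono) auto
    finally have "\<alpha> * real ?R / real n \<le> \<alpha> * real (card {k \<in> {1..n}. r \<le> \<bar>x k\<bar>}) / real n"
      using \<alpha> by (intro divide_right_mono mult_left_mono) auto
    moreover have "2 * tail f 0 r \<le> \<alpha> * real ?R / real n" using j by (auto simp: pval_def)
    ultimately have "2 * tail f 0 r / \<alpha> \<le> real (card {k \<in> {1..n}. r \<le> \<bar>x k\<bar>}) / real n"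
      using \<alpha> by (simp add: field_simps)
    then have "?T \<le> ereal r" by (intro least(2)) auto
    also have "ereal r \<le> ereal \<bar>x i\<bar>" using rle A by simp
    finally show "?T \<le> ereal \<bar>x i\<bar>" .
  }
qed

lemma BH_eq:
  assumes "0 < \<alpha>" "\<alpha> \<le> 1"
  shows "BH f n \<alpha> = (\<lambda>x. \<lambda>i\<in>{1..n}.
    of_bool (pval (x i) \<le> \<alpha> * real (step_up n \<alpha> (\<lambda>k. pval (x k))) / real n))"
  unfolding BH_def using BH_threshold_le_iff[OF assms]
  by (intro ext) (auto simp: restrict_def)

lemma sum_BH:
  assumes "0 < \<alpha>" "\<alpha> \<le> 1"
  shows "(\<Sum>i\<in>{1..n}. real (BH f n \<alpha> x i)) = real (step_up n \<alpha> (\<lambda>k. pval (x k)))"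
proof -
  let ?R = "step_up n \<alpha> (\<lambda>k. pval (x k))"
  have "(\<Sum>i\<in>{1..n}. real (BH f n \<alpha> x i)) =
      (\<Sum>i\<in>{1..n}. of_bool (pval (x i) \<le> \<alpha> * real ?R / real n))"
    using assms by (intro sum.cong) (auto simp: BH_eq)
  also have "\<dots> = real (card {i \<in> {1..n}. pval (x i) \<le> \<alpha> * real ?R / real n})"
    by (subst sum_of_bool_eq) (auto simp: Int_def)
  finally show ?thesis using card_step_up[of \<alpha> n "\<lambda>k. pval (x k)"] assms by simp
qed

lemma BH_procedure:
  assumes "0 < \<alpha>" "\<alpha> \<le> 1"
  shows "BH f n \<alpha> \<in> procedures n"
  unfolding procedures_def BH_eq[OF assms]
proof (rule measurable_restrict)
  fix i assume i: "i \<in> {1..n}"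
  let ?M = "\<Pi>\<^sub>M i\<in>{1..n}. (borel :: real measure)"
  have [measurable]: "(\<lambda>x. x k) \<in> ?M \<rightarrow>\<^sub>M borel" if "k \<in> {1..n}" for k
    using that by (rule measurable_component_singleton)
  have [measurable]: "Measurable.pred ?M
      (\<lambda>x. pval (x i) \<le> \<alpha> * real (step_up n \<alpha> (\<lambda>k. pval (x k))) / real n)"
    using i by measurable
  show "(\<lambda>x. of_bool (pval (x i) \<le> \<alpha> * real (step_up n \<alpha> (\<lambda>k. pval (x k))) / real n))
    \<in> ?M \<rightarrow>\<^sub>M count_space {0, 1}"
    unfolding of_bool_def by measurable
qed

end

section \<open>Risk of the BH procedure\<close>

context noise_model
begin

section \<open>The product law and its coordinates\<close>

lemma sets_law: "sets (law f n \<theta>) = sets (\<Pi>\<^sub>M i\<in>{1..n}. borel)"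
  unfolding law_def by (intro sets_PiM_cong) auto

lemma prob_space_law: "prob_space (law f n \<theta>)"
  unfolding law_def by (intro prob_space_PiM prob_space_noise)

lemma measurable_coordinate:
  "i \<in> {1..n} \<Longrightarrow> (\<lambda>x. x i) \<in> law f n \<theta> \<rightarrow>\<^sub>M borel"
  by (subst measurable_cong_sets[OF sets_law refl]) (rule measurable_component_singleton)

lemma distr_coordinate:
  assumes "i \<in> {1..n}" shows "distr (law f n \<theta>) borel (\<lambda>x. x i) = noise f (\<theta> i)"
proof -
  have "distr (law f n \<theta>) borel (\<lambda>x. x i) = distr (law f n \<theta>) (noise f (\<theta> i)) (\<lambda>x. x i)"
    by (intro distr_cong) auto
  also have "\<dots> = noise f (\<theta> i)"
    unfolding law_def using assms by (intro distr_PiM_component prob_space_noise) auto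
  finally show ?thesis .
qed

lemma measure_coordinate:
  assumes i: "i \<in> {1..n}" and [measurable]: "A \<in> sets borel"
  shows "measure (law f n \<theta>) {x \<in> space (law f n \<theta>). x i \<in> A} = measure (noise f (\<theta> i)) A"
  by (subst distr_coordinate[OF i, symmetric], subst measure_distr[OF measurable_coordinate[OF i]])
    (auto intro!: arg_cong2[where f=measure])

lemma indep_vars_coordinates:
  assumes "I \<subseteq> {1..n}"
  shows "prob_space.indep_vars (law f n \<theta>) (\<lambda>_. borel) (\<lambda>i x. x i) I"
proof -
  interpret prob_space "law f n \<theta>" by (rule prob_space_law)
  have "indep_vars (\<lambda>_. borel) (\<lambda>i x. x i) {1..n}"
  \<comment> \<open>The characterisation of independence by the product of the marginals asks for a
    nonempty index set.\<close>
  proof (cases "n = 0")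
    case True
    then show ?thesis unfolding indep_vars_def indep_sets_def by auto
  next
    case False
    have [measurable]: "(\<lambda>x. x i) \<in> law f n \<theta> \<rightarrow>\<^sub>M borel" if "i \<in> {1..n}" for i
      using that by (rule measurable_coordinate)
    have "distr (law f n \<theta>) (PiM {1..n} (\<lambda>_. borel)) (\<lambda>x. \<lambda>i\<in>{1..n}. x i)
        = distr (law f n \<theta>) (law f n \<theta>) (\<lambda>x. x)"
    proof (rule distr_cong)
      fix x assume "x \<in> space (law f n \<theta>)"
      then show "restrict x {1..n} = x"
        by (auto simp: law_def space_PiM PiE_def intro: extensional_restrict)
    qed (simp_all only: sets_law)
    also have "\<dots> = law f n \<theta>" by (rule distr_id2) simp
    also have "\<dots> = PiM {1..n} (\<lambda>i. noise f (\<theta> i))" by (rule law_def)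
    also have "\<dots> = PiM {1..n} (\<lambda>i. distr (law f n \<theta>) borel (\<lambda>x. x i))"
      by (intro PiM_cong) (simp_all only: distr_coordinate)
    finally show ?thesis
      using False by (subst indep_vars_iff_distr_eq_PiM') auto
  qed
  then show ?thesis using assms by (rule indep_vars_subset)
qed

lemma measurable_procedure:
  assumes "\<phi> \<in> procedures n" "i \<in> {1..n}"
  shows "(\<lambda>x. real (\<phi> x i)) \<in> borel_measurable (law f n \<theta>)"
proof -
  have "(\<lambda>x. \<phi> x i) \<in> law f n \<theta> \<rightarrow>\<^sub>M count_space {0, 1}"
    using measurable_compose[OF _ measurable_component_singleton, of \<phi> "law f n \<theta>" "{1..n}"
        "\<lambda>_. count_space {0, 1}" i] assms
    by (simp add: procedures_def measurable_cong_sets[OF sets_law refl])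
  then show ?thesis by (rule measurable_compose) simp
qed

lemma procedure_cases:
  assumes "\<phi> \<in> procedures n" "i \<in> {1..n}" "x \<in> space (law f n \<theta>)"
  shows "\<phi> x i = 0 \<or> \<phi> x i = 1"
proof -
  have "space (law f n \<theta>) = space (\<Pi>\<^sub>M i\<in>{1..n}. (borel :: real measure))"
    by (rule sets_eq_imp_space_eq[OF sets_law])
  then have "\<phi> x \<in> space (\<Pi>\<^sub>M i\<in>{1..n}. count_space {0, 1 :: nat})"
    using assms by (auto simp: procedures_def dest: measurable_space)
  with assms(2) show ?thesis by (auto simp: space_PiM PiE_iff)
qed

text \<open>Fix the coordinates other than \<open>i\<close>. The count \<open>R\<close>, computed
  with the \<open>i\<close>-th p-value replaced by 0, is then a constant \<open>r\<close>, at least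
  1. By uniformity of the null p-value the dominating function \<open>h\<close> has inner integral
  \<open>1 / r\<close> times \<open>\<alpha> * r / n\<close>, and \<open>r\<close> cancels.\<close>

lemma BH_null_rejection:
  assumes \<alpha>: "0 < \<alpha>" "\<alpha> \<le> 1" and i: "i \<in> {1..n}" "\<theta> i = 0"
  shows "(LINT x|law f n \<theta>. real (BH f n \<alpha> x i) / max 1 (\<Sum>k\<in>{1..n}. real (BH f n \<alpha> x k))) \<le> \<alpha> / real n"
proof -
  have n: "0 < n" using i by auto
  define R where "R x = step_up n \<alpha> ((\<lambda>k. pval (x k))(i := 0))" for x :: "nat \<Rightarrow> real"
  define h where "h x = (if pval (x i) \<le> \<alpha> * real (R x) / real n then 1 / real (R x) else 0)" for x
  have R: "1 \<le> R x" "R x \<le> n" for x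
    using step_up_pos[of \<alpha> i n "(\<lambda>k. pval (x k))(i := 0)"] \<alpha> i by (auto simp: R_def step_up_le)
  have bound: "real (BH f n \<alpha> x i) / max 1 (\<Sum>k\<in>{1..n}. real (BH f n \<alpha> x k)) \<le> h x" for x
  proof (cases "pval (x i) \<le> \<alpha> * real (step_up n \<alpha> (\<lambda>k. pval (x k))) / real n")
    case True
    then have "R x = step_up n \<alpha> (\<lambda>k. pval (x k))"
      unfolding R_def using \<alpha> pval_nonneg by (intro step_up_leave_one_out) auto
    with True R(1)[of x] i show ?thesis unfolding sum_BH[OF \<alpha>] by (simp add: BH_eq[OF \<alpha>] h_def)
  next
    case False
    then show ?thesis using i by (simp add: BH_eq[OF \<alpha>] h_def)
  qed
  have R_meas: "R \<in> law f n \<theta> \<rightarrow>\<^sub>M count_space UNIV"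
    unfolding R_def
  proof (rule measurable_step_up)
    fix k assume k: "k \<in> {1..n}"
    then have [measurable]: "(\<lambda>x. x k) \<in> law f n \<theta> \<rightarrow>\<^sub>M borel" by (rule measurable_coordinate)
    show "(\<lambda>x. ((\<lambda>k. pval (x k))(i := 0)) k) \<in> borel_measurable (law f n \<theta>)"
      by (cases "k = i") auto
  qed
  have [measurable]: "(\<lambda>x. real (R x)) \<in> borel_measurable (law f n \<theta>)"
    by (rule measurable_compose[OF R_meas]) simp
  have [measurable]: "(\<lambda>x. pval (x i)) \<in> borel_measurable (law f n \<theta>)"
    by (rule measurable_compose[OF measurable_coordinate[OF i(1)] measurable_pval])
  have [measurable]: "h \<in> borel_measurable (law f n \<theta>)" unfolding h_def by measurable
  have h: "0 \<le> h x" "h x \<le> 1" for x using R(1)[of x] by (auto simp: h_def)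
  let ?J = "{1..n} - {i}"
  let ?M = "\<lambda>k. noise f (\<theta> k)"
  interpret M: product_sigma_finite ?M
    unfolding product_sigma_finite_def
    using prob_space_noise by (auto intro: prob_space_imp_sigma_finite)
  have ins: "insert i ?J = {1..n}" using i by auto
  have inner: "(\<integral>\<^sup>+y. ennreal (h (x(i := y))) \<partial>?M i) \<le> ennreal (\<alpha> / real n)" for x
  proof -
    define r where "r = R x"
    have r: "1 \<le> r" "r \<le> n" using R by (auto simp: r_def)
    define u where "u = \<alpha> * real r / real n"
    \<comment> \<open>\<open>\<alpha> \<le> 1\<close> and \<open>r \<le> n\<close> keep the cutoff
      in the range where \<open>null_pvalue\<close> applies.\<close>
    have "\<alpha> * real r \<le> 1 * real n" using \<alpha> r by (intro mult_mono) auto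
    then have u: "0 < u" "u \<le> 1" using \<alpha> r n by (auto simp: u_def)
    have "R (x(i := y)) = r" for y
      unfolding R_def r_def by (intro arg_cong[where f="step_up n \<alpha>"]) auto
    then have "ennreal (h (x(i := y))) = ennreal (1 / real r) * indicator {y. 2 * tail f 0 \<bar>y\<bar> \<le> u} y" for y
      by (simp add: h_def u_def pval_def indicator_def)
    then have "(\<integral>\<^sup>+y. ennreal (h (x(i := y))) \<partial>?M i) =
        ennreal (1 / real r) * emeasure (noise f 0) {y. 2 * tail f 0 \<bar>y\<bar> \<le> u}"
      by (simp add: nn_integral_cmult_indicator i)
    also have "\<dots> = ennreal (1 / real r) * ennreal u"
      using null_pvalue[OF u]
      by (simp add: finite_measure.emeasure_eq_measure[OF prob_space.finite_measure[OF prob_space_noise]])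
    also have "\<dots> = ennreal (1 / real r * u)" by (rule ennreal_mult'[symmetric]) simp
    also have "1 / real r * u = \<alpha> / real n" using r by (simp add: u_def)
    finally show ?thesis by (rule eq_refl)
  qed
  have "(\<integral>\<^sup>+x. ennreal (h x) \<partial>law f n \<theta>) =
      (\<integral>\<^sup>+x. (\<integral>\<^sup>+y. ennreal (h (x(i := y))) \<partial>?M i) \<partial>PiM ?J ?M)"
    using M.product_nn_integral_insert[of ?J i "\<lambda>x. ennreal (h x)"] unfolding ins law_def[symmetric]
    by simp
  also have "\<dots> \<le> (\<integral>\<^sup>+x. ennreal (\<alpha> / real n) \<partial>PiM ?J ?M)"
    by (intro nn_integral_mono inner)
  also have "\<dots> = ennreal (\<alpha> / real n)"
    using prob_space.emeasure_space_1[OF prob_space_PiM[of ?J ?M], OF prob_space_noise] by simp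
  finally have le: "(\<integral>\<^sup>+x. ennreal (h x) \<partial>law f n \<theta>) \<le> ennreal (\<alpha> / real n)" .
  interpret prob_space "law f n \<theta>" by (rule prob_space_law)
  have int_h: "integrable (law f n \<theta>) h"
    using h by (intro integrable_const_bound[of _ 1]) auto
  have "(LINT x|law f n \<theta>. real (BH f n \<alpha> x i) / max 1 (\<Sum>k\<in>{1..n}. real (BH f n \<alpha> x k)))
      \<le> (LINT x|law f n \<theta>. h x)"
    using int_h bound h by (intro integral_mono') (auto intro: order_trans)
  also have "\<dots> \<le> \<alpha> / real n"
    using le \<alpha> h int_h by (subst (asm) nn_integral_eq_integral) (auto simp: ennreal_le_iff)
  finally show ?thesis .
qed

lemma FDR_BH_le:
  assumes \<alpha>: "0 < \<alpha>" "\<alpha> \<le> 1" and n: "0 < n"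
  shows "FDR f n \<theta> (BH f n \<alpha>) \<le> \<alpha>"
proof -
  interpret prob_space "law f n \<theta>" by (rule prob_space_law)
  let ?T = "\<lambda>x. max 1 (\<Sum>k\<in>{1..n}. real (BH f n \<alpha> x k))"
  note [measurable] = measurable_procedure[OF BH_procedure[OF \<alpha>]]
  have int: "integrable (law f n \<theta>) (\<lambda>x. of_bool (\<theta> i = 0) * real (BH f n \<alpha> x i) / ?T x)"
    if i: "i \<in> {1..n}" for i
  proof (rule integrable_const_bound[of _ 1])
    have [measurable]: "(\<lambda>x. real (BH f n \<alpha> x i)) \<in> borel_measurable (law f n \<theta>)" using i by measurable
    show "(\<lambda>x. of_bool (\<theta> i = 0) * real (BH f n \<alpha> x i) / ?T x) \<in> borel_measurable (law f n \<theta>)"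
      by measurable
    show "AE x in law f n \<theta>. norm (of_bool (\<theta> i = 0) * real (BH f n \<alpha> x i) / ?T x) \<le> 1"
      using i by (intro always_eventually allI) (auto simp: BH_eq[OF \<alpha>] divide_le_eq)
  qed
  have "FDR f n \<theta> (BH f n \<alpha>) =
      (\<Sum>i\<in>{1..n}. LINT x|law f n \<theta>. of_bool (\<theta> i = 0) * real (BH f n \<alpha> x i) / ?T x)"
    unfolding FDR_def sum_divide_distrib by (intro Bochner_Integration.integral_sum int)
  also have "\<dots> \<le> (\<Sum>i\<in>{1..n}. \<alpha> / real n)"
    using BH_null_rejection[OF \<alpha>] \<alpha> by (intro sum_mono) (auto simp: of_bool_def)
  also have "\<dots> = \<alpha>" using n by simp
  finally show ?thesis .
qed

text \<open>Hoeffding's inequality with a deviation of one third of the mean. The remaining two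
  thirds answer to the constant 3 of \<open>level_condition\<close> and the factor 2 of the
  two-sided p-value.\<close>

lemma signal_detection_deviation:
  fixes \<theta> :: "nat \<Rightarrow> real" and t :: real
  assumes S: "S \<subseteq> {1..n}" "S \<noteq> {}"
  defines "\<mu> \<equiv> \<Sum>i\<in>S. measure (noise f (\<theta> i)) {x. t \<le> \<bar>x\<bar>}"
  shows "measure (law f n \<theta>) {x \<in> space (law f n \<theta>). (\<Sum>i\<in>S. indicator {x. t \<le> \<bar>x\<bar>} (x i)) \<le> 2 / 3 * \<mu>}
    \<le> exp (- (2 * \<mu>\<^sup>2 / (9 * real (card S))))"
proof -
  interpret prob_space "law f n \<theta>" by (rule prob_space_law)
  have fin: "finite S" using S by (auto intro: finite_subset)
  let ?D = "{x::real. t \<le> \<bar>x\<bar>}"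
  let ?Y = "\<lambda>i x. indicator ?D (x i) :: real"
  have "indep_vars (\<lambda>_. borel) (\<lambda>i x. indicator ?D (x i) :: real) S"
    by (rule indep_vars_compose2[OF indep_vars_coordinates[OF S(1)]]) measurable
  then interpret H: Hoeffding_ineq "law f n \<theta>" S ?Y "\<lambda>_. 0" "\<lambda>_. 1" "\<Sum>i\<in>S. expectation (?Y i)"
    using fin by unfold_locales auto
  have "expectation (?Y i) = measure (noise f (\<theta> i)) ?D" if "i \<in> S" for i
  proof -
    have i: "i \<in> {1..n}" using S that by auto
    have [measurable]: "(\<lambda>x. x i) \<in> law f n \<theta> \<rightarrow>\<^sub>M borel" using i by (rule measurable_coordinate)
    have "expectation (?Y i) = expectation (indicator {x \<in> space (law f n \<theta>). x i \<in> ?D})"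
      by (intro Bochner_Integration.integral_cong) (auto simp: indicator_def)
    also have "\<dots> = measure (law f n \<theta>) {x \<in> space (law f n \<theta>). x i \<in> ?D}" by simp
    also have "\<dots> = measure (noise f (\<theta> i)) ?D" by (rule measure_coordinate[OF i]) measurable
    finally show ?thesis .
  qed
  then have \<mu>: "(\<Sum>i\<in>S. expectation (?Y i)) = \<mu>" by (simp add: \<mu>_def)
  have "0 \<le> \<mu>" unfolding \<mu>_def by (intro sum_nonneg) auto
  then have "measure (law f n \<theta>) {x \<in> space (law f n \<theta>). (\<Sum>i\<in>S. ?Y i x) \<le> \<mu> - \<mu> / 3}
      \<le> exp (- 2 * (\<mu> / 3)\<^sup>2 / (\<Sum>i\<in>S. (1 - 0)\<^sup>2))"
    using H.Hoeffding_ineq_le[of "\<mu> / 3"] S fin unfolding \<mu> by (auto simp: card_gt_0_iff)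
  also have "\<mu> - \<mu> / 3 = 2 / 3 * \<mu>" by simp
  also have "- 2 * (\<mu> / 3)\<^sup>2 / (\<Sum>i\<in>S. (1 - 0 :: real)\<^sup>2) = - (2 * \<mu>\<^sup>2 / (9 * real (card S)))"
    by (simp add: power_divide)
  finally show ?thesis .
qed

text \<open>The signals enter only through \<open>detect\<close>, a lower bound
  \<open>k * (1 - l)\<close> for the expected number of signals beyond \<open>t\<close>. It serves
  twice: it makes \<open>t\<close> admissible off the event \<open>E\<close>, and it bounds the mean
  proportion of signals below \<open>t\<close> by \<open>l\<close>. On \<open>E\<close> the missed
  proportion is bounded by 1.\<close>

lemma FNR_BH_le:
  fixes \<theta> :: "nat \<Rightarrow> real"
  assumes \<alpha>: "0 < \<alpha>" "\<alpha> \<le> 1" and k: "card (nonzero n \<theta>) = k" "0 < k" and l: "l < 1"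
    and level: "3 * real n * tail f 0 t / (real k * (1 - l)) \<le> \<alpha>"
    and detect: "real k * (1 - l) \<le> (\<Sum>i\<in>nonzero n \<theta>. measure (noise f (\<theta> i)) {x. t \<le> \<bar>x\<bar>})"
  shows "FNR f n \<theta> (BH f n \<alpha>) \<le> l + exp (- ((1 - l)\<^sup>2 / 32 * real k))"
proof -
  interpret prob_space "law f n \<theta>" by (rule prob_space_law)
  let ?S = "nonzero n \<theta>" and ?D = "{x::real. t \<le> \<bar>x\<bar>}"
  have S: "?S \<subseteq> {1..n}" "?S \<noteq> {}" "finite ?S"
    using k(2) unfolding k(1)[symmetric] by (auto simp: nonzero_def card_gt_0_iff)
  have n: "0 < n" using S by auto
  define \<mu> where "\<mu> = (\<Sum>i\<in>?S. measure (noise f (\<theta> i)) ?D)"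
  define Z where "Z x = (\<Sum>i\<in>?S. indicator ?D (x i) :: real)" for x
  define E where "E = {x \<in> space (law f n \<theta>). Z x \<le> 2 / 3 * \<mu>}"
  have meas_ind: "(\<lambda>x. indicator ?D (x i) :: real) \<in> borel_measurable (law f n \<theta>)" if "i \<in> ?S" for i
  proof -
    have [measurable]: "(\<lambda>x. x i) \<in> law f n \<theta> \<rightarrow>\<^sub>M borel" using that S by (intro measurable_coordinate) auto
    show ?thesis by measurable
  qed
  have [measurable]: "Z \<in> borel_measurable (law f n \<theta>)"
    unfolding Z_def by (intro borel_measurable_sum meas_ind)
  have E [measurable]: "E \<in> sets (law f n \<theta>)" unfolding E_def by measurable
  have kl: "0 < real k * (1 - l)" using k l by simp
  have reject: "BH_threshold f n \<alpha> x \<le> ereal t" if "2 / 3 * \<mu> < Z x" for x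
  proof (rule BH_threshold_least(2)[OF \<alpha> n], intro disjI2 exI conjI)
    have "Z x = real (card (?S \<inter> {i. x i \<in> ?D}))"
      using S by (simp add: Z_def indicator_def sum_of_bool_eq of_bool_def[symmetric])
    also have "\<dots> \<le> real (card {i \<in> {1..n}. t \<le> \<bar>x i\<bar>})"
      using S by (intro of_nat_mono card_mono) auto
    finally have N: "Z x \<le> real (card {i \<in> {1..n}. t \<le> \<bar>x i\<bar>})" .
    have "2 * tail f 0 t / \<alpha> * real n \<le> 2 / 3 * (real k * (1 - l))"
      using level kl \<alpha> by (simp add: field_simps)
    also have "\<dots> \<le> 2 / 3 * \<mu>" using detect by (simp add: \<mu>_def)
    finally show "2 * tail f 0 t / \<alpha> \<le> real (card {i \<in> {1..n}. t \<le> \<bar>x i\<bar>}) / real n"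
      using N that n by (simp add: pos_le_divide_eq)
  qed simp
  have miss: "(\<Sum>i\<in>{1..n}. of_bool (\<theta> i \<noteq> 0) * (1 - real (BH f n \<alpha> x i))) / max 1 (real (card ?S))
      \<le> (real k - Z x) / real k + indicator E x" (is "?l \<le> ?r") if x: "x \<in> space (law f n \<theta>)" for x
  proof -
    have Zk: "Z x \<le> real k"
      using sum_mono[of ?S "\<lambda>i. indicator ?D (x i) :: real" "\<lambda>_. 1"] k by (simp add: Z_def)
    have "(\<Sum>i\<in>{1..n}. of_bool (\<theta> i \<noteq> 0) * (1 - real (BH f n \<alpha> x i))) =
        (\<Sum>i\<in>?S. 1 - real (BH f n \<alpha> x i))"
      by (intro sum.mono_neutral_cong_right) (auto simp: nonzero_def)
    then have l_eq: "?l = (\<Sum>i\<in>?S. 1 - real (BH f n \<alpha> x i)) / real k" using k by simp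
    show ?thesis
    proof (cases "x \<in> E")
      case True
      have "(\<Sum>i\<in>?S. 1 - real (BH f n \<alpha> x i)) \<le> (\<Sum>i\<in>?S. 1)" by (intro sum_mono) auto
      then have "?l \<le> 1" unfolding l_eq using k by simp
      moreover have "0 \<le> (real k - Z x) / real k" using Zk by (simp add: divide_nonneg_nonneg)
      moreover have "indicator E x = (1 :: real)" using True by simp
      ultimately show ?thesis by linarith
    next
      case False
      then have "2 / 3 * \<mu> < Z x" using x by (simp add: E_def)
      then have thr: "BH_threshold f n \<alpha> x \<le> ereal t" by (rule reject)
      have "(\<Sum>i\<in>?S. 1 - real (BH f n \<alpha> x i)) \<le> (\<Sum>i\<in>?S. 1 - indicator ?D (x i))"
      proof (rule sum_mono)
        fix i assume "i \<in> ?S"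
        then show "1 - real (BH f n \<alpha> x i) \<le> 1 - indicator ?D (x i)"
          using S order_trans[OF thr, of "ereal \<bar>x i\<bar>"] by (auto simp: BH_def indicator_def)
      qed
      also have "\<dots> = real k - Z x" by (simp add: sum_subtractf Z_def k)
      finally show ?thesis unfolding l_eq using False k by (simp add: divide_right_mono)
    qed
  qed
  have int_Z: "integrable (law f n \<theta>) Z"
    unfolding Z_def by (intro Bochner_Integration.integrable_sum integrable_const_bound[of _ 1] meas_ind) auto
  have "expectation Z = (\<Sum>i\<in>?S. expectation (\<lambda>x. indicator ?D (x i)))"
    unfolding Z_def
    by (intro Bochner_Integration.integral_sum integrable_const_bound[of _ 1] meas_ind) auto
  also have "\<dots> = \<mu>" unfolding \<mu>_def
  proof (rule sum.cong[OF refl])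
    fix i assume "i \<in> ?S"
    then have i: "i \<in> {1..n}" using S by auto
    have [measurable]: "(\<lambda>x. x i) \<in> law f n \<theta> \<rightarrow>\<^sub>M borel" using i by (rule measurable_coordinate)
    have "expectation (\<lambda>x. indicator ?D (x i) :: real) = integral\<^sup>L (distr (law f n \<theta>) borel (\<lambda>x. x i)) (indicator ?D)"
      using measurable_coordinate[OF i, of \<theta>] by (intro integral_distr[symmetric]) auto
    then show "expectation (\<lambda>x. indicator ?D (x i)) = measure (noise f (\<theta> i)) ?D"
      by (simp add: distr_coordinate[OF i])
  qed
  finally have EZ: "expectation Z = \<mu>" .
  have int_r: "integrable (law f n \<theta>) (\<lambda>x. (real k - Z x) / real k + indicator E x)"
    using int_Z by (intro Bochner_Integration.integrable_add integrable_divide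
      Bochner_Integration.integrable_diff) (auto simp: emeasure_eq_measure)
  have "FNR f n \<theta> (BH f n \<alpha>) \<le> expectation (\<lambda>x. (real k - Z x) / real k + indicator E x)"
    unfolding FNR_def
  proof (rule integral_mono'[OF int_r miss])
    fix x assume "x \<in> space (law f n \<theta>)"
    have "Z x \<le> real k"
      using sum_mono[of ?S "\<lambda>i. indicator ?D (x i) :: real" "\<lambda>_. 1"] k by (simp add: Z_def)
    then show "0 \<le> (real k - Z x) / real k + indicator E x" by (simp add: divide_nonneg_nonneg)
  qed
  also have "\<dots> = (real k - \<mu>) / real k + measure (law f n \<theta>) E"
    using int_Z E by (simp add: EZ prob_space emeasure_eq_measure)
  also have "(real k - \<mu>) / real k \<le> l"
    using detect k by (simp add: \<mu>_def field_simps)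
  also have "measure (law f n \<theta>) E \<le> exp (- (2 * \<mu>\<^sup>2 / (9 * real k)))"
    using signal_detection_deviation[OF S(1,2), where t=t and \<theta>=\<theta>] k by (simp add: E_def Z_def \<mu>_def)
  also have "\<dots> \<le> exp (- ((1 - l)\<^sup>2 / 32 * real k))"
  proof -
    have "(real k * (1 - l))\<^sup>2 \<le> \<mu>\<^sup>2" using detect kl by (intro power_mono) (auto simp: \<mu>_def)
    then have "real k * (1 - l)\<^sup>2 \<le> \<mu>\<^sup>2 / real k"
      using k by (simp add: field_simps power2_eq_square)
    \<comment> \<open>\<open>2 / 9\<close> exceeds \<open>1 / 32\<close>, so the Hoeffding exponent
      leaves room.\<close>
    moreover have "(1 - l)\<^sup>2 / 32 * real k \<le> 2 / 9 * (real k * (1 - l)\<^sup>2)" by simp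
    ultimately have "(1 - l)\<^sup>2 / 32 * real k \<le> 2 / 9 * (\<mu>\<^sup>2 / real k)" by linarith
    then show ?thesis by simp
  qed
  finally show ?thesis by simp
qed

end

section \<open>Change of measure\<close>

context noise_model
begin

definition lr :: "real \<Rightarrow> real \<Rightarrow> real" where
  "lr a y = f a y / f 0 y"

lemma lr_nonneg: "0 \<le> lr a y"
  using density_nonneg[of a y] pos0[of y] by (simp add: lr_def)

lemma measurable_lr [measurable]: "lr a \<in> borel_measurable borel"
  unfolding lr_def[abs_def] by measurable

lemma lr_times: "ennreal (f 0 y) * ennreal (lr a y) = ennreal (f a y)"
  using pos0[of y] density_nonneg[of a y] lr_nonneg[of a y]
  by (simp add: ennreal_mult'[symmetric] lr_def)

lemma noise_eq_density: "noise f a = density (noise f 0) (\<lambda>y. ennreal (lr a y))"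
  by (subst density_density_eq) (simp_all add: lr_times)

text \<open>Only one factor of the product changes, so the density depends on the coordinate
  \<open>x i\<close> alone. It suffices to compare both measures on rectangles, where the integral
  factorises.\<close>

lemma law_update:
  assumes i: "i \<in> {1..n}" "\<theta> i = 0"
  shows "law f n (\<theta>(i := a)) = density (law f n \<theta>) (\<lambda>x. ennreal (lr a (x i)))"
proof -
  let ?M = "\<lambda>k. noise f (\<theta> k)" and ?M' = "\<lambda>k. noise f ((\<theta>(i := a)) k)"
  interpret M: product_sigma_finite ?M
    unfolding product_sigma_finite_def using prob_space_noise by (auto intro: prob_space_imp_sigma_finite)
  interpret M': product_sigma_finite ?M'
    unfolding product_sigma_finite_def using prob_space_noise by (auto intro: prob_space_imp_sigma_finite)
  have meas: "(\<lambda>x. ennreal (lr a (x i))) \<in> borel_measurable (law f n \<theta>)"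
    by (rule measurable_compose[OF measurable_coordinate[OF i(1)]]) measurable
  have "density (law f n \<theta>) (\<lambda>x. ennreal (lr a (x i))) = PiM {1..n} ?M'"
  proof (rule M'.PiM_eqI)
    show "sets (density (law f n \<theta>) (\<lambda>x. ennreal (lr a (x i)))) = sets (PiM {1..n} ?M')"
      using sets_law[of n "\<theta>(i := a)"] by (simp add: sets_law law_def[of f n "\<theta>(i := a)"])
    fix A assume "\<And>k. k \<in> {1..n} \<Longrightarrow> A k \<in> sets (?M' k)"
    then have A [measurable]: "\<And>k. k \<in> {1..n} \<Longrightarrow> A k \<in> sets borel" by simp
    have AP: "Pi\<^sub>E {1..n} A \<in> sets (law f n \<theta>)"
      unfolding law_def by (rule sets_PiM_I_finite) (auto simp: A)
    define g where "g k y = (if k = i then ennreal (lr a y) else 1) * indicator (A k) y" for k y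
    have g: "g k \<in> borel_measurable borel" if "k \<in> {1..n}" for k
      unfolding g_def using A[OF that] by measurable
    have "emeasure (density (law f n \<theta>) (\<lambda>x. ennreal (lr a (x i)))) (Pi\<^sub>E {1..n} A) =
        (\<integral>\<^sup>+x. ennreal (lr a (x i)) * indicator (Pi\<^sub>E {1..n} A) x \<partial>law f n \<theta>)"
      by (rule emeasure_density[OF meas AP])
    also have "\<dots> = (\<integral>\<^sup>+x. (\<Prod>k\<in>{1..n}. g k (x k)) \<partial>law f n \<theta>)"
    proof (rule nn_integral_cong)
      fix x assume "x \<in> space (law f n \<theta>)"
      then have x: "x \<in> extensional {1..n}" by (auto simp: law_def space_PiM PiE_def)
      have "(\<Prod>k\<in>{1..n}. g k (x k)) =
          (\<Prod>k\<in>{1..n}. if k = i then ennreal (lr a (x i)) else 1) * (\<Prod>k\<in>{1..n}. indicator (A k) (x k))"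
        unfolding g_def prod.distrib by (intro arg_cong2[where f=times] prod.cong) auto
      also have "(\<Prod>k\<in>{1..n}. if k = i then ennreal (lr a (x i)) else 1) = ennreal (lr a (x i))"
        using i(1) by (subst prod.delta) auto
      also have "(\<Prod>k\<in>{1..n}. indicator (A k) (x k)) = (indicator (Pi\<^sub>E {1..n} A) x :: ennreal)"
        using x by (auto simp: indicator_def PiE_def Pi_def prod_zero_iff)
      finally show "ennreal (lr a (x i)) * indicator (Pi\<^sub>E {1..n} A) x = (\<Prod>k\<in>{1..n}. g k (x k))" ..
    qed
    also have "\<dots> = (\<Prod>k\<in>{1..n}. \<integral>\<^sup>+y. g k y \<partial>?M k)"
      unfolding law_def by (rule M.product_nn_integral_prod) (auto simp: g)
    also have "\<dots> = (\<Prod>k\<in>{1..n}. emeasure (?M' k) (A k))"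
    proof (rule prod.cong[OF refl])
      fix k assume k: "k \<in> {1..n}"
      note A[OF k, measurable]
      show "(\<integral>\<^sup>+y. g k y \<partial>?M k) = emeasure (?M' k) (A k)"
      proof (cases "k = i")
        case True
        then show ?thesis using i
          by (simp add: g_def noise_eq_density[of a] emeasure_density)
      next
        case False
        then show ?thesis by (simp add: g_def)
      qed
    qed
    finally show "emeasure (density (law f n \<theta>) (\<lambda>x. ennreal (lr a (x i)))) (Pi\<^sub>E {1..n} A) =
        (\<Prod>k\<in>{1..n}. emeasure (?M' k) (A k))" .
  qed simp
  then show ?thesis by (simp add: law_def[of f n "\<theta>(i := a)"])
qed

lemma integral_law_update:
  fixes h :: "(nat \<Rightarrow> real) \<Rightarrow> real"
  assumes i: "i \<in> {1..n}" "\<theta> i = 0" and h: "h \<in> borel_measurable (law f n \<theta>)"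
  shows "(LINT x|law f n (\<theta>(i := a)). h x) = (LINT x|law f n \<theta>. lr a (x i) * h x)"
proof -
  have "(\<lambda>x. lr a (x i)) \<in> borel_measurable (law f n \<theta>)"
    by (rule measurable_compose[OF measurable_coordinate[OF i(1)]]) measurable
  with h show ?thesis
    unfolding law_update[where \<theta>=\<theta> and i=i, OF i]
    by (intro integral_real_density) (auto simp: lr_nonneg)
qed

text \<open>Independence removes the cross terms, and \<open>0 \<le> u \<le> c\<close> gives
  \<open>u * u \<le> c * u\<close>, so one factor \<open>c\<close> is traded for the mean
  \<open>p\<close>. That gain lets a block sum concentrate although a single summand may be as large
  as a small fraction of the block size.\<close>

lemma null_sum_variance:
  fixes u :: "real \<Rightarrow> real"
  assumes B: "B \<subseteq> {1..n}" "\<And>i. i \<in> B \<Longrightarrow> \<theta> i = 0"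
    and u [measurable]: "u \<in> borel_measurable borel" and bound: "\<And>y. 0 \<le> u y" "\<And>y. u y \<le> c"
  defines "p \<equiv> LINT y|noise f 0. u y"
  shows "(LINT x|law f n \<theta>. ((\<Sum>i\<in>B. u (x i)) - real (card B) * p)\<^sup>2) \<le> real (card B) * (c * p)"
proof -
  interpret prob_space "law f n \<theta>" by (rule prob_space_law)
  interpret N: prob_space "noise f 0" by (rule prob_space_noise)
  have N1: "N.prob UNIV = 1" using N.prob_space by simp
  define Y where "Y i x = u (x i) - p" for i and x :: "nat \<Rightarrow> real"
  have fin: "finite B" using B by (auto intro: finite_subset)
  have c: "0 \<le> c" using bound[of 0] by simp
  have int_u: "integrable (noise f 0) u"
    using bound by (intro N.integrable_const_bound[of _ c]) auto
  have "p \<le> (LINT y|noise f 0. c)"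
    unfolding p_def using int_u bound by (intro integral_mono) auto
  then have p: "0 \<le> p" "p \<le> c"
    using bound N1 by (auto simp: p_def intro!: integral_nonneg_AE)
  have meas_Y: "Y i \<in> borel_measurable (law f n \<theta>)" if "i \<in> B" for i
    unfolding Y_def using B that
    by (intro borel_measurable_diff measurable_compose[OF measurable_coordinate u]) auto
  have abs_Y: "\<bar>Y i x\<bar> \<le> c" for i x
    using bound(1)[of "x i"] bound(2)[of "x i"] p unfolding Y_def by arith
  have int_Y: "integrable (law f n \<theta>) (Y i)" if "i \<in> B" for i
    using abs_Y meas_Y[OF that] by (intro integrable_const_bound[of _ c]) auto
  have int_YY: "integrable (law f n \<theta>) (\<lambda>x. Y i x * Y k x)" if "i \<in> B" "k \<in> B" for i k
    using abs_Y meas_Y that c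
    by (intro integrable_const_bound[of _ "c * c"]) (auto simp: abs_mult intro!: mult_mono)
  have coord: "(LINT x|law f n \<theta>. w (x i)) = (LINT y|noise f 0. w y)"
    if "i \<in> B" "w \<in> borel_measurable borel" for i and w :: "real \<Rightarrow> real"
  proof -
    have i: "i \<in> {1..n}" "\<theta> i = 0" using that B by auto
    show ?thesis
      using integral_distr[OF measurable_coordinate[OF i(1), of \<theta>] that(2)]
      by (simp add: distr_coordinate[OF i(1)] i)
  qed
  have EY: "expectation (Y i) = 0" if "i \<in> B" for i
  proof -
    have "expectation (Y i) = (LINT y|noise f 0. u y - p)"
      unfolding Y_def by (rule coord[OF that]) measurable
    also have "\<dots> = 0"
      using int_u by (simp add: p_def[symmetric] N1)
    finally show ?thesis .
  qed
  have EYY: "expectation (\<lambda>x. Y i x * Y k x) = 0" if ik: "i \<in> B" "k \<in> B" "i \<noteq> k" for i k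
  proof -
    have "indep_vars (\<lambda>_. borel) Y {i, k}"
      unfolding Y_def
      by (rule indep_vars_compose2[OF indep_vars_coordinates]) (use ik B in auto)
    then have "expectation (\<lambda>x. \<Prod>j\<in>{i, k}. Y j x) = (\<Prod>j\<in>{i, k}. expectation (Y j))"
      using ik int_Y by (intro indep_vars_lebesgue_integral) auto
    then show ?thesis using ik EY by simp
  qed
  have EY2: "expectation (\<lambda>x. Y i x * Y i x) \<le> c * p" if "i \<in> B" for i
  proof -
    have int_uu: "integrable (noise f 0) (\<lambda>y. u y * u y)"
      using bound c by (intro N.integrable_const_bound[of _ "c * c"]) (auto simp: abs_mult intro!: mult_mono)
    have "expectation (\<lambda>x. Y i x * Y i x) = (LINT y|noise f 0. (u y - p) * (u y - p))"
      unfolding Y_def using coord[OF that, of "\<lambda>y. (u y - p) * (u y - p)"] by simp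
    also have "\<dots> = (LINT y|noise f 0. u y * u y - 2 * p * u y + p * p)"
      by (simp add: algebra_simps)
    also have "\<dots> = (LINT y|noise f 0. u y * u y) - p * p"
      using int_uu int_u by (simp add: N1 p_def[symmetric])
    also have "(LINT y|noise f 0. u y * u y) \<le> (LINT y|noise f 0. c * u y)"
      using int_uu int_u bound by (intro integral_mono) (auto intro: mult_right_mono)
    also have "(LINT y|noise f 0. c * u y) = c * p" by (simp add: p_def)
    finally show ?thesis using p by (smt (verit) mult_nonneg_nonneg)
  qed
  have "(LINT x|law f n \<theta>. ((\<Sum>i\<in>B. u (x i)) - real (card B) * p)\<^sup>2) =
      expectation (\<lambda>x. \<Sum>i\<in>B. \<Sum>k\<in>B. Y i x * Y k x)"
    by (simp add: Y_def sum_subtractf sum_product[symmetric] power2_eq_square)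
  also have "\<dots> = (\<Sum>i\<in>B. \<Sum>k\<in>B. expectation (\<lambda>x. Y i x * Y k x))"
    using int_YY by (subst Bochner_Integration.integral_sum)
      (auto intro!: Bochner_Integration.integrable_sum sum.cong Bochner_Integration.integral_sum)
  also have "\<dots> = (\<Sum>i\<in>B. expectation (\<lambda>x. Y i x * Y i x))"
  proof (rule sum.cong[OF refl])
    fix i assume i: "i \<in> B"
    have "(\<Sum>k\<in>B. expectation (\<lambda>x. Y i x * Y k x)) =
        (\<Sum>k\<in>B. if k = i then expectation (\<lambda>x. Y i x * Y i x) else 0)"
      using EYY[OF i] by (intro sum.cong) auto
    then show "(\<Sum>k\<in>B. expectation (\<lambda>x. Y i x * Y k x)) = expectation (\<lambda>x. Y i x * Y i x)"
      using i fin by simp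
  qed
  also have "\<dots> \<le> real (card B) * (c * p)"
    using sum_mono[of B "\<lambda>i. expectation (\<lambda>x. Y i x * Y i x)" "\<lambda>_. c * p"] EY2 by simp
  finally show ?thesis .
qed

end

section \<open>Power within one block\<close>

text \<open>Takes the place of Chebyshev's inequality in \<open>block_power\<close>: \<open>D\<close> is the sum of the truncated
  likelihood ratios over a block, \<open>M\<close> its mean, \<open>N\<close> the number of rejections in the block.\<close>

lemma min_le_quadratic:
  fixes D N c M :: real
  assumes "0 < M" "0 \<le> c" "0 \<le> N" "0 \<le> D" "v \<le> D" "v \<le> c * N"
  shows "v \<le> 2 * c / M * (N * D) + 2 / M * (D - M)\<^sup>2"
proof (cases "M / 2 \<le> D")
  case True
  have "c * N * (M / 2) \<le> c * N * D" using True assms by (intro mult_left_mono) auto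
  then have "c * N \<le> 2 * c / M * (N * D)" using assms by (simp add: field_simps)
  moreover have "0 \<le> 2 / M * (D - M)\<^sup>2" using assms by simp
  ultimately show ?thesis using assms by linarith
next
  case False
  then have "(M / 2)\<^sup>2 \<le> (M - D)\<^sup>2" using assms by (intro power_mono) auto
  then have "2 / M * (M / 2)\<^sup>2 \<le> 2 / M * (D - M)\<^sup>2"
    using assms by (intro mult_left_mono) (auto simp: power2_commute)
  then have "M / 2 \<le> 2 / M * (D - M)\<^sup>2" using assms by (simp add: power2_eq_square field_simps)
  moreover have "0 \<le> 2 * c / M * (N * D)" using assms by simp
  ultimately show ?thesis using False assms by linarith
qed

context noise_model
begin

text \<open>Under the law without a signal in the block, the power outside \<open>A\<close>, summed
  over the position of the signal, is the expectation of the sum of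
  \<open>u (x i) * \<phi> i x\<close>. This sum is at most \<open>D\<close> and at most
  \<open>c * N\<close>. Through \<open>min_le_quadratic\<close> it is traded for
  \<open>N * D\<close> plus a squared deviation; the form \<open>N * D\<close> is chosen because a
  change of measure turns it back into expected rejections under the laws with a signal.\<close>

lemma block_power:
  fixes \<phi> :: "nat \<Rightarrow> (nat \<Rightarrow> real) \<Rightarrow> real"
  assumes B: "B \<subseteq> {1..n}" "\<And>i. i \<in> B \<Longrightarrow> \<theta> i = 0" "card B = m" "0 < m"
    and A [measurable]: "A \<in> sets borel" and \<rho>: "0 < \<rho>"
    and bounded_lr: "\<And>y. y \<notin> A \<Longrightarrow> lr a y \<le> \<rho> * real m"
    and \<phi>_meas: "\<And>i. i \<in> B \<Longrightarrow> \<phi> i \<in> borel_measurable (\<Pi>\<^sub>M i\<in>{1..n}. borel)"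
    and \<phi>: "\<And>i x. 0 \<le> \<phi> i x" "\<And>i x. \<phi> i x \<le> 1"
  shows "(\<Sum>i\<in>B. LINT x|law f n (\<theta>(i := a)). \<phi> i x) \<le>
    real m * (measure (noise f a) A + 2 * \<rho> + sqrt \<rho>)
    + 2 * sqrt \<rho> * (\<Sum>i\<in>B. LINT x|law f n (\<theta>(i := a)). (\<Sum>k\<in>B. \<phi> k x))"
proof -
  interpret prob_space "law f n \<theta>" by (rule prob_space_law)
  interpret N: prob_space "noise f 0" by (rule prob_space_noise)
  have fin: "finite B" using B by (auto intro: finite_subset)
  define c where "c = \<rho> * real m"
  have c: "0 < c" using \<rho> B by (simp add: c_def)
  define u where "u y = lr a y * indicator (- A) y" for y
  define p where "p = (LINT y|noise f 0. u y)"
  define q where "q = measure (noise f a) A"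
  let ?P = "\<lambda>i. law f n (\<theta>(i := a))"
  let ?N = "\<lambda>x. \<Sum>k\<in>B. \<phi> k x"
  have [measurable]: "u \<in> borel_measurable borel" unfolding u_def by measurable
  have u: "0 \<le> u y" "u y \<le> c" for y
    using lr_nonneg[of a y] bounded_lr[of y] c by (auto simp: u_def c_def indicator_def)
  have \<phi>_law: "\<phi> i \<in> borel_measurable (law f n \<theta>')" if "i \<in> B" for i \<theta>'
    using \<phi>_meas[OF that] by (simp only: measurable_cong_sets[OF sets_law refl])
  have coord_law: "(\<lambda>x. w (x i)) \<in> borel_measurable (law f n \<theta>')"
    if "i \<in> B" "w \<in> borel_measurable borel" for i \<theta>' and w :: "real \<Rightarrow> real"
    using that B by (intro measurable_compose[OF measurable_coordinate]) auto
  have p_eq: "p = measure (noise f a) (- A)"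
  proof -
    have "measure (noise f a) (- A) = (LINT y|noise f a. indicator (- A) y)" by simp
    also have "\<dots> = p"
      unfolding noise_eq_density[of a] p_def u_def by (intro integral_real_density) (auto simp: lr_nonneg)
    finally show ?thesis ..
  qed
  have p: "0 \<le> p" "p \<le> 1" using prob_space.prob_le_1[OF prob_space_noise] by (auto simp: p_eq)
  have q: "0 \<le> q" by (simp add: q_def)
  have prob_coord: "measure (?P i) {x \<in> space (?P i). x i \<in> E} = measure (noise f a) E"
    if "i \<in> B" "E \<in> sets borel" for i E
    using measure_coordinate[of i n E "\<theta>(i := a)"] that B by auto
  have expect_coord: "(LINT x|?P i. indicator E (x i)) = measure (noise f a) E"
    if iE: "i \<in> B" "E \<in> sets borel" for i E
  proof -
    have "(LINT x|?P i. indicator E (x i) :: real) = (LINT x|?P i. indicator {x \<in> space (?P i). x i \<in> E} x)"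
      by (intro Bochner_Integration.integral_cong) (auto simp: indicator_def)
    moreover have "{x \<in> space (?P i). x i \<in> E} \<inter> space (?P i) = {x \<in> space (?P i). x i \<in> E}" by auto
    ultimately show ?thesis using prob_coord[OF iE] by simp
  qed
  have int_P: "integrable (?P i) w"
    if "w \<in> borel_measurable (?P i)" "\<And>x. \<bar>w x\<bar> \<le> C" for i C and w :: "(nat \<Rightarrow> real) \<Rightarrow> real"
    using that by (intro finite_measure.integrable_const_bound[of _ _ C]
      prob_space.finite_measure[OF prob_space_law]) auto
  have E_ind: "(LINT x|?P i. indicator (- A) (x i) * w x) = (LINT x|law f n \<theta>. u (x i) * w x)"
    if "i \<in> B" "w \<in> borel_measurable (law f n \<theta>)" for i w
    using that B coord_law[of i "\<lambda>y. indicator (- A) y" \<theta>]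
    by (subst integral_law_update) (auto simp: u_def mult.assoc)
  have split_power: "(LINT x|?P i. \<phi> i x) \<le> q + (LINT x|?P i. indicator (- A) (x i) * \<phi> i x)"
    if i: "i \<in> B" for i
  proof -
    have int1: "integrable (?P i) (\<lambda>x. indicator A (x i) :: real)"
      by (rule int_P[of _ _ 1]) (use coord_law[OF i, of "indicator A"] in auto)
    have int2: "integrable (?P i) (\<lambda>x. indicator (- A) (x i) * \<phi> i x)"
      using \<phi> by (intro int_P[of _ _ 1] borel_measurable_times coord_law[OF i] \<phi>_law[OF i])
        (auto simp: indicator_def)
    have "(LINT x|?P i. \<phi> i x) \<le> (LINT x|?P i. indicator A (x i) + indicator (- A) (x i) * \<phi> i x)"
      using \<phi> int1 int2 by (intro integral_mono int_P[of _ _ 1] \<phi>_law[OF i]) (auto simp: indicator_def)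
    also have "\<dots> = q + (LINT x|?P i. indicator (- A) (x i) * \<phi> i x)"
      using int1 int2 expect_coord[OF i A] by (simp add: q_def)
    finally show ?thesis .
  qed
  have N_nonneg: "0 \<le> (\<Sum>i\<in>B. LINT x|?P i. ?N x)"
    using \<phi> by (intro sum_nonneg integral_nonneg_AE) (auto intro!: sum_nonneg)
  have sum_split: "(\<Sum>i\<in>B. LINT x|?P i. \<phi> i x) \<le>
      real m * q + (\<Sum>i\<in>B. LINT x|?P i. indicator (- A) (x i) * \<phi> i x)"
    using sum_mono[of B, OF split_power] B by (simp add: sum.distrib)
  have "(\<Sum>i\<in>B. LINT x|?P i. indicator (- A) (x i) * \<phi> i x) \<le>
      real m * (2 * \<rho> + sqrt \<rho>) + 2 * sqrt \<rho> * (\<Sum>i\<in>B. LINT x|?P i. ?N x)" (is "?lhs \<le> ?rhs")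
  \<comment> \<open>If \<open>p\<close> is small, the signal rarely falls outside \<open>A\<close>
    and the trivial bound \<open>p\<close> suffices. Otherwise \<open>M = m * p\<close> is large
    enough that \<open>c / M = \<rho> / p\<close> is at most \<open>sqrt \<rho>\<close>.\<close>
  proof (cases "p \<le> sqrt \<rho>")
    case True
    have "?lhs \<le> (\<Sum>i\<in>B. p)"
    proof (rule sum_mono)
      fix i assume i: "i \<in> B"
      have "(LINT x|?P i. indicator (- A) (x i) * \<phi> i x) \<le> (LINT x|?P i. indicator (- A) (x i))"
        using \<phi> by (intro integral_mono int_P[of _ _ 1] borel_measurable_times coord_law[OF i] \<phi>_law[OF i])
          (auto simp: indicator_def)
      also have "\<dots> = p" using expect_coord[OF i, of "- A"] by (simp add: p_eq)
      finally show "(LINT x|?P i. indicator (- A) (x i) * \<phi> i x) \<le> p" .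
    qed
    also have "\<dots> \<le> real m * sqrt \<rho>" using True B by (simp add: mult_left_mono)
    also have "\<dots> \<le> ?rhs" using N_nonneg \<rho> by (simp add: distrib_left)
    finally show ?thesis .
  next
    case False
    then have p_pos: "sqrt \<rho> < p" "0 < p" using \<rho> by (auto intro: order_le_less_trans[of 0 "sqrt \<rho>"])
    define M where "M = real m * p"
    have M: "0 < M" using p_pos B by (simp add: M_def)
    define D where "D x = (\<Sum>i\<in>B. u (x i))" for x :: "nat \<Rightarrow> real"
    have meas_u: "(\<lambda>x. u (x i)) \<in> borel_measurable (law f n \<theta>)" if "i \<in> B" for i
      by (rule coord_law[OF that]) measurable
    have meas_N: "?N \<in> borel_measurable (law f n \<theta>)" by (intro borel_measurable_sum \<phi>_law)
    have meas_D: "D \<in> borel_measurable (law f n \<theta>)" unfolding D_def by (intro borel_measurable_sum meas_u)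
    have N_bd: "0 \<le> ?N x" "?N x \<le> real m" for x
      using \<phi> sum_mono[of B "\<lambda>k. \<phi> k x" "\<lambda>_. 1"] B by (auto intro!: sum_nonneg)
    have D_bd: "0 \<le> D x" "D x \<le> real m * c" for x
      using u sum_mono[of B "\<lambda>i. u (x i)" "\<lambda>_. c"] B by (auto simp: D_def intro!: sum_nonneg)
    have int_u\<phi>: "integrable (law f n \<theta>) (\<lambda>x. u (x i) * \<phi> i x)" if i: "i \<in> B" for i
    proof -
      have "u (x i) * \<phi> i x \<le> c" for x
        using mult_left_le[OF \<phi>(2)[of i x] u(1)[of "x i"]] u(2)[of "x i"] by linarith
      then show ?thesis
        using u \<phi> by (intro integrable_const_bound[of _ c] borel_measurable_times meas_u[OF i] \<phi>_law[OF i])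
          auto
    qed
    have int_uN: "integrable (law f n \<theta>) (\<lambda>x. u (x i) * ?N x)" if i: "i \<in> B" for i
      using u N_bd c by (intro integrable_const_bound[of _ "c * real m"] borel_measurable_times meas_u[OF i] meas_N)
        (auto simp: abs_mult intro!: mult_mono)
    have int_ND: "integrable (law f n \<theta>) (\<lambda>x. ?N x * D x)"
      using D_bd N_bd by (intro integrable_const_bound[of _ "real m * (real m * c)"] borel_measurable_times meas_D meas_N)
        (auto simp: abs_mult intro!: mult_mono)
    have int_D2: "integrable (law f n \<theta>) (\<lambda>x. (D x - M)\<^sup>2)"
    proof (rule integrable_const_bound[of _ "(real m * c + M)\<^sup>2"])
      have "\<bar>D x - M\<bar> \<le> real m * c + M" for x using D_bd[of x] M by arith
      then show "AE x in law f n \<theta>. norm ((D x - M)\<^sup>2) \<le> (real m * c + M)\<^sup>2"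
        using M c by (intro always_eventually allI) (auto simp: abs_le_square_iff[symmetric])
    qed (intro borel_measurable_power borel_measurable_diff meas_D borel_measurable_const)
    have "?lhs = (\<Sum>i\<in>B. LINT x|law f n \<theta>. u (x i) * \<phi> i x)"
      by (intro sum.cong refl E_ind \<phi>_law)
    also have "\<dots> = (LINT x|law f n \<theta>. (\<Sum>i\<in>B. u (x i) * \<phi> i x))"
      by (intro Bochner_Integration.integral_sum[symmetric] int_u\<phi>)
    also have "\<dots> \<le> (LINT x|law f n \<theta>. 2 * c / M * (?N x * D x) + 2 / M * (D x - M)\<^sup>2)"
    proof (rule integral_mono)
      show "integrable (law f n \<theta>) (\<lambda>x. \<Sum>i\<in>B. u (x i) * \<phi> i x)"
        by (intro Bochner_Integration.integrable_sum int_u\<phi>)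
      show "integrable (law f n \<theta>) (\<lambda>x. 2 * c / M * (?N x * D x) + 2 / M * (D x - M)\<^sup>2)"
        using int_ND int_D2 by simp
      fix x
      show "(\<Sum>i\<in>B. u (x i) * \<phi> i x) \<le> 2 * c / M * (?N x * D x) + 2 / M * (D x - M)\<^sup>2"
      proof (rule min_le_quadratic[OF M])
        show "(\<Sum>i\<in>B. u (x i) * \<phi> i x) \<le> D x"
          unfolding D_def using u \<phi> by (intro sum_mono) (auto intro: mult_left_le)
        show "(\<Sum>i\<in>B. u (x i) * \<phi> i x) \<le> c * ?N x"
          unfolding sum_distrib_left using u \<phi> by (intro sum_mono mult_right_mono) auto
      qed (use c N_bd D_bd in auto)
    qed
    also have "\<dots> = 2 * c / M * (LINT x|law f n \<theta>. ?N x * D x) + 2 / M * (LINT x|law f n \<theta>. (D x - M)\<^sup>2)"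
      using int_ND int_D2 by simp
    finally have main: "?lhs \<le> 2 * c / M * (LINT x|law f n \<theta>. ?N x * D x)
      + 2 / M * (LINT x|law f n \<theta>. (D x - M)\<^sup>2)" .
    \<comment> \<open>Each \<open>u (x i)\<close> is absorbed as the density that puts the signal at
      \<open>i\<close>, so the rejections are now averaged under the laws that occur in the
      prior.\<close>
    have "(LINT x|law f n \<theta>. ?N x * D x) = (\<Sum>i\<in>B. LINT x|law f n \<theta>. u (x i) * ?N x)"
    proof -
      have "?N x * D x = (\<Sum>i\<in>B. u (x i) * ?N x)" for x
        unfolding D_def by (subst mult.commute) (rule sum_distrib_right)
      then show ?thesis by (simp only: Bochner_Integration.integral_sum[OF int_uN])
    qed
    also have "\<dots> = (\<Sum>i\<in>B. LINT x|?P i. indicator (- A) (x i) * ?N x)"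
      by (intro sum.cong refl E_ind[symmetric] meas_N)
    finally have ND: "(LINT x|law f n \<theta>. ?N x * D x) =
      (\<Sum>i\<in>B. LINT x|?P i. indicator (- A) (x i) * ?N x)" .
    have first: "2 * c / M * (LINT x|law f n \<theta>. ?N x * D x) \<le>
        2 * sqrt \<rho> * (\<Sum>i\<in>B. LINT x|?P i. ?N x)"
      unfolding ND
    proof (rule mult_mono)
      have "\<rho> = sqrt \<rho> * sqrt \<rho>" using \<rho> by simp
      also have "\<dots> \<le> sqrt \<rho> * p" using p_pos \<rho> by (intro mult_left_mono) auto
      finally have "\<rho> / p \<le> sqrt \<rho>" using p_pos by (simp add: divide_le_eq)
      moreover have "2 * c / M = 2 * (\<rho> / p)" using B by (simp add: c_def M_def)
      ultimately show "2 * c / M \<le> 2 * sqrt \<rho>" by simp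
      have meas_N': "?N \<in> borel_measurable (?P i)" for i by (intro borel_measurable_sum \<phi>_law)
      show "(\<Sum>i\<in>B. LINT x|?P i. indicator (- A) (x i) * ?N x) \<le> (\<Sum>i\<in>B. LINT x|?P i. ?N x)"
        using N_bd by (intro sum_mono integral_mono int_P[of _ _ "real m"] borel_measurable_times coord_law meas_N')
          (auto simp: indicator_def)
      show "0 \<le> (\<Sum>i\<in>B. LINT x|?P i. indicator (- A) (x i) * ?N x)"
        using N_bd by (intro sum_nonneg integral_nonneg_AE) auto
    qed (use \<rho> in auto)
    \<comment> \<open>The variance bound is \<open>m * (c * p)\<close>. Since
      \<open>M = m * p\<close>, the factor \<open>p\<close> cancels and \<open>2 * c\<close>
      remains, which is \<open>2 * \<rho>\<close> times the block size.\<close>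
    have "2 / M * (LINT x|law f n \<theta>. (D x - M)\<^sup>2) \<le> 2 / M * (real m * (c * p))"
      using null_sum_variance[where B=B and \<theta>=\<theta> and u=u and c=c] B u M
      by (intro mult_left_mono) (auto simp: D_def M_def p_def)
    also have "2 / M * (real m * (c * p)) = 2 * c" using p_pos B by (simp add: M_def)
    also have "\<dots> \<le> real m * (2 * \<rho> + sqrt \<rho>)" using \<rho> by (simp add: c_def algebra_simps)
    finally show ?thesis using main first by linarith
  qed
  with sum_split show ?thesis by (simp add: q_def algebra_simps)
qed

end

section \<open>From risk to power\<close>

text \<open>Redrawing one coordinate uniformly preserves the uniform distribution on the product.
  This allows the position in one block to be averaged while the positions in the other blocks are
  frozen.\<close>

lemma sum_PiE_resample:
  fixes G :: "('a \<Rightarrow> 'b) \<Rightarrow> real"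
  assumes "finite J" "j \<in> J" "\<And>i. i \<in> J \<Longrightarrow> finite (B i)"
  shows "(\<Sum>I\<in>PiE J B. \<Sum>i\<in>B j. G (I(j := i))) = real (card (B j)) * (\<Sum>I\<in>PiE J B. G I)"
proof -
  let ?J = "J - {j}"
  have "insert j ?J = J" using assms by auto
  then have eq: "PiE J B = (\<lambda>(y, g). g(j := y)) ` (B j \<times> PiE ?J B)"
    using PiE_insert_eq[of j ?J B] by simp
  have inj: "inj_on (\<lambda>(y, g). g(j := y)) (B j \<times> PiE ?J B)"
    by (rule inj_combinator) simp
  have split: "(\<Sum>I\<in>PiE J B. H I) = (\<Sum>y\<in>B j. \<Sum>g\<in>PiE ?J B. H (g(j := y)))"
    for H :: "('a \<Rightarrow> 'b) \<Rightarrow> real"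
    unfolding eq by (subst sum.reindex[OF inj]) (simp add: sum.cartesian_product split_def)
  show ?thesis
    unfolding split by (simp add: sum.swap[of _ "B j"])
qed

lemma ratio_le_1: "v \<le> r \<Longrightarrow> v / max 1 r \<le> 1" for v r :: real
  by (subst divide_le_eq_1_pos) auto

context noise_model
begin

lemma FDR_ratio:
  assumes "\<psi> \<in> procedures n"
  shows "0 \<le> (\<Sum>i\<in>{1..n}. of_bool (\<theta> i = 0) * real (\<psi> x i)) / max 1 (\<Sum>i\<in>{1..n}. real (\<psi> x i))"
    and "(\<Sum>i\<in>{1..n}. of_bool (\<theta> i = 0) * real (\<psi> x i)) / max 1 (\<Sum>i\<in>{1..n}. real (\<psi> x i)) \<le> 1"
    and "(\<lambda>x. (\<Sum>i\<in>{1..n}. of_bool (\<theta> i = 0) * real (\<psi> x i)) / max 1 (\<Sum>i\<in>{1..n}. real (\<psi> x i)))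
      \<in> borel_measurable (law f n \<theta>')"
proof -
  let ?V = "\<Sum>i\<in>{1..n}. of_bool (\<theta> i = 0) * real (\<psi> x i)" and ?R = "\<Sum>i\<in>{1..n}. real (\<psi> x i)"
  show "0 \<le> ?V / max 1 ?R" by (intro divide_nonneg_nonneg sum_nonneg) auto
  have "?V \<le> ?R" by (intro sum_mono) auto
  then show "?V / max 1 ?R \<le> 1" by (rule ratio_le_1)
  show "(\<lambda>x. (\<Sum>i\<in>{1..n}. of_bool (\<theta> i = 0) * real (\<psi> x i)) / max 1 (\<Sum>i\<in>{1..n}. real (\<psi> x i)))
      \<in> borel_measurable (law f n \<theta>')"
    by (intro borel_measurable_divide borel_measurable_sum borel_measurable_times borel_measurable_max
      measurable_procedure[OF assms] borel_measurable_const)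
qed

text \<open>Nonnegativity is claimed only on the space of the law: measurability into
  \<open>{0, 1}\<close> says nothing about the values of \<open>\<psi>\<close> outside it.\<close>

lemma FNR_ratio:
  assumes \<psi>: "\<psi> \<in> procedures n"
  shows "x \<in> space (law f n \<theta>') \<Longrightarrow>
      0 \<le> (\<Sum>i\<in>{1..n}. of_bool (\<theta> i \<noteq> 0) * (1 - real (\<psi> x i))) / max 1 (real (card (nonzero n \<theta>)))"
    and "(\<Sum>i\<in>{1..n}. of_bool (\<theta> i \<noteq> 0) * (1 - real (\<psi> x i))) / max 1 (real (card (nonzero n \<theta>))) \<le> 1"
    and "(\<lambda>x. (\<Sum>i\<in>{1..n}. of_bool (\<theta> i \<noteq> 0) * (1 - real (\<psi> x i))) / max 1 (real (card (nonzero n \<theta>))))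
      \<in> borel_measurable (law f n \<theta>')"
proof -
  let ?V = "\<Sum>i\<in>{1..n}. of_bool (\<theta> i \<noteq> 0) * (1 - real (\<psi> x i))" and ?R = "real (card (nonzero n \<theta>))"
  {
    assume x: "x \<in> space (law f n \<theta>')"
    have "0 \<le> of_bool (\<theta> i \<noteq> 0) * (1 - real (\<psi> x i))" if "i \<in> {1..n}" for i
      using procedure_cases[OF \<psi> that x] by auto
    then show "0 \<le> ?V / max 1 ?R" by (intro divide_nonneg_nonneg sum_nonneg) auto
  }
  have "?V \<le> (\<Sum>i\<in>{1..n}. of_bool (\<theta> i \<noteq> 0))" by (intro sum_mono) auto
  also have "\<dots> = ?R" by (subst sum_of_bool_eq) (auto simp: nonzero_def Int_def)
  finally show "?V / max 1 ?R \<le> 1" by (rule ratio_le_1)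
  show "(\<lambda>x. (\<Sum>i\<in>{1..n}. of_bool (\<theta> i \<noteq> 0) * (1 - real (\<psi> x i))) / max 1 (real (card (nonzero n \<theta>))))
      \<in> borel_measurable (law f n \<theta>')"
    by (intro borel_measurable_divide borel_measurable_sum borel_measurable_times borel_measurable_max
      borel_measurable_diff measurable_procedure[OF \<psi>] borel_measurable_const)
qed

lemma
  assumes \<psi>: "\<psi> \<in> procedures n"
  shows FDR_bounds: "0 \<le> FDR f n \<theta> \<psi>" "FDR f n \<theta> \<psi> \<le> 1"
    and FNR_bounds: "0 \<le> FNR f n \<theta> \<psi>" "FNR f n \<theta> \<psi> \<le> 1"
proof -
  interpret prob_space "law f n \<theta>" by (rule prob_space_law)
  note D = FDR_ratio[OF \<psi>, where \<theta>=\<theta>] and N = FNR_ratio[OF \<psi>, where \<theta>=\<theta>]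
  show "0 \<le> FDR f n \<theta> \<psi>" unfolding FDR_def using D by (intro integral_nonneg_AE always_eventually allI)
  show "0 \<le> FNR f n \<theta> \<psi>" unfolding FNR_def using N(1) by (intro integral_nonneg_AE AE_I2)
  have "FDR f n \<theta> \<psi> \<le> expectation (\<lambda>x. 1)" unfolding FDR_def using D by (intro integral_mono') auto
  then show "FDR f n \<theta> \<psi> \<le> 1" by (simp add: prob_space)
  have "FNR f n \<theta> \<psi> \<le> expectation (\<lambda>x. 1)" unfolding FNR_def using N by (intro integral_mono') auto
  then show "FNR f n \<theta> \<psi> \<le> 1" by (simp add: prob_space)
qed

lemma risk_le_worst_risk:
  assumes "\<psi> \<in> procedures n" "\<theta> \<in> signal_class n k a"
  shows "risk f n \<theta> \<psi> \<le> worst_risk f n k a \<psi>"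
  unfolding worst_risk_def
proof (rule cSUP_upper[OF assms(2)])
  have "risk f n \<theta> \<psi> \<le> 2" for \<theta>
    using FDR_bounds(2)[OF assms(1), of \<theta>] FNR_bounds(2)[OF assms(1), of \<theta>] by (simp add: risk_def)
  then show "bdd_above ((\<lambda>\<theta>. risk f n \<theta> \<psi>) ` signal_class n k a)"
    by (intro bdd_aboveI[of _ 2]) auto
qed

text \<open>A procedure rejecting more than \<open>c\<close> hypotheses, with \<open>c\<close> much larger than the number of
  signals, has false discovery proportion close to 1, so it is no better than one rejecting nothing.\<close>

definition capped :: "nat \<Rightarrow> ((nat \<Rightarrow> real) \<Rightarrow> nat \<Rightarrow> nat) \<Rightarrow> real \<Rightarrow> nat \<Rightarrow> (nat \<Rightarrow> real) \<Rightarrow> real" where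
  "capped n \<psi> c i x = (if (\<Sum>k\<in>{1..n}. real (\<psi> x k)) \<le> c then min 1 (real (\<psi> x i)) else 0)"

text \<open>The term \<open>min 1\<close> makes these bounds hold at every \<open>x\<close>, also
  outside the space of the law, which is the form that \<open>block_power\<close> asks for.\<close>

lemma capped_bounds: "0 \<le> capped n \<psi> c i x" "capped n \<psi> c i x \<le> 1"
  by (auto simp: capped_def)

lemma measurable_capped:
  assumes \<psi>: "\<psi> \<in> procedures n" and i: "i \<in> {1..n}"
  shows "capped n \<psi> c i \<in> borel_measurable (\<Pi>\<^sub>M i\<in>{1..n}. borel)"
proof -
  have m: "(\<lambda>x. real (\<psi> x i)) \<in> borel_measurable (\<Pi>\<^sub>M i\<in>{1..n}. borel)" if "i \<in> {1..n}" for i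
    using measurable_procedure[OF \<psi> that] by (simp only: measurable_cong_sets[OF sets_law refl])
  have [measurable]: "(\<lambda>x. \<Sum>k\<in>{1..n}. real (\<psi> x k)) \<in> borel_measurable (\<Pi>\<^sub>M i\<in>{1..n}. borel)"
    by (intro borel_measurable_sum m)
  have [measurable]: "(\<lambda>x. real (\<psi> x i)) \<in> borel_measurable (\<Pi>\<^sub>M i\<in>{1..n}. borel)" by (rule m[OF i])
  show ?thesis unfolding capped_def[abs_def] by measurable
qed

text \<open>Let \<open>r\<close> be the number of rejections and \<open>T \<le> k\<close> the number
  of true ones. If \<open>r > K * k\<close>, the false discovery proportion is
  \<open>1 - T / r\<close>, at least \<open>1 - 1 / K\<close>. Otherwise the cap is inactive and the
  missed proportion is exactly one minus the captured one.\<close>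

lemma risk_ge_capped:
  assumes \<psi>: "\<psi> \<in> procedures n" and k: "card (nonzero n \<theta>) = k" "0 < k" and K: "0 < K"
  shows "1 - 1 / K - (\<Sum>i\<in>nonzero n \<theta>. LINT x|law f n \<theta>. capped n \<psi> (K * real k) i x) / real k
    \<le> risk f n \<theta> \<psi>"
proof -
  interpret prob_space "law f n \<theta>" by (rule prob_space_law)
  let ?S = "nonzero n \<theta>" and ?\<phi> = "capped n \<psi> (K * real k)"
  have S: "?S \<subseteq> {1..n}" "finite ?S" by (auto simp: nonzero_def)
  let ?D = "\<lambda>x. (\<Sum>i\<in>{1..n}. of_bool (\<theta> i = 0) * real (\<psi> x i)) / max 1 (\<Sum>i\<in>{1..n}. real (\<psi> x i))"
  let ?N = "\<lambda>x. (\<Sum>i\<in>{1..n}. of_bool (\<theta> i \<noteq> 0) * (1 - real (\<psi> x i))) / max 1 (real (card ?S))"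
  note D = FDR_ratio[OF \<psi>, where \<theta>=\<theta>] and N = FNR_ratio[OF \<psi>, where \<theta>=\<theta>]
  have int_D: "integrable (law f n \<theta>) ?D"
  proof (rule integrable_const_bound[of _ 1])
    show "AE x in law f n \<theta>. norm (?D x) \<le> 1"
    proof (rule AE_I2)
      fix x show "norm (?D x) \<le> 1" using D(1)[of x] D(2)[of x] unfolding real_norm_def by linarith
    qed
  qed (rule D(3))
  have int_N: "integrable (law f n \<theta>) ?N"
  proof (rule integrable_const_bound[of _ 1])
    show "AE x in law f n \<theta>. norm (?N x) \<le> 1"
    proof (rule AE_I2)
      fix x assume "x \<in> space (law f n \<theta>)"
      from N(1)[OF this] N(2)[of x] show "norm (?N x) \<le> 1" unfolding real_norm_def by linarith
    qed
  qed (rule N(3))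
  have int_\<phi>: "integrable (law f n \<theta>) (?\<phi> i)" if "i \<in> ?S" for i
  proof (rule integrable_const_bound[of _ 1])
    show "?\<phi> i \<in> borel_measurable (law f n \<theta>)"
      using measurable_capped[OF \<psi>, of i] that S by (simp only: measurable_cong_sets[OF sets_law refl]) auto
  qed (use capped_bounds in auto)
  have pointwise: "1 - 1 / K - (\<Sum>i\<in>?S. ?\<phi> i x) / real k \<le> ?D x + ?N x"
    if x: "x \<in> space (law f n \<theta>)" for x
  proof -
    define T where "T = (\<Sum>i\<in>?S. real (\<psi> x i))"
    define r where "r = (\<Sum>i\<in>{1..n}. real (\<psi> x i))"
    have 01: "\<psi> x i = 0 \<or> \<psi> x i = 1" if "i \<in> {1..n}" for i
      by (rule procedure_cases[OF \<psi> that x])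
    have "(\<Sum>i\<in>{1..n}. of_bool (\<theta> i \<noteq> 0) * (1 - real (\<psi> x i))) = (\<Sum>i\<in>?S. 1 - real (\<psi> x i))"
      by (intro sum.mono_neutral_cong_right) (auto simp: nonzero_def)
    also have "\<dots> = real k - T" by (simp add: sum_subtractf T_def k)
    finally have N_eq: "?N x = (real k - T) / real k" using k by simp
    have "(\<Sum>i\<in>{1..n}. of_bool (\<theta> i \<noteq> 0) * real (\<psi> x i)) = T"
      unfolding T_def by (intro sum.mono_neutral_cong_right) (auto simp: nonzero_def)
    moreover have "(\<Sum>i\<in>{1..n}. of_bool (\<theta> i = 0) * real (\<psi> x i)) +
        (\<Sum>i\<in>{1..n}. of_bool (\<theta> i \<noteq> 0) * real (\<psi> x i)) = r"
      unfolding r_def sum.distrib[symmetric] by (intro sum.cong) auto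
    ultimately have D_eq: "?D x = (r - T) / max 1 r" unfolding r_def[symmetric] by simp
    have "T \<le> (\<Sum>i\<in>?S. 1)" unfolding T_def using 01 S by (intro sum_mono) fastforce
    then have T: "T \<le> real k" using k by simp
    show ?thesis
    proof (cases "r \<le> K * real k")
      case True
      have "(\<Sum>i\<in>?S. ?\<phi> i x) = T"
        unfolding T_def
      proof (rule sum.cong[OF refl])
        fix i assume "i \<in> ?S"
        then have "\<psi> x i = 0 \<or> \<psi> x i = 1" using S by (intro 01) auto
        then show "?\<phi> i x = real (\<psi> x i)" using True by (auto simp: capped_def r_def)
      qed
      moreover have "0 \<le> 1 / K" using K by simp
      moreover have "0 \<le> ?D x" by (rule D(1))
      ultimately show ?thesis unfolding N_eq using k by (simp add: field_simps)
    next
      case False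
      then have "(\<Sum>i\<in>?S. ?\<phi> i x) = 0" by (simp add: capped_def r_def)
      have "0 < r" using False K k by (smt (verit) mult_pos_pos of_nat_0_less_iff)
      moreover have "r = real (\<Sum>i\<in>{1..n}. \<psi> x i)" by (simp add: r_def)
      \<comment> \<open>The count \<open>r\<close> is integral, so positivity gives at least 1 and
        the maximum in the denominator of the false discovery proportion is
        \<open>r\<close>.\<close>
      ultimately have r: "1 \<le> r" by (metis of_nat_0_less_iff One_nat_def Suc_leI of_nat_1 of_nat_mono)
      have "T / r \<le> real k / r" using T r by (intro divide_right_mono) auto
      also have "\<dots> \<le> real k / (K * real k)" using False K k r by (intro divide_left_mono) auto
      also have "\<dots> = 1 / K" using k by simp
      finally have "1 - 1 / K \<le> ?D x" unfolding D_eq using r by (simp add: diff_divide_distrib)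
      moreover have "0 \<le> ?N x" unfolding N_eq using T by simp
      ultimately show ?thesis using \<open>(\<Sum>i\<in>?S. ?\<phi> i x) = 0\<close> by simp
    qed
  qed
  have int_sum: "integrable (law f n \<theta>) (\<lambda>x. \<Sum>i\<in>?S. ?\<phi> i x)"
    by (intro Bochner_Integration.integrable_sum int_\<phi>)
  have "1 - 1 / K - (\<Sum>i\<in>?S. expectation (?\<phi> i)) / real k =
      expectation (\<lambda>x. 1 - 1 / K - (\<Sum>i\<in>?S. ?\<phi> i x) / real k)"
    using int_sum int_\<phi> by (simp add: prob_space Bochner_Integration.integral_sum)
  also have "\<dots> \<le> expectation (\<lambda>x. ?D x + ?N x)"
    using int_sum int_D int_N pointwise by (intro integral_mono) auto
  also have "\<dots> = risk f n \<theta> \<psi>"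
    unfolding risk_def FDR_def FNR_def by (rule Bochner_Integration.integral_add[OF int_D int_N])
  finally show ?thesis .
qed

end

section \<open>Block priors\<close>

text \<open>A sum over \<open>j\<close> rather than a case distinction: for disjoint blocks at most
  one term is nonzero, and one block can be split off by removing its term.\<close>

definition block_signal :: "nat \<Rightarrow> nat set \<Rightarrow> (nat \<Rightarrow> real) \<Rightarrow> (nat \<Rightarrow> nat) \<Rightarrow> nat \<Rightarrow> real" where
  "block_signal n J a I = (\<lambda>i\<in>{1..n}. \<Sum>j\<in>J. if I j = i then a j else 0)"

text \<open>Brings the prior into the form required by \<open>block_power\<close>: a base vector
  vanishing on block \<open>j\<close>, with one coordinate of that block raised to
  \<open>a j\<close>.\<close>

lemma block_signal_update:
  assumes J: "finite J" "j \<in> J" and I: "I \<in> PiE J B" and i: "i \<in> B j" "B j \<subseteq> {1..n}"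
    and disj: "disjoint_family_on B J"
  shows "block_signal n J a (I(j := i)) = (block_signal n (J - {j}) a I)(i := a j)"
    and "block_signal n (J - {j}) a I i = 0"
proof -
  have ne: "I j' \<noteq> i" if "j' \<in> J - {j}" for j'
  proof -
    have "I j' \<in> B j'" "B j' \<inter> B j = {}"
      using that I disjoint_family_onD[OF disj, of j' j] J by auto
    then show ?thesis using i by auto
  qed
  then show 0: "block_signal n (J - {j}) a I i = 0"
    using i by (auto simp: block_signal_def intro!: sum.neutral)
  have i_n: "i \<in> {1..n}" using i by auto
  show "block_signal n J a (I(j := i)) = (block_signal n (J - {j}) a I)(i := a j)"
  proof (rule ext)
    fix l
    have "(\<Sum>j'\<in>J. if (I(j := i)) j' = l then a j' else 0) =
        (if i = l then a j else 0) + (\<Sum>j'\<in>J - {j}. if I j' = l then a j' else 0)"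
      using J by (subst sum.remove[of J j]) (auto intro!: sum.cong)
    then show "block_signal n J a (I(j := i)) l = ((block_signal n (J - {j}) a I)(i := a j)) l"
      using 0 i_n by (auto simp: block_signal_def)
  qed
qed

lemma block_signal_at:
  assumes J: "finite J" "j \<in> J" and I: "I \<in> PiE J B" "B j \<subseteq> {1..n}" and disj: "disjoint_family_on B J"
  shows "block_signal n J a I (I j) = a j"
proof -
  have "I j \<in> B j" using I J by auto
  from block_signal_update(1)[OF J I(1) this I(2) disj, of a] show ?thesis by simp
qed

lemma inj_on_block_choice:
  assumes "I \<in> PiE J B" "disjoint_family_on B J"
  shows "inj_on I J"
  using assms by (fastforce simp: inj_on_def disjoint_family_on_def PiE_iff)

lemma nonzero_block_signal:
  assumes J: "finite J" and B: "\<And>j. j \<in> J \<Longrightarrow> B j \<subseteq> {1..n}" and I: "I \<in> PiE J B"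
    and disj: "disjoint_family_on B J" and a: "\<And>j. j \<in> J \<Longrightarrow> 0 < a j"
  shows "nonzero n (block_signal n J a I) = I ` J"
proof (intro set_eqI iffI)
  fix i assume "i \<in> nonzero n (block_signal n J a I)"
  then have "(\<Sum>j\<in>J. if I j = i then a j else 0) \<noteq> 0" by (auto simp: nonzero_def block_signal_def)
  then show "i \<in> I ` J" by (rule contrapos_np) (auto intro!: sum.neutral)
next
  fix i assume "i \<in> I ` J"
  then obtain j where j: "j \<in> J" "i = I j" by auto
  have "i \<in> {1..n}" using j I B[OF j(1)] by (auto simp: PiE_iff subset_iff)
  moreover have "block_signal n J a I i = a j"
    unfolding j(2) using block_signal_at[OF J j(1) I B[OF j(1)] disj] .
  ultimately show "i \<in> nonzero n (block_signal n J a I)" using a[OF j(1)] by (simp add: nonzero_def)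
qed

context noise_model
begin

text \<open>The supremum dominates the average over all choices of positions. The averages are kept
  as unnormalised sums over \<open>PiE\<close>, with \<open>w\<close> the number of choices, so no
  probability space for the prior is needed.\<close>

lemma worst_risk_lower_bound:
  assumes B: "\<And>j. j \<in> {1..k} \<Longrightarrow> B j \<subseteq> {1..n}" "\<And>j. j \<in> {1..k} \<Longrightarrow> card (B j) = m"
    and disj: "disjoint_family_on B {1..k}" and pos: "0 < m" "0 < k" "0 < \<rho>" "0 < K"
    and a: "\<And>j. j \<in> {1..k} \<Longrightarrow> 0 < a j" and A: "\<And>j. j \<in> {1..k} \<Longrightarrow> A j \<in> sets borel"
    and bounded_lr: "\<And>j y. j \<in> {1..k} \<Longrightarrow> y \<notin> A j \<Longrightarrow> lr (a j) y \<le> \<rho> * real m"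
    and \<psi>: "\<psi> \<in> procedures n"
  shows "1 - (\<Sum>j\<in>{1..k}. measure (noise f (a j)) (A j)) / real k
      - (1 / K + 2 * \<rho> + sqrt \<rho> + 2 * sqrt \<rho> * K) \<le> worst_risk f n k a \<psi>"
proof -
  let ?J = "{1..k}"
  let ?\<Omega> = "PiE ?J B"
  let ?\<theta> = "block_signal n ?J a"
  let ?\<phi> = "capped n \<psi> (K * real k)"
  define W where "W = worst_risk f n k a \<psi>"
  define w where "w = real (card ?\<Omega>)"
  define q where "q j = measure (noise f (a j)) (A j)" for j
  let ?E = "\<lambda>I i. LINT x|law f n (?\<theta> I). ?\<phi> i x"
  have finB: "finite (B j)" if "j \<in> ?J" for j using B(1)[OF that] by (rule finite_subset) simp
  have "B j \<noteq> {}" if "j \<in> ?J" for j using B(2)[OF that] pos by auto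
  then have "?\<Omega> \<noteq> {}" by (simp add: PiE_eq_empty_iff)
  moreover have "finite ?\<Omega>" using finB by (intro finite_PiE) auto
  ultimately have w: "0 < w" by (simp add: w_def card_gt_0_iff)
  have nz: "nonzero n (?\<theta> I) = I ` ?J" if "I \<in> ?\<Omega>" for I
    using nonzero_block_signal[OF _ B(1) that disj a] by simp
  have inj: "inj_on I ?J" if "I \<in> ?\<Omega>" for I using inj_on_block_choice[OF that disj] .
  have class_mem: "?\<theta> I \<in> signal_class n k a" if I: "I \<in> ?\<Omega>" for I
  proof -
    have "I ` ?J \<subseteq> {1..n}" using nz[OF I] by (auto simp: nonzero_def)
    moreover have "\<forall>j\<in>?J. a j \<le> \<bar>?\<theta> I (I j)\<bar>"
    proof
      fix j assume j: "j \<in> ?J"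
      show "a j \<le> \<bar>?\<theta> I (I j)\<bar>"
        using block_signal_at[OF _ j I B(1)[OF j] disj, of a] by simp
    qed
    moreover have "card (nonzero n (?\<theta> I)) \<le> k" using card_image[OF inj[OF I]] nz[OF I] by simp
    moreover have "?\<theta> I \<in> vectors n" by (simp add: block_signal_def vectors_def)
    ultimately show ?thesis using inj[OF I] by (auto simp: signal_class_def)
  qed
  have risk_I: "1 - 1 / K - (\<Sum>j\<in>?J. ?E I (I j)) / real k \<le> W" if I: "I \<in> ?\<Omega>" for I
  proof -
    have "card (nonzero n (?\<theta> I)) = k" using card_image[OF inj[OF I]] nz[OF I] by simp
    from risk_ge_capped[OF \<psi> this pos(2,4)]
    have "1 - 1 / K - (\<Sum>j\<in>?J. ?E I (I j)) / real k \<le> risk f n (?\<theta> I) \<psi>"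
      unfolding nz[OF I] sum.reindex[OF inj[OF I]] comp_def .
    also have "\<dots> \<le> W" unfolding W_def by (rule risk_le_worst_risk[OF \<psi> class_mem[OF I]])
    finally show ?thesis .
  qed
  define N where "N j I = (LINT x|law f n (?\<theta> I). (\<Sum>i\<in>B j. ?\<phi> i x))" for j I
  have block: "(\<Sum>I\<in>?\<Omega>. ?E I (I j)) \<le> w * (q j + 2 * \<rho> + sqrt \<rho>) + 2 * sqrt \<rho> * (\<Sum>I\<in>?\<Omega>. N j I)"
    if j: "j \<in> ?J" for j
  proof -
    \<comment> \<open>The choice \<open>I\<close> is frozen outside block \<open>j\<close> and only
      the position there varies; \<open>sum_PiE_resample\<close> later turns both sides back into
      sums over all choices.\<close>
    have "(\<Sum>i\<in>B j. ?E (I(j := i)) i) \<le> real m * (q j + 2 * \<rho> + sqrt \<rho>)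
        + 2 * sqrt \<rho> * (\<Sum>i\<in>B j. N j (I(j := i)))" if I: "I \<in> ?\<Omega>" for I
    proof -
      let ?base = "block_signal n (?J - {j}) a I"
      note upd = block_signal_update[OF _ j I _ B(1)[OF j] disj, of _ a]
      have eq: "?\<theta> (I(j := i)) = ?base(i := a j)" if "i \<in> B j" for i using upd(1)[OF _ that] by simp
      have "(\<Sum>i\<in>B j. LINT x|law f n (?base(i := a j)). ?\<phi> i x) \<le>
        real m * (measure (noise f (a j)) (A j) + 2 * \<rho> + sqrt \<rho>)
        + 2 * sqrt \<rho> * (\<Sum>i\<in>B j. LINT x|law f n (?base(i := a j)). (\<Sum>l\<in>B j. ?\<phi> l x))"
        using upd(2) B[OF j] pos A[OF j] bounded_lr[OF j] capped_bounds measurable_capped[OF \<psi>]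
        by (intro block_power) auto
      then show ?thesis by (simp only: eq N_def q_def cong: sum.cong)
    qed
    then have "(\<Sum>I\<in>?\<Omega>. \<Sum>i\<in>B j. ?E (I(j := i)) i) \<le>
        (\<Sum>I\<in>?\<Omega>. real m * (q j + 2 * \<rho> + sqrt \<rho>) + 2 * sqrt \<rho> * (\<Sum>i\<in>B j. N j (I(j := i))))"
      by (intro sum_mono)
    also have "\<dots> = w * (real m * (q j + 2 * \<rho> + sqrt \<rho>)) + 2 * sqrt \<rho> * (\<Sum>I\<in>?\<Omega>. \<Sum>i\<in>B j. N j (I(j := i)))"
      by (simp add: sum.distrib sum_distrib_left w_def)
    also have "(\<Sum>I\<in>?\<Omega>. \<Sum>i\<in>B j. N j (I(j := i))) = real m * (\<Sum>I\<in>?\<Omega>. N j I)"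
      using sum_PiE_resample[of ?J j B "N j"] j finB B(2)[OF j] by simp
    also have "(\<Sum>I\<in>?\<Omega>. \<Sum>i\<in>B j. ?E (I(j := i)) i) = real m * (\<Sum>I\<in>?\<Omega>. ?E I (I j))"
      using sum_PiE_resample[of ?J j B "\<lambda>I. ?E I (I j)"] j finB B(2)[OF j] by simp
    finally have "real m * (\<Sum>I\<in>?\<Omega>. ?E I (I j)) \<le>
        real m * (w * (q j + 2 * \<rho> + sqrt \<rho>) + 2 * sqrt \<rho> * (\<Sum>I\<in>?\<Omega>. N j I))"
      by (simp add: algebra_simps)
    then show ?thesis using pos by simp
  qed
  \<comment> \<open>The blocks are disjoint, so the rejections counted block by block add up to at
    most the cap. How a procedure distributes them is irrelevant.\<close>
  have total: "(\<Sum>j\<in>?J. N j I) \<le> K * real k" for I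
  proof -
    interpret prob_space "law f n (?\<theta> I)" by (rule prob_space_law)
    have int_\<phi>: "integrable (law f n (?\<theta> I)) (?\<phi> i)" if "i \<in> B j" "j \<in> ?J" for i j
    proof (rule integrable_const_bound[of _ 1])
      show "?\<phi> i \<in> borel_measurable (law f n (?\<theta> I))"
        using measurable_capped[OF \<psi>, of i] that(1) B(1)[OF that(2)]
        by (simp only: measurable_cong_sets[OF sets_law refl]) auto
    qed (use capped_bounds in auto)
    have int_N: "integrable (law f n (?\<theta> I)) (\<lambda>x. \<Sum>i\<in>B j. ?\<phi> i x)" if "j \<in> ?J" for j
      using int_\<phi> that by (intro Bochner_Integration.integrable_sum)
    have "(\<Sum>j\<in>?J. N j I) = expectation (\<lambda>x. \<Sum>j\<in>?J. \<Sum>i\<in>B j. ?\<phi> i x)"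
      unfolding N_def by (intro Bochner_Integration.integral_sum[symmetric] int_N)
    also have "\<dots> \<le> expectation (\<lambda>x. K * real k)"
    proof (rule integral_mono)
      show "integrable (law f n (?\<theta> I)) (\<lambda>x. \<Sum>j\<in>?J. \<Sum>i\<in>B j. ?\<phi> i x)"
        by (intro Bochner_Integration.integrable_sum[OF int_N])
      fix x
      have "(\<Sum>j\<in>?J. \<Sum>i\<in>B j. ?\<phi> i x) = (\<Sum>i\<in>(\<Union>j\<in>?J. B j). ?\<phi> i x)"
        using finB disj by (intro sum.UNION_disjoint_family[symmetric]) auto
      also have "\<dots> \<le> (\<Sum>i\<in>{1..n}. ?\<phi> i x)"
        using capped_bounds by (intro sum_mono2 UN_least B(1)) auto
      also have "\<dots> \<le> K * real k"
      proof (cases "(\<Sum>i\<in>{1..n}. real (\<psi> x i)) \<le> K * real k")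
        case True
        have "(\<Sum>i\<in>{1..n}. ?\<phi> i x) \<le> (\<Sum>i\<in>{1..n}. real (\<psi> x i))"
          by (intro sum_mono) (auto simp: capped_def)
        with True show ?thesis by simp
      next
        case False
        then show ?thesis using pos by (simp add: capped_def)
      qed
      finally show "(\<Sum>j\<in>?J. \<Sum>i\<in>B j. ?\<phi> i x) \<le> K * real k" .
    qed (rule integrable_const)
    also have "\<dots> = K * real k" unfolding lebesgue_integral_const prob_space by simp
    finally show ?thesis .
  qed
  have "w * (1 - 1 / K) - (\<Sum>I\<in>?\<Omega>. \<Sum>j\<in>?J. ?E I (I j)) / real k =
      (\<Sum>I\<in>?\<Omega>. 1 - 1 / K - (\<Sum>j\<in>?J. ?E I (I j)) / real k)"
    by (simp add: sum_subtractf sum_divide_distrib w_def)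
  also have "\<dots> \<le> (\<Sum>I\<in>?\<Omega>. W)" by (intro sum_mono risk_I)
  also have "\<dots> = w * W" by (simp add: w_def)
  finally have avg: "w * (1 - 1 / K) - (\<Sum>I\<in>?\<Omega>. \<Sum>j\<in>?J. ?E I (I j)) / real k \<le> w * W" .
  have "(\<Sum>I\<in>?\<Omega>. \<Sum>j\<in>?J. ?E I (I j)) = (\<Sum>j\<in>?J. \<Sum>I\<in>?\<Omega>. ?E I (I j))" by (rule sum.swap)
  also have "\<dots> \<le> (\<Sum>j\<in>?J. w * (q j + 2 * \<rho> + sqrt \<rho>) + 2 * sqrt \<rho> * (\<Sum>I\<in>?\<Omega>. N j I))"
    by (intro sum_mono block)
  also have "\<dots> = w * (\<Sum>j\<in>?J. q j) + w * real k * (2 * \<rho> + sqrt \<rho>)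
      + 2 * sqrt \<rho> * (\<Sum>I\<in>?\<Omega>. \<Sum>j\<in>?J. N j I)"
    by (simp add: sum.distrib sum_distrib_left[symmetric] sum.swap[of "\<lambda>j I. N j I"] algebra_simps)
  also have "(\<Sum>I\<in>?\<Omega>. \<Sum>j\<in>?J. N j I) \<le> w * (K * real k)"
    using sum_mono[of ?\<Omega> "\<lambda>I. \<Sum>j\<in>?J. N j I" "\<lambda>_. K * real k"] total by (simp add: w_def)
  finally have "(\<Sum>I\<in>?\<Omega>. \<Sum>j\<in>?J. ?E I (I j)) \<le> w * (\<Sum>j\<in>?J. q j) + w * real k * (2 * \<rho> + sqrt \<rho>)
      + 2 * sqrt \<rho> * (w * (K * real k))"
    using pos by (simp add: mult_left_mono)
  then have "(\<Sum>I\<in>?\<Omega>. \<Sum>j\<in>?J. ?E I (I j)) / real k \<le> (w * (\<Sum>j\<in>?J. q j) + w * real k * (2 * \<rho> + sqrt \<rho>)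
      + 2 * sqrt \<rho> * (w * (K * real k))) / real k"
    by (rule divide_right_mono) simp
  also have "\<dots> = w * ((\<Sum>j\<in>?J. q j) / real k + 2 * \<rho> + sqrt \<rho> + 2 * sqrt \<rho> * K)"
    using pos by (simp add: field_simps)
  finally have "w * (1 - 1 / K - ((\<Sum>j\<in>?J. q j) / real k + 2 * \<rho> + sqrt \<rho> + 2 * sqrt \<rho> * K)) \<le> w * W"
    using avg by (simp add: algebra_simps)
  then have "1 - 1 / K - ((\<Sum>j\<in>?J. q j) / real k + 2 * \<rho> + sqrt \<rho> + 2 * sqrt \<rho> * K) \<le> W"
    using w by simp
  then show ?thesis by (simp add: W_def q_def)
qed

end

section \<open>Minimax bounds at fixed sample size\<close>

text \<open>\<open>\<kappa> = 1\<close> is case (A), where \<open>g u = u\<close>, and \<open>\<kappa> = 2\<close> is case (B), where \<open>g u = 2 * u - 1\<close>.\<close>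

locale detection_model = noise_model +
  fixes \<kappa> :: real
  assumes \<kappa>_pos: "0 < \<kappa>"
    and detection_prob: "\<lbrakk>a \<noteq> 0; 0 < t\<rbrakk> \<Longrightarrow> \<kappa> * tail f \<bar>a\<bar> t \<le> measure (noise f a) {x. t \<le> \<bar>x\<bar>}"
    and tail_mono_signal: "\<lbrakk>0 < t; 0 < a; a \<le> b\<rbrakk> \<Longrightarrow> tail f a t \<le> tail f b t"
    and tail_pos: "\<lbrakk>0 < a; 0 < t\<rbrakk> \<Longrightarrow> 0 < tail f a t"
    and likelihood_ratio_test: "\<lbrakk>0 < a; 0 < t\<rbrakk> \<Longrightarrow> \<exists>A \<in> sets borel.
      measure (noise f a) A \<le> \<kappa> * tail f a t \<and> (\<forall>y. y \<notin> A \<longrightarrow> lr a y \<le> 1 / tail f 0 t)"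
begin

definition gap :: "real \<Rightarrow> real" where
  "gap u = 1 - \<kappa> * (1 - u)"

lemma gap_mono: "u \<le> v \<Longrightarrow> gap u \<le> gap v"
  using \<kappa>_pos by (simp add: gap_def)

text \<open>The right-hand side is the lower bound for the expected number of detections given by
  \<open>detection_prob\<close>, so the level condition and the \<open>detect\<close> premise of
  \<open>FNR_BH_le\<close> speak of the same quantity.\<close>

lemma gap_Lambda_vec:
  assumes "card (nonzero n \<theta>) = k" "0 < k"
  shows "real k * (1 - gap (Lambda_vec f k t n \<theta>)) = (\<Sum>i\<in>nonzero n \<theta>. \<kappa> * tail f \<bar>\<theta> i\<bar> t)"
proof -
  have "(\<Sum>i\<in>nonzero n \<theta>. \<kappa> * tail f \<bar>\<theta> i\<bar> t) = \<kappa> * (real k - (\<Sum>i\<in>nonzero n \<theta>. df f \<bar>\<theta> i\<bar> t))"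
    using assms by (simp add: tail_def sum_distrib_left[symmetric] sum_subtractf)
  moreover have "real k * (1 - gap (Lambda_vec f k t n \<theta>)) =
      \<kappa> * (real k - (\<Sum>i\<in>nonzero n \<theta>. df f \<bar>\<theta> i\<bar> t))"
    using assms by (simp add: gap_def Lambda_vec_def right_diff_distrib)
  ultimately show ?thesis by simp
qed

lemma gap_Lambda_sig:
  assumes "0 < k"
  shows "real k * (1 - gap (Lambda_sig f k t a)) = (\<Sum>j\<in>{1..k}. \<kappa> * tail f (a j) t)"
proof -
  have "(\<Sum>j\<in>{1..k}. \<kappa> * tail f (a j) t) = \<kappa> * (real k - (\<Sum>j\<in>{1..k}. df f (a j) t))"
    by (simp add: tail_def sum_distrib_left[symmetric] sum_subtractf)
  moreover have "real k * (1 - gap (Lambda_sig f k t a)) = \<kappa> * (real k - (\<Sum>j\<in>{1..k}. df f (a j) t))"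
    using assms by (simp add: gap_def Lambda_sig_def right_diff_distrib)
  ultimately show ?thesis by simp
qed

lemma gap_Lambda_vec_less_1:
  assumes "card (nonzero n \<theta>) = k" "0 < k" "0 < t"
  shows "gap (Lambda_vec f k t n \<theta>) < 1"
proof -
  have "nonzero n \<theta> \<noteq> {}" "finite (nonzero n \<theta>)" using assms(2) card_gt_0_iff[of "nonzero n \<theta>"]
    unfolding assms(1)[symmetric] by auto
  then have "0 < (\<Sum>i\<in>nonzero n \<theta>. \<kappa> * tail f \<bar>\<theta> i\<bar> t)"
    using assms \<kappa>_pos tail_pos by (intro sum_pos) (auto simp: nonzero_def)
  then show ?thesis
    unfolding gap_Lambda_vec[OF assms(1,2), of t, symmetric] using assms(2) by (simp add: zero_less_mult_iff)
qed

lemma gap_Lambda_sig_less_1: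
  assumes "0 < k" "0 < t" "\<And>j. j \<in> {1..k} \<Longrightarrow> 0 < a j"
  shows "gap (Lambda_sig f k t a) < 1"
proof -
  have "0 < (\<Sum>j\<in>{1..k}. \<kappa> * tail f (a j) t)"
    using assms \<kappa>_pos tail_pos by (intro sum_pos) auto
  then show ?thesis
    unfolding gap_Lambda_sig[OF assms(1), of t a, symmetric] using assms(1) by (simp add: zero_less_mult_iff)
qed

section \<open>Upper bounds for BH over the signal class\<close>

lemma level_condition_bounds:
  assumes "level_condition f k t d n l \<alpha>" "0 < k" "0 < n" "l < 1"
  shows "0 < \<alpha>" "\<alpha> \<le> 1"
proof -
  have "0 < 3 * real n * tail f 0 t / (real k * (1 - l))" using assms tail0_pos by simp
  then show "0 < \<alpha>" using assms by (auto simp: level_condition_def)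
  show "\<alpha> \<le> 1" using assms by (simp add: level_condition_def)
qed

lemma risk_BH_le:
  assumes k: "card (nonzero n \<theta>) = k" "0 < k" and t: "0 < t"
  defines "l \<equiv> gap (Lambda_vec f k t n \<theta>)"
  assumes level: "level_condition f k t d n l \<alpha>"
  shows "risk f n \<theta> (BH f n \<alpha>) \<le> l + \<alpha> + exp (- ((1 - l)\<^sup>2 / 32 * real k))"
proof -
  have "k \<le> n" using card_filter_le[of n "\<lambda>i. \<theta> i \<noteq> 0"] k by (simp add: nonzero_def)
  then have n: "0 < n" using k by simp
  have l: "l < 1" unfolding l_def by (rule gap_Lambda_vec_less_1[OF k t])
  note \<alpha> = level_condition_bounds[OF level k(2) n l]
  have "real k * (1 - l) \<le> (\<Sum>i\<in>nonzero n \<theta>. measure (noise f (\<theta> i)) {x. t \<le> \<bar>x\<bar>})"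
    unfolding l_def gap_Lambda_vec[OF k]
    by (intro sum_mono detection_prob t) (auto simp: nonzero_def)
  then have "FNR f n \<theta> (BH f n \<alpha>) \<le> l + exp (- ((1 - l)\<^sup>2 / 32 * real k))"
    using level by (intro FNR_BH_le[OF \<alpha> k l]) (auto simp: level_condition_def)
  with FDR_BH_le[OF \<alpha> n, of \<theta>] show ?thesis by (simp add: risk_def)
qed

text \<open>The \<open>k\<close> distinct positions carry nonzero entries because
  \<open>a j > 0\<close>; as the support has at most \<open>k\<close> elements, they exhaust it.
  Larger signals have larger tails, which gives the comparison of the two averages.\<close>

lemma signal_class_sparsity:
  assumes \<theta>: "\<theta> \<in> signal_class n k a" and a: "\<And>j. j \<in> {1..k} \<Longrightarrow> 0 < a j" and t: "0 < t"
  shows "card (nonzero n \<theta>) = k" "Lambda_vec f k t n \<theta> \<le> Lambda_sig f k t a"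
proof -
  obtain \<iota> where \<iota>: "inj_on \<iota> {1..k}" "\<iota> ` {1..k} \<subseteq> {1..n}" "\<And>j. j \<in> {1..k} \<Longrightarrow> a j \<le> \<bar>\<theta> (\<iota> j)\<bar>"
    and le: "card (nonzero n \<theta>) \<le> k"
    using \<theta> unfolding signal_class_def by blast
  have sub: "\<iota> ` {1..k} \<subseteq> nonzero n \<theta>"
  proof
    fix i assume "i \<in> \<iota> ` {1..k}"
    then obtain j where j: "j \<in> {1..k}" "i = \<iota> j" by auto
    have "0 < \<bar>\<theta> (\<iota> j)\<bar>" using a[OF j(1)] \<iota>(3)[OF j(1)] by linarith
    moreover have "\<iota> j \<in> {1..n}" using \<iota>(2) j(1) by blast
    ultimately show "i \<in> nonzero n \<theta>" using j(2) by (simp add: nonzero_def)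
  qed
  have fin: "finite (nonzero n \<theta>)" by (simp add: nonzero_def)
  have card_\<iota>: "card (\<iota> ` {1..k}) = k" using card_image[OF \<iota>(1)] by simp
  then have eq: "\<iota> ` {1..k} = nonzero n \<theta>" using sub fin le by (intro card_seteq) auto
  then show "card (nonzero n \<theta>) = k" using card_\<iota> by simp
  have "(\<Sum>i\<in>nonzero n \<theta>. df f \<bar>\<theta> i\<bar> t) = (\<Sum>j\<in>{1..k}. df f \<bar>\<theta> (\<iota> j)\<bar> t)"
    unfolding eq[symmetric] sum.reindex[OF \<iota>(1)] comp_def ..
  also have "\<dots> \<le> (\<Sum>j\<in>{1..k}. df f (a j) t)"
  proof (rule sum_mono)
    fix j assume j: "j \<in> {1..k}"
    from tail_mono_signal[OF t a[OF j] \<iota>(3)[OF j]]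
    show "df f \<bar>\<theta> (\<iota> j)\<bar> t \<le> df f (a j) t" by (simp add: tail_def)
  qed
  finally show "Lambda_vec f k t n \<theta> \<le> Lambda_sig f k t a"
    by (simp add: Lambda_vec_def Lambda_sig_def divide_right_mono)
qed

lemma signal_class_nonempty:
  assumes "k \<le> n" shows "signal_class n k a \<noteq> {}"
proof -
  let ?\<theta> = "\<lambda>i\<in>{1..n}. if i \<le> k then a i else 0"
  have "nonzero n ?\<theta> \<subseteq> {1..k}" by (auto simp: nonzero_def split: if_splits)
  then have "card (nonzero n ?\<theta>) \<le> card {1..k}" by (intro card_mono) auto
  then have "card (nonzero n ?\<theta>) \<le> k" by simp
  moreover have "\<exists>\<iota>. inj_on \<iota> {1..k} \<and> \<iota> ` {1..k} \<subseteq> {1..n} \<and> (\<forall>j\<in>{1..k}. a j \<le> \<bar>?\<theta> (\<iota> j)\<bar>)"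
    using assms by (intro exI[of _ "\<lambda>j. j"]) auto
  moreover have "?\<theta> \<in> vectors n" by (simp add: vectors_def)
  ultimately have "?\<theta> \<in> signal_class n k a"
    unfolding signal_class_def by (intro CollectI conjI)
  then show ?thesis by blast
qed

lemma worst_risk_nonneg:
  assumes "k \<le> n" "\<psi> \<in> procedures n" shows "0 \<le> worst_risk f n k a \<psi>"
proof -
  obtain \<theta> where "\<theta> \<in> signal_class n k a" using signal_class_nonempty[OF assms(1)] by blast
  from risk_le_worst_risk[OF assms(2) this] FDR_bounds(1)[OF assms(2), of \<theta>] FNR_bounds(1)[OF assms(2), of \<theta>]
  show ?thesis by (simp add: risk_def)
qed

lemma minimax_risk_le:
  assumes "k \<le> n" "\<psi> \<in> procedures n" shows "minimax_risk f n k a \<le> worst_risk f n k a \<psi>"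
  unfolding minimax_risk_def
  by (rule cINF_lower[OF bdd_belowI[of _ 0]]) (use worst_risk_nonneg assms in auto)

lemma worst_risk_BH_trivial:
  assumes "k \<le> n" "0 < n" "0 < \<alpha>" "\<alpha> \<le> 1"
  shows "worst_risk f n k a (BH f n \<alpha>) \<le> 1 + \<alpha>"
  unfolding worst_risk_def
proof (rule cSUP_least[OF signal_class_nonempty[OF assms(1)]])
  fix \<theta>
  show "risk f n \<theta> (BH f n \<alpha>) \<le> 1 + \<alpha>"
    using FDR_BH_le[OF assms(3,4,2), of \<theta>] FNR_bounds(2)[OF BH_procedure[OF assms(3,4)], of n \<theta>]
    by (simp add: risk_def)
qed

text \<open>For \<open>l < 1\<close> both \<open>l\<close> and the exponential term increase with
  \<open>l\<close>, so the bound for a single vector is largest at the value belonging to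
  \<open>a\<close>.\<close>

lemma worst_risk_BH_le:
  assumes k: "0 < k" "k \<le> n" and t: "0 < t" and a: "\<And>j. j \<in> {1..k} \<Longrightarrow> 0 < a j"
    and level: "\<And>\<theta>. \<theta> \<in> signal_class n k a \<Longrightarrow> level_condition f k t d n (gap (Lambda_vec f k t n \<theta>)) \<alpha>"
  defines "l \<equiv> gap (Lambda_sig f k t a)"
  shows "worst_risk f n k a (BH f n \<alpha>) \<le> l + (\<alpha> + exp (- ((1 - l)\<^sup>2 * real k / 32)))"
  unfolding worst_risk_def
proof (rule cSUP_least[OF signal_class_nonempty[OF k(2)]])
  fix \<theta> assume \<theta>: "\<theta> \<in> signal_class n k a"
  note sp = signal_class_sparsity[OF \<theta> a t]
  let ?l = "gap (Lambda_vec f k t n \<theta>)"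
  have le: "?l \<le> l" unfolding l_def by (rule gap_mono[OF sp(2)])
  have "l < 1" unfolding l_def by (rule gap_Lambda_sig_less_1[OF k(1) t a])
  then have "(1 - l)\<^sup>2 \<le> (1 - ?l)\<^sup>2" using le by (intro power_mono) auto
  then have "(1 - l)\<^sup>2 * real k / 32 \<le> (1 - ?l)\<^sup>2 / 32 * real k" by (simp add: mult_right_mono)
  then have "exp (- ((1 - ?l)\<^sup>2 / 32 * real k)) \<le> exp (- ((1 - l)\<^sup>2 * real k / 32))" by simp
  with risk_BH_le[OF sp(1) k(1) t level[OF \<theta>]] le
  show "risk f n \<theta> (BH f n \<alpha>) \<le> l + (\<alpha> + exp (- ((1 - l)\<^sup>2 * real k / 32)))" by linarith
qed

text \<open>Both terms come from cutting at \<open>1 - l = 1 / sqrt (sqrt k)\<close>, where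
  \<open>(1 - l)\<close> squared times \<open>k\<close> equals \<open>sqrt k\<close>.\<close>

definition excess :: "nat \<Rightarrow> real" where
  "excess k = 1 / sqrt (sqrt (real k)) + exp (- (sqrt (real k) / 32))"

text \<open>Uniformity in \<open>l\<close>: if \<open>1 - l\<close> is below \<open>k\<^sup>-\<^sup>1\<^sup>/\<^sup>4\<close> the trivial bound is already good enough,
  otherwise the exponential term is small.\<close>

lemma worst_risk_BH_uniform:
  assumes k: "0 < k" "k \<le> n" and t: "0 < t" and a: "\<And>j. j \<in> {1..k} \<Longrightarrow> 0 < a j"
    and level: "\<And>\<theta>. \<theta> \<in> signal_class n k a \<Longrightarrow> level_condition f k t d n (gap (Lambda_vec f k t n \<theta>)) \<alpha>"
  shows "worst_risk f n k a (BH f n \<alpha>) \<le> gap (Lambda_sig f k t a) + (\<alpha> + excess k)"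
proof -
  define l where "l = gap (Lambda_sig f k t a)"
  have n: "0 < n" using k by simp
  obtain \<theta> where \<theta>: "\<theta> \<in> signal_class n k a" using signal_class_nonempty[OF k(2)] by blast
  note sp = signal_class_sparsity[OF \<theta> a t]
  note \<alpha> = level_condition_bounds[OF level[OF \<theta>] k(1) n gap_Lambda_vec_less_1[OF sp(1) k(1) t]]
  let ?r = "sqrt (sqrt (real k))"
  have r: "0 < ?r" using k by simp
  show ?thesis
  proof (cases "1 - l \<le> 1 / ?r")
    case True
    have "worst_risk f n k a (BH f n \<alpha>) \<le> 1 + \<alpha>"
      using k n \<alpha> by (intro worst_risk_BH_trivial) auto
    with True exp_ge_zero[of "- (sqrt (real k) / 32)"] show ?thesis
      unfolding excess_def l_def[symmetric] by linarith
  next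
    case False
    have "(1 / ?r)\<^sup>2 \<le> (1 - l)\<^sup>2" using False r by (intro power_mono) auto
    moreover have "(1 / ?r)\<^sup>2 = 1 / sqrt (real k)" by (simp add: power_divide)
    ultimately have "1 / sqrt (real k) * real k \<le> (1 - l)\<^sup>2 * real k" by (intro mult_right_mono) auto
    moreover have "1 / sqrt (real k) * real k = sqrt (real k)" by (simp add: real_div_sqrt)
    ultimately have "exp (- ((1 - l)\<^sup>2 * real k / 32)) \<le> exp (- (sqrt (real k) / 32))" by simp
    moreover have "0 \<le> 1 / ?r" by simp
    ultimately show ?thesis
      using worst_risk_BH_le[where a=a and \<alpha>=\<alpha> and d=d, OF k t a level]
      unfolding excess_def l_def[symmetric] by linarith
  qed
qed

text \<open>The level must dominate \<open>3 * x / (1 - l)\<close> and still tend to 0 with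
  \<open>x\<close>. The square root does both as soon as \<open>1 - l\<close> is at least
  \<open>3 * sqrt x\<close>.\<close>

lemma level_condition_sqrt:
  assumes k: "0 < k" "0 < n" and x: "x = real n / real k * tail f 0 t"
    and l: "3 * sqrt x \<le> 1 - l" and upper: "sqrt x \<le> 1" "sqrt x \<le> real n / real k * tail f 0 (t - d)"
  shows "level_condition f k t d n l (sqrt x)"
proof -
  have x0: "0 < x" using k tail0_pos by (simp add: x)
  then have l1: "0 < 1 - l" using l by (smt (verit) real_sqrt_gt_zero)
  have "3 * x = sqrt x * (3 * sqrt x)" using x0 by simp
  also have "\<dots> \<le> sqrt x * (1 - l)" using l x0 by (intro mult_left_mono) auto
  finally have "3 * x / (1 - l) \<le> sqrt x" using l1 by (simp add: divide_le_eq)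
  moreover have "3 * real n * tail f 0 t / (real k * (1 - l)) = 3 * x / (1 - l)"
    by (simp add: x)
  ultimately show ?thesis using upper by (simp add: level_condition_def)
qed

text \<open>No separation of \<open>\<Lambda>\<close> from 1 is assumed. When the level condition is
  out of reach, \<open>1\<close> is below the target value plus \<open>3 * sqrt x\<close>, and the
  trivial bound \<open>1 + sqrt x\<close> accounts for the coefficient 4.\<close>

lemma worst_risk_BH_sqrt:
  assumes k: "0 < k" "k \<le> n" and t: "0 < t" and a: "\<And>j. j \<in> {1..k} \<Longrightarrow> 0 < a j"
    and x: "x = real n / real k * tail f 0 t"
    and upper: "sqrt x \<le> 1" "sqrt x \<le> real n / real k * tail f 0 (t - d)"
  shows "worst_risk f n k a (BH f n (sqrt x)) \<le> gap (Lambda_sig f k t a) + (4 * sqrt x + excess k)"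
proof -
  have n: "0 < n" using k by simp
  have x0: "0 < x" using k tail0_pos by (simp add: x)
  have ex: "0 \<le> excess k" by (simp add: excess_def)
  show ?thesis
  proof (cases "3 * sqrt x \<le> 1 - gap (Lambda_sig f k t a)")
    case True
    have "level_condition f k t d n (gap (Lambda_vec f k t n \<theta>)) (sqrt x)"
      if \<theta>: "\<theta> \<in> signal_class n k a" for \<theta>
      using gap_mono[OF signal_class_sparsity(2)[OF \<theta> a t]] True
      by (intro level_condition_sqrt[OF k(1) n x _ upper]) auto
    from worst_risk_BH_uniform[where a=a and \<alpha>="sqrt x" and d=d, OF k t a this] x0
    show ?thesis by (smt (verit) real_sqrt_gt_zero)
  next
    case False
    have "worst_risk f n k a (BH f n (sqrt x)) \<le> 1 + sqrt x"
      using x0 upper by (intro worst_risk_BH_trivial k n) auto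
    with False ex show ?thesis by linarith
  qed
qed

text \<open>Likelihood ratios are cut at \<open>t - d\<close>, where
  \<open>1 / tail f 0 (t - d)\<close> is small compared with the block size;
  \<open>tail_shift\<close> then returns to \<open>t\<close>.\<close>

lemma minimax_risk_ge:
  assumes k: "0 < k" "k \<le> n" and d: "0 \<le> d" "d < t" and a: "\<And>j. j \<in> {1..k} \<Longrightarrow> 0 < a j"
  defines "\<rho> \<equiv> 2 / (real n / real k * tail f 0 (t - d))"
  shows "gap (Lambda_sig f k t a) - (\<kappa> * (L * d) + 2 * \<rho> + sqrt \<rho> + 3 * sqrt (sqrt \<rho>))
    \<le> minimax_risk f n k a"
  unfolding minimax_risk_def
proof (rule cINF_greatest)
  show "procedures n \<noteq> {}" using BH_procedure[of 1 n] by auto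
  fix \<psi> assume \<psi>: "\<psi> \<in> procedures n"
  define m where "m = n div k"
  define B where "B j = {(j - 1) * m + 1..j * m}" for j
  have m: "0 < m" using k by (simp add: m_def div_greater_zero_iff)
  have km: "k * m \<le> n" by (simp add: m_def)
  \<comment> \<open>Since \<open>m \<ge> 1\<close>, the remainder of the division is at most
    \<open>k * m\<close>, so \<open>m\<close> is at least half of \<open>n / k\<close>. This is the
    2 in \<open>\<rho>\<close>.\<close>
  have "n mod k < k" "k \<le> k * m" using k m by auto
  moreover have "n = k * m + n mod k" by (simp add: m_def)
  ultimately have "n \<le> 2 * (k * m)" by linarith
  then have "real n \<le> real (2 * (k * m))" by (rule of_nat_mono)
  then have "real n \<le> 2 * (real k * real m)" by simp
  then have m_ge: "real n / real k \<le> 2 * real m" using k by (simp add: field_simps)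
  let ?h = "tail f 0 (t - d)"
  have h: "0 < ?h" by (rule tail0_pos)
  have \<rho>: "0 < \<rho>" using k h by (simp add: \<rho>_def)
  have "(real n / real k) * ?h \<le> 2 * real m * ?h" using m_ge h by (intro mult_right_mono) auto
  then have lr_le: "1 / ?h \<le> \<rho> * real m"
    unfolding \<rho>_def using k h by (simp add: field_simps)
  have "\<forall>j\<in>{1..k}. \<exists>A. A \<in> sets borel \<and> measure (noise f (a j)) A \<le> \<kappa> * tail f (a j) (t - d) \<and>
      (\<forall>y. y \<notin> A \<longrightarrow> lr (a j) y \<le> 1 / ?h)"
    using likelihood_ratio_test[OF a, of _ "t - d"] d by fastforce
  from bchoice[OF this] obtain A where A: "\<And>j. j \<in> {1..k} \<Longrightarrow> A j \<in> sets borel"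
    "\<And>j. j \<in> {1..k} \<Longrightarrow> measure (noise f (a j)) (A j) \<le> \<kappa> * tail f (a j) (t - d)"
    "\<And>j y. j \<in> {1..k} \<Longrightarrow> y \<notin> A j \<Longrightarrow> lr (a j) y \<le> 1 / ?h"
    by blast
  \<comment> \<open>Balances \<open>1 / K\<close>, lost by capping, against
    \<open>2 * sqrt \<rho> * K\<close>, lost to lucky rejections; together they give
    \<open>3 * sqrt (sqrt \<rho>)\<close>.\<close>
  define K where "K = 1 / sqrt (sqrt \<rho>)"
  have K: "0 < K" "1 / K = sqrt (sqrt \<rho>)" "sqrt \<rho> * K = sqrt (sqrt \<rho>)"
    using \<rho> by (simp_all add: K_def real_div_sqrt)
  have "1 - (\<Sum>j\<in>{1..k}. measure (noise f (a j)) (A j)) / real k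
      - (1 / K + 2 * \<rho> + sqrt \<rho> + 2 * sqrt \<rho> * K) \<le> worst_risk f n k a \<psi>"
  proof (rule worst_risk_lower_bound[where B=B and m=m])
    fix j assume j: "j \<in> {1..k}"
    then have "j * m \<le> k * m" by simp
    with km have "j * m \<le> n" by linarith
    then show "B j \<subseteq> {1..n}" by (auto simp: B_def)
    show "card (B j) = m" using j by (cases j) (auto simp: B_def)
    show "lr (a j) y \<le> \<rho> * real m" if "y \<notin> A j" for y using A(3)[OF j that] lr_le by linarith
  next
    have lt: "B i \<inter> B j = {}" if "i < j" for i j
    proof -
      have "i \<le> j - 1" using that by simp
      then have "i * m \<le> (j - 1) * m" by (rule mult_le_mono1)
      then have "b \<notin> B j" if "b \<in> B i" for b
        using that unfolding B_def atLeastAtMost_iff by linarith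
      then show ?thesis by blast
    qed
    show "disjoint_family_on B {1..k}"
      unfolding disjoint_family_on_def
    proof (intro ballI impI)
      fix i j :: nat assume "i \<noteq> j"
      then show "B i \<inter> B j = {}" using lt[of i j] lt[of j i] by (cases "i < j") auto
    qed
  qed (simp_all only: m k \<rho> K(1) a A(1) \<psi>)
  moreover have "(\<Sum>j\<in>{1..k}. measure (noise f (a j)) (A j)) / real k \<le>
      1 - gap (Lambda_sig f k t a) + \<kappa> * (L * d)"
  proof -
    have "(\<Sum>j\<in>{1..k}. measure (noise f (a j)) (A j)) \<le> (\<Sum>j\<in>{1..k}. \<kappa> * tail f (a j) t + \<kappa> * (L * d))"
    proof (rule sum_mono)
      fix j assume "j \<in> {1..k}"
      have "\<kappa> * tail f (a j) (t - d) \<le> \<kappa> * (tail f (a j) t + L * d)"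
        using tail_shift[OF d(1), of "a j" t] \<kappa>_pos by (intro mult_left_mono) auto
      with A(2)[OF \<open>j \<in> {1..k}\<close>]
      show "measure (noise f (a j)) (A j) \<le> \<kappa> * tail f (a j) t + \<kappa> * (L * d)"
        by (simp add: distrib_left)
    qed
    also have "\<dots> = real k * (1 - gap (Lambda_sig f k t a) + \<kappa> * (L * d))"
      using gap_Lambda_sig[OF k(1), of t a] by (simp add: sum.distrib distrib_left)
    finally show ?thesis using k by (simp add: divide_le_eq mult.commute)
  qed
  ultimately show "gap (Lambda_sig f k t a) - (\<kappa> * (L * d) + 2 * \<rho> + sqrt \<rho> + 3 * sqrt (sqrt \<rho>))
      \<le> worst_risk f n k a \<psi>"
    using K by (simp add: mult.assoc)
qed

end

section \<open>Asymptotics\<close>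

context detection_model
begin

lemma tendsto_excess: "excess \<longlonglongrightarrow> 0"
proof -
  have r: "filterlim (\<lambda>k. sqrt (real k)) at_top sequentially"
    by (rule filterlim_compose[OF sqrt_at_top filterlim_real_sequentially])
  have "(\<lambda>k. 1 / sqrt (sqrt (real k))) \<longlonglongrightarrow> 0"
    by (rule real_tendsto_divide_at_top[OF tendsto_const filterlim_compose[OF sqrt_at_top r]])
  moreover have "filterlim (\<lambda>k. 1 / 32 * sqrt (real k)) at_top sequentially"
    by (rule filterlim_tendsto_pos_mult_at_top[OF tendsto_const _ r]) simp
  then have "filterlim (\<lambda>k. - (sqrt (real k) / 32)) at_bot sequentially"
    by (intro filterlim_compose[OF filterlim_uminus_at_bot_at_top]) simp
  then have "(\<lambda>k. exp (- (sqrt (real k) / 32))) \<longlonglongrightarrow> 0"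
    by (rule filterlim_compose[OF exp_at_bot])
  ultimately have "(\<lambda>k. 1 / sqrt (sqrt (real k)) + exp (- (sqrt (real k) / 32))) \<longlonglongrightarrow> 0 + 0"
    by (rule tendsto_add)
  then show ?thesis by (simp add: excess_def[abs_def])
qed

end

locale sparse_asymptotics = detection_model +
  fixes s :: "nat \<Rightarrow> nat" and astar \<delta> :: "nat \<Rightarrow> real"
  assumes s_le: "s n \<le> n"
    and s_top: "filterlim s at_top sequentially"
    and astar_pos: "0 < astar n" and \<delta>_pos: "0 < \<delta> n"
    and astar_top: "filterlim astar at_top sequentially" and \<delta>_lim: "\<delta> \<longlonglongrightarrow> 0"
    and tail_lower: "filterlim (\<lambda>n. real n / real (s n) * tail f 0 (astar n - \<delta> n)) at_top sequentially"
    and tail_upper: "(\<lambda>n. real n / real (s n) * tail f 0 (astar n)) \<longlonglongrightarrow> 0"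
begin

abbreviation "level \<alpha> n l \<equiv> level_condition f (s n) (astar n) (\<delta> n) n l \<alpha>"
abbreviation "lam_vec n \<theta> \<equiv> gap (Lambda_vec f (s n) (astar n) n \<theta>)"
abbreviation "lam_sig n b \<equiv> gap (Lambda_sig f (s n) (astar n) b)"

lemma eventually_s_pos: "\<forall>\<^sub>F n in sequentially. 0 < s n"
  using s_top[unfolded filterlim_at_top, rule_format, of 1] by eventually_elim simp

lemma tendsto_excess_s: "(\<lambda>n. excess (s n)) \<longlonglongrightarrow> 0"
  by (rule filterlim_compose[OF tendsto_excess s_top])

text \<open>The only asymptotic input is \<open>0 < s n\<close>, so the index from which the bound
  holds depends neither on \<open>\<theta>\<close> nor on the levels.\<close>

lemma risk_BH_eventually:
  "\<forall>\<^sub>F n in sequentially. \<forall>\<theta>\<in>vectors n. card (nonzero n \<theta>) = s n \<longrightarrow> level (\<alpha> n) n (lam_vec n \<theta>) \<longrightarrow>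
    risk f n \<theta> (BH f n (\<alpha> n)) \<le> lam_vec n \<theta> + \<alpha> n + exp (- ((1 - lam_vec n \<theta>)\<^sup>2 / 32 * real (s n)))"
  using eventually_s_pos
proof eventually_elim
  case (elim n)
  show ?case by (intro ballI impI risk_BH_le[OF _ elim astar_pos])
qed

definition opt_level :: "nat \<Rightarrow> real" where
  "opt_level n = sqrt (real n / real (s n) * tail f 0 (astar n))"

lemma tendsto_opt_level: "opt_level \<longlonglongrightarrow> 0"
  using tendsto_real_sqrt[OF tail_upper] by (simp add: opt_level_def[abs_def])

lemma eventually_opt_level_le:
  "\<forall>\<^sub>F n in sequentially. opt_level n \<le> 1 \<and> opt_level n \<le> real n / real (s n) * tail f 0 (astar n - \<delta> n)"
proof -
  have "\<forall>\<^sub>F n in sequentially. opt_level n < 1"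
    by (rule order_tendstoD(2)[OF tendsto_opt_level]) simp
  moreover have "\<forall>\<^sub>F n in sequentially. 1 \<le> real n / real (s n) * tail f 0 (astar n - \<delta> n)"
    by (rule tail_lower[unfolded filterlim_at_top, rule_format])
  ultimately show ?thesis by eventually_elim auto
qed

lemma worst_risk_opt_level:
  assumes a: "\<And>n j. j \<in> {1..s n} \<Longrightarrow> 0 < a n j"
  shows "\<forall>\<^sub>F n in sequentially. worst_risk f n (s n) (a n) (BH f n (opt_level n))
    \<le> lam_sig n (a n) + (4 * opt_level n + excess (s n))"
  using eventually_s_pos eventually_opt_level_le
proof eventually_elim
  case (elim n)
  then show ?case
    unfolding opt_level_def
    by (intro worst_risk_BH_sqrt[OF _ s_le astar_pos a refl]) auto
qed

lemma tendsto_opt_excess: "(\<lambda>n. 4 * opt_level n + excess (s n)) \<longlonglongrightarrow> 0"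
  using tendsto_add[OF tendsto_mult_left[OF tendsto_opt_level, of 4] tendsto_excess_s] by simp

lemma level_opt_level:
  assumes a: "\<And>n j. j \<in> {1..s n} \<Longrightarrow> 0 < a n j"
    and c: "c < 1" "\<forall>\<^sub>F n in sequentially. lam_sig n (a n) \<le> c"
  shows "\<forall>\<^sub>F n in sequentially. \<forall>\<theta>\<in>signal_class n (s n) (a n). level (opt_level n) n (lam_vec n \<theta>)"
proof -
  have "\<forall>\<^sub>F n in sequentially. opt_level n < (1 - c) / 3"
    by (rule order_tendstoD(2)[OF tendsto_opt_level]) (use c in simp)
  then show ?thesis
    using eventually_s_pos eventually_opt_level_le c(2)
  proof eventually_elim
    case (elim n)
    have n: "0 < n" using elim(2) s_le[of n] by simp
    show ?case
    proof
      fix \<theta> assume \<theta>: "\<theta> \<in> signal_class n (s n) (a n)"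
      have "lam_vec n \<theta> \<le> lam_sig n (a n)"
        by (rule gap_mono[OF signal_class_sparsity(2)[OF \<theta> a astar_pos]])
      then have "3 * opt_level n \<le> 1 - lam_vec n \<theta>" using elim(1,4) by simp
      then show "level (opt_level n) n (lam_vec n \<theta>)"
        using elim(3) unfolding opt_level_def
        by (intro level_condition_sqrt[OF elim(2) n refl]) auto
    qed
  qed
qed

text \<open>The upper half uses BH at \<open>opt_level\<close> as a competitor, so the limit holds
  for every array, without a level condition or a bound on \<open>\<Lambda>\<close>.\<close>

lemma tendsto_minimax_risk:
  assumes a: "\<And>n j. j \<in> {1..s n} \<Longrightarrow> 0 < a n j"
  shows "(\<lambda>n. minimax_risk f n (s n) (a n) - lam_sig n (a n)) \<longlonglongrightarrow> 0"
proof -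
  define \<rho> where "\<rho> n = 2 / (real n / real (s n) * tail f 0 (astar n - \<delta> n))" for n
  define e where "e n = \<kappa> * (L * \<delta> n) + 2 * \<rho> n + sqrt (\<rho> n) + 3 * sqrt (sqrt (\<rho> n))" for n
  have \<rho>: "\<rho> \<longlonglongrightarrow> 0"
    unfolding \<rho>_def by (rule real_tendsto_divide_at_top[OF tendsto_const tail_lower])
  have "e \<longlonglongrightarrow> \<kappa> * (L * 0) + 2 * 0 + sqrt 0 + 3 * sqrt (sqrt 0)"
    unfolding e_def by (intro tendsto_intros \<rho> \<delta>_lim)
  then have lim_e: "(\<lambda>n. - e n) \<longlonglongrightarrow> 0" using tendsto_minus[of e 0] by simp
  have lower: "\<forall>\<^sub>F n in sequentially. - e n \<le> minimax_risk f n (s n) (a n) - lam_sig n (a n)"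
  proof -
    have "\<forall>\<^sub>F n in sequentially. \<delta> n < 1" by (rule order_tendstoD(2)[OF \<delta>_lim]) simp
    moreover have "\<forall>\<^sub>F n in sequentially. 1 \<le> astar n"
      by (rule astar_top[unfolded filterlim_at_top, rule_format])
    ultimately show ?thesis
      using eventually_s_pos
    proof eventually_elim
      case (elim n)
      have "lam_sig n (a n) - e n \<le> minimax_risk f n (s n) (a n)"
        unfolding e_def \<rho>_def
        by (rule minimax_risk_ge[OF elim(3) s_le]) (use elim \<delta>_pos[of n] a in auto)
      then show ?case by simp
    qed
  qed
  have opt: "\<forall>\<^sub>F n in sequentially. worst_risk f n (s n) (a n) (BH f n (opt_level n))
      \<le> lam_sig n (a n) + (4 * opt_level n + excess (s n))"
    using a by (rule worst_risk_opt_level)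
  have upper: "\<forall>\<^sub>F n in sequentially.
      minimax_risk f n (s n) (a n) - lam_sig n (a n) \<le> 4 * opt_level n + excess (s n)"
    using opt eventually_opt_level_le eventually_s_pos
  proof eventually_elim
    case (elim n)
    have "0 < n" using elim(3) s_le[of n] by simp
    then have "0 < opt_level n" using elim(3) tail0_pos by (simp add: opt_level_def)
    then have "minimax_risk f n (s n) (a n) \<le> worst_risk f n (s n) (a n) (BH f n (opt_level n))"
      using elim(2) by (intro minimax_risk_le s_le BH_procedure) auto
    with elim(1) show ?case by simp
  qed
  show ?thesis by (rule tendsto_sandwich[OF lower upper lim_e tendsto_opt_excess])
qed

text \<open>Two forms are kept because the concrete exponential need not vanish when
  \<open>lam_sig n (a n)\<close> tends to 1, whereas \<open>excess (s n)\<close> vanishes for every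
  array.\<close>

lemma
  assumes a: "\<And>n j. j \<in> {1..s n} \<Longrightarrow> 0 < a n j"
    and lev: "\<forall>\<^sub>F n in sequentially. \<forall>\<theta>\<in>signal_class n (s n) (a n). level (\<alpha> n) n (lam_vec n \<theta>)"
  shows worst_risk_BH_eventually: "\<forall>\<^sub>F n in sequentially. worst_risk f n (s n) (a n) (BH f n (\<alpha> n))
      \<le> lam_sig n (a n) + (\<alpha> n + exp (- ((1 - lam_sig n (a n))\<^sup>2 * real (s n) / 32)))" (is ?concrete)
    and worst_risk_BH_excess: "\<forall>\<^sub>F n in sequentially. worst_risk f n (s n) (a n) (BH f n (\<alpha> n))
      \<le> lam_sig n (a n) + (\<alpha> n + excess (s n))" (is ?uniform)
proof -
  from lev eventually_s_pos show ?concrete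
  proof eventually_elim
    case (elim n)
    show ?case by (rule worst_risk_BH_le[OF elim(2) s_le astar_pos a bspec[OF elim(1)]])
  qed
  from lev eventually_s_pos show ?uniform
  proof eventually_elim
    case (elim n)
    show ?case by (rule worst_risk_BH_uniform[OF elim(2) s_le astar_pos a bspec[OF elim(1)]])
  qed
qed

lemma tendsto_remainder:
  assumes c: "c < 1" "\<forall>\<^sub>F n in sequentially. l n \<le> c" and \<alpha>: "\<alpha> \<longlonglongrightarrow> 0"
  shows "(\<lambda>n. \<alpha> n + exp (- ((1 - l n)\<^sup>2 * real (s n) / 32))) \<longlonglongrightarrow> 0"
proof -
  have "filterlim (\<lambda>n. real (s n)) at_top sequentially"
    by (rule filterlim_compose[OF filterlim_real_sequentially s_top])
  then have "filterlim (\<lambda>n. (1 - c)\<^sup>2 / 32 * real (s n)) at_top sequentially"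
    using c by (intro filterlim_tendsto_pos_mult_at_top[OF tendsto_const]) auto
  then have "filterlim (\<lambda>n. - ((1 - c)\<^sup>2 / 32 * real (s n))) at_bot sequentially"
    by (rule filterlim_compose[OF filterlim_uminus_at_bot_at_top])
  then have lim: "(\<lambda>n. exp (- ((1 - c)\<^sup>2 / 32 * real (s n)))) \<longlonglongrightarrow> 0"
    by (rule filterlim_compose[OF exp_at_bot])
  have "(\<lambda>n. exp (- ((1 - l n)\<^sup>2 * real (s n) / 32))) \<longlonglongrightarrow> 0"
  proof (rule tendsto_sandwich[OF _ _ tendsto_const lim])
    show "\<forall>\<^sub>F n in sequentially. exp (- ((1 - l n)\<^sup>2 * real (s n) / 32)) \<le> exp (- ((1 - c)\<^sup>2 / 32 * real (s n)))"
      using c(2)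
    proof eventually_elim
      case (elim n)
      then have "(1 - c)\<^sup>2 \<le> (1 - l n)\<^sup>2" using c by (intro power_mono) auto
      then show ?case by (simp add: mult_right_mono)
    qed
  qed simp
  from tendsto_add[OF \<alpha> this] show ?thesis by simp
qed

end

section \<open>The detection model in the two symmetry cases\<close>

lemma (in noise_model) measure_noise_mono_density:
  assumes S: "S \<in> sets borel" and le: "\<And>y. y \<in> S \<Longrightarrow> c * f a y \<le> d * f b y"
  shows "c * measure (noise f a) S \<le> d * measure (noise f b) S"
proof -
  have int: "set_integrable lborel S (\<lambda>y. r * f v y)" for r v
    unfolding set_integrable_def
  proof (rule integrable_mult_indicator)
    show "integrable lborel (\<lambda>y. r * f v y)"
      by (intro integrable_mult_right integrable.intros[OF has_integral_density])
  qed (use S in simp)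
  have "(LINT y:S|lborel. c * f a y) \<le> (LINT y:S|lborel. d * f b y)"
    by (rule set_integral_mono[OF int int le])
  then show ?thesis unfolding measure_noise[OF S] set_integral_mult_right .
qed

text \<open>A positive signal has a likelihood ratio increasing on the whole line, so a half-line is
  the test region and \<open>\<kappa> = 1\<close>.\<close>

lemma detection_model_one_sided:
  assumes f: "density_family f" and A: "assumption_1A f s astar \<delta>"
  obtains L where "detection_model f L 1"
proof -
  note A' = A[unfolded assumption_1A_def assumption_1_def]
  from A' have lips: "\<exists>L. \<forall>a. L-lipschitz_on UNIV (df f a)" by (elim conjE)
  from A' have pos: "\<forall>x. 0 < f 0 x" by (elim conjE)
  from A' have reflect: "\<forall>a x. f (- a) (- x) = f a x" by (elim conjE)
  from A' have tail_mono': "\<forall>x. mono (\<lambda>a. tail f a x)" by (elim conjE)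
  from A' have lr_mono': "\<forall>a>0. mono (\<lambda>x. f a x / f 0 x)" by (elim conjE)
  note pos = pos[rule_format] and reflect = reflect[rule_format]
    and tail_mono' = tail_mono'[rule_format] and lr_mono' = lr_mono'[rule_format]
  from lips obtain L where L: "\<And>a. L-lipschitz_on UNIV (df f a)" by blast
  interpret noise_model f L
  proof
    show "f 0 (- x) = f 0 x" for x using reflect[of 0 x] by simp
  qed (rule f pos L)+
  have tail_mono: "tail f a t \<le> tail f b t" if "a \<le> b" for a b t
    using tail_mono' that by (rule monoD)
  have lr_mono: "lr a x \<le> lr a y" if "0 < a" "x \<le> y" for a x y
    unfolding lr_def using lr_mono'[OF that(1)] that(2) by (rule monoD)
  have "detection_model f L 1"
  proof
    fix a t :: real assume a: "a \<noteq> 0" and t: "0 < t"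
    interpret N: prob_space "noise f a" by (rule prob_space_noise)
    show "1 * tail f \<bar>a\<bar> t \<le> measure (noise f a) {x. t \<le> \<bar>x\<bar>}"
    proof (cases "0 < a")
      case True
      have "measure (noise f a) {t..} \<le> measure (noise f a) {x. t \<le> \<bar>x\<bar>}"
        by (rule N.finite_measure_mono) auto
      with True show ?thesis by (simp add: tail_measure_ge)
    next
      \<comment> \<open>For a negative signal, reflection identifies the mass below
        \<open>- t\<close> with the upper tail of \<open>f (- a)\<close>.\<close>
      case False
      have "measure (noise f a) (uminus ` {t..}) = measure (noise f (- a)) {t..}"
        by (rule noise_reflect) (use reflect[of "- a"] in auto)
      then have "tail f \<bar>a\<bar> t = measure (noise f a) {..- t}"
        using False by (simp add: tail_measure_ge)
      also have "\<dots> \<le> measure (noise f a) {x. t \<le> \<bar>x\<bar>}" by (rule N.finite_measure_mono) auto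
      finally show ?thesis by simp
    qed
  next
    fix a t :: real assume a: "0 < a" and t: "0 < t"
    then show "0 < tail f a t" using tail_mono[of 0 a t] tail0_pos[of t] by simp
    have "lr a t * tail f 0 t \<le> 1 * tail f a t" unfolding tail_measure
    proof (rule measure_noise_mono_density)
      fix y assume "y \<in> {t<..}"
      then have "lr a t \<le> lr a y" using a by (intro lr_mono) auto
      then show "lr a t * f 0 y \<le> 1 * f a y" using pos0[of y] by (simp add: lr_def[of a y] le_divide_eq)
    qed simp
    then have "lr a t \<le> 1 / tail f 0 t"
      using tail_le_1[of a t] tail0_pos[of t] by (simp add: le_divide_eq)
    then have "lr a y \<le> 1 / tail f 0 t" if "y \<notin> {t<..}" for y
      using lr_mono[OF a, of y t] that by simp
    then show "\<exists>A\<in>sets borel. measure (noise f a) A \<le> 1 * tail f a t \<and> (\<forall>y. y \<notin> A \<longrightarrow> lr a y \<le> 1 / tail f 0 t)"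
      by (intro bexI[of _ "{t<..}"]) (simp_all add: tail_measure)
  qed (simp_all add: tail_mono)
  then show thesis by (rule that)
qed

text \<open>Each density is symmetric, so a signal shows in both tails and
  \<open>\<kappa> = 2\<close>. Assumption (B) does not relate \<open>f a\<close> to
  \<open>f (- a)\<close>; \<open>even\<close> provides the link, because \<open>\<Lambda>\<close> is
  computed from \<open>\<bar>\<theta> i\<bar>\<close> while the data follow
  \<open>f (\<theta> i)\<close>.\<close>

lemma detection_model_two_sided:
  assumes f: "density_family f" and B: "assumption_1B f s astar \<delta>"
    and even: "\<And>a x. df f (- a) x = df f a x"
  obtains L where "detection_model f L 2"
proof -
  note B' = B[unfolded assumption_1B_def assumption_1_def]
  from B' have lips: "\<exists>L. \<forall>a. L-lipschitz_on UNIV (df f a)" by (elim conjE)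
  from B' have pos: "\<forall>x. 0 < f 0 x" by (elim conjE)
  from B' have reflect: "\<forall>a x. f a (- x) = f a x" by (elim conjE)
  from B' have tail_mono': "\<forall>x>0. mono_on {0<..} (\<lambda>a. tail f a x)" by (elim conjE)
  from B' have lr_mono': "\<forall>a. a \<noteq> 0 \<longrightarrow> mono_on {0<..} (\<lambda>x. f a x / f 0 x)" by (elim conjE)
  note pos = pos[rule_format] and reflect = reflect[rule_format]
    and tail_mono' = tail_mono'[rule_format] and lr_mono' = lr_mono'[rule_format]
  from lips obtain L where L: "\<And>a. L-lipschitz_on UNIV (df f a)" by blast
  interpret noise_model f L
    by standard (rule f pos L reflect)+
  note two_sided = two_sided_tail[OF reflect]
  have tail_mono: "tail f a t \<le> tail f b t" if "0 < t" "0 < a" "a \<le> b" for a b t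
    by (rule mono_onD[OF tail_mono'[OF that(1)]]) (use that in auto)
  have lr_mono: "lr a x \<le> lr a y" if "a \<noteq> 0" "0 < x" "x \<le> y" for a x y
    unfolding lr_def by (rule mono_onD[OF lr_mono'[OF that(1)]]) (use that in auto)
  have lr_even: "lr a \<bar>y\<bar> = lr a y" for a y by (simp add: lr_def reflect abs_if)
  have "detection_model f L 2"
  proof
    fix a t :: real assume a: "a \<noteq> 0" and t: "0 < t"
    have "tail f \<bar>a\<bar> t = tail f a t" by (simp add: tail_def even abs_if)
    then show "2 * tail f \<bar>a\<bar> t \<le> measure (noise f a) {x. t \<le> \<bar>x\<bar>}" by (simp add: two_sided[OF t])
  next
    fix a t :: real assume a: "0 < a" and t: "0 < t"
    interpret N: prob_space "noise f a" by (rule prob_space_noise)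
    interpret N0: prob_space "noise f 0" by (rule prob_space_noise)
    have ge: "lr a t * tail f 0 t \<le> 1 * tail f a t" unfolding tail_measure
    proof (rule measure_noise_mono_density)
      fix y assume "y \<in> {t<..}"
      then have "lr a t \<le> lr a y" using a t by (intro lr_mono) auto
      then show "lr a t * f 0 y \<le> 1 * f a y" using pos0[of y] by (simp add: lr_def[of a y] le_divide_eq)
    qed simp
    \<comment> \<open>Monotonicity in \<open>a\<close> is assumed only for \<open>a > 0\<close>, so
      there is no comparison with \<open>tail f 0 t\<close>. Instead, a vanishing tail would force
      the likelihood ratio at \<open>t\<close>, hence on all of \<open>{0<..<t}\<close>, to be 0,
      and the positive half-line would lose its mass \<open>1 / 2\<close>.\<close>
    show "0 < tail f a t"
    proof (rule ccontr)
      assume "\<not> 0 < tail f a t"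
      then have 0: "tail f a t = 0" using tail_nonneg[of a t] by simp
      then have "lr a t = 0" using ge tail0_pos[of t] lr_nonneg[of a t] by (simp add: mult_le_0_iff)
      have "f a y = 0" if "0 < y" "y < t" for y
      proof -
        have "lr a y = 0" using lr_mono[of a y t] lr_nonneg[of a y] \<open>lr a t = 0\<close> a that by simp
        then show ?thesis using pos0[of y] by (simp add: lr_def)
      qed
      then have "1 * measure (noise f a) {0<..<t} \<le> 0 * measure (noise f 0) {0<..<t}"
        by (intro measure_noise_mono_density) auto
      then have zero: "measure (noise f a) {0<..<t} = 0"
        using measure_nonneg[of "noise f a" "{0<..<t}"] by simp
      have "{0<..} = {0<..<t} \<union> {t..}" using t by auto
      then have "tail f a 0 = measure (noise f a) ({0<..<t} \<union> {t..})"
        by (simp only: tail_measure)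
      also have "\<dots> \<le> measure (noise f a) {0<..<t} + measure (noise f a) {t..}"
        by (rule measure_Un_le) auto
      finally show False using zero 0 tail_symmetric_0[OF reflect, of a] by (simp add: tail_measure_ge)
    qed
    have "lr a t \<le> 1 / tail f 0 t"
      using ge tail_le_1[of a t] tail0_pos[of t] by (simp add: le_divide_eq)
    moreover have bound: "lr a y \<le> lr a t" if "y \<noteq> 0" "\<bar>y\<bar> < t" for y
      using lr_mono[of a "\<bar>y\<bar>" t] a that by (simp add: lr_even)
    \<comment> \<open>The point 0 is added to the test region because monotonicity on
      \<open>{0<..}\<close> does not control the likelihood ratio there; its mass is 0.\<close>
    moreover have "measure (noise f a) ({x. t \<le> \<bar>x\<bar>} \<union> {0}) \<le> 2 * tail f a t"
    proof -
      have "measure (noise f a) ({x. t \<le> \<bar>x\<bar>} \<union> {0}) \<le>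
          measure (noise f a) {x. t \<le> \<bar>x\<bar>} + measure (noise f a) {0}"
        by (rule measure_Un_le) auto
      then show ?thesis by (simp add: two_sided[OF t] noise_null_singleton)
    qed
    ultimately show "\<exists>A\<in>sets borel. measure (noise f a) A \<le> 2 * tail f a t \<and>
        (\<forall>y. y \<notin> A \<longrightarrow> lr a y \<le> 1 / tail f 0 t)"
    proof (intro bexI[of _ "{x. t \<le> \<bar>x\<bar>} \<union> {0}"] conjI allI impI)
      fix y assume "y \<notin> {x. t \<le> \<bar>x\<bar>} \<union> {0}"
      then have "lr a y \<le> lr a t" by (intro bound) auto
      also note \<open>lr a t \<le> 1 / tail f 0 t\<close>
      finally show "lr a y \<le> 1 / tail f 0 t" .
    qed auto
  qed (simp_all add: tail_mono)
  then show thesis by (rule that)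
qed

theorem theorem5:
  fixes f :: "real \<Rightarrow> real \<Rightarrow> real"
    and s :: "nat \<Rightarrow> nat"
    and astar \<delta> :: "nat \<Rightarrow> real"
    and g :: "real \<Rightarrow> real"
  assumes "density_family f"
    and "\<forall>n. s n \<le> n"
    and "filterlim s at_top sequentially"
    and "filterlim (\<lambda>n. real n / real (s n)) at_top sequentially"
    and "(assumption_1A f s astar \<delta> \<and> g = (\<lambda>u. u)) \<or>
         (assumption_1B f s astar \<delta> \<and> (\<forall>a x. df f (- a) x = df f a x) \<and> g = (\<lambda>u. 2 * u - 1))"
  shows
    \<comment> \<open>risk bound for each individual \<open>\<theta>\<close>\<close>
    "(\<forall>\<alpha> :: nat \<Rightarrow> real. \<forall>\<^sub>F n in sequentially. \<forall>\<theta>\<in>vectors n.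
        card (nonzero n \<theta>) = s n \<longrightarrow>
        level_condition f (s n) (astar n) (\<delta> n) n (g (Lambda_vec f (s n) (astar n) n \<theta>)) (\<alpha> n) \<longrightarrow>
        risk f n \<theta> (BH f n (\<alpha> n))
          \<le> g (Lambda_vec f (s n) (astar n) n \<theta>) + \<alpha> n
             + exp (- ((1 - g (Lambda_vec f (s n) (astar n) n \<theta>))\<^sup>2 / 32 * real (s n))))
     \<and>
     \<comment> \<open>asymptotic minimax risk, and its attainment by BH at levels \<open>\<alpha> n \<longlonglongrightarrow> 0\<close> obeying the
        level condition on the whole signal class\<close>
     (\<forall>a :: nat \<Rightarrow> nat \<Rightarrow> real. (\<forall>n. \<forall>j\<in>{1..s n}. 0 < a n j) \<longrightarrow>
        (\<lambda>n. minimax_risk f n (s n) (a n) - g (Lambda_sig f (s n) (astar n) (a n))) \<longlonglongrightarrow> 0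
        \<and>
        (\<forall>\<alpha> :: nat \<Rightarrow> real.
           (\<forall>\<^sub>F n in sequentially. \<forall>\<theta>\<in>signal_class n (s n) (a n).
              level_condition f (s n) (astar n) (\<delta> n) n (g (Lambda_vec f (s n) (astar n) n \<theta>)) (\<alpha> n)) \<longrightarrow>
           (\<alpha> \<longlonglongrightarrow> 0 \<longrightarrow>
              (\<exists>\<epsilon> :: nat \<Rightarrow> real. \<epsilon> \<longlonglongrightarrow> 0 \<and>
                 (\<forall>\<^sub>F n in sequentially.
                    worst_risk f n (s n) (a n) (BH f n (\<alpha> n))
                      \<le> g (Lambda_sig f (s n) (astar n) (a n)) + \<epsilon> n)))
           \<and>
           ((\<exists>c<1. \<forall>\<^sub>F n in sequentially. g (Lambda_sig f (s n) (astar n) (a n)) \<le> c) \<longrightarrow>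
              (\<forall>\<^sub>F n in sequentially.
                 worst_risk f n (s n) (a n) (BH f n (\<alpha> n))
                   \<le> g (Lambda_sig f (s n) (astar n) (a n))
                      + (\<alpha> n + exp (- ((1 - g (Lambda_sig f (s n) (astar n) (a n)))\<^sup>2 * real (s n) / 32)))) \<and>
              (\<alpha> \<longlonglongrightarrow> 0 \<longrightarrow>
                 (\<lambda>n. \<alpha> n + exp (- ((1 - g (Lambda_sig f (s n) (astar n) (a n)))\<^sup>2 * real (s n) / 32)))
                   \<longlonglongrightarrow> 0))))
     \<and>
     \<comment> \<open>one choice of levels, not depending on the signal strengths, attains the minimax risk for
        every array; it obeys the level condition whenever \<open>\<Lambda>\<close> stays away from 1\<close>
     (\<exists>\<alpha> :: nat \<Rightarrow> real. \<alpha> \<longlonglongrightarrow> 0 \<and>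
        (\<forall>a :: nat \<Rightarrow> nat \<Rightarrow> real. (\<forall>n. \<forall>j\<in>{1..s n}. 0 < a n j) \<longrightarrow>
           ((\<exists>c<1. \<forall>\<^sub>F n in sequentially. g (Lambda_sig f (s n) (astar n) (a n)) \<le> c) \<longrightarrow>
              (\<forall>\<^sub>F n in sequentially. \<forall>\<theta>\<in>signal_class n (s n) (a n).
                 level_condition f (s n) (astar n) (\<delta> n) n (g (Lambda_vec f (s n) (astar n) n \<theta>)) (\<alpha> n)))
           \<and>
           (\<exists>\<epsilon> :: nat \<Rightarrow> real. \<epsilon> \<longlonglongrightarrow> 0 \<and>
              (\<forall>\<^sub>F n in sequentially.
                 worst_risk f n (s n) (a n) (BH f n (\<alpha> n))
                   \<le> g (Lambda_sig f (s n) (astar n) (a n)) + \<epsilon> n))))"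
proof -
  note top = assms(3) and le = assms(2)[rule_format]
  \<comment> \<open>\<open>1 - \<kappa> * (1 - u)\<close> is \<open>u\<close> for
    \<open>\<kappa> = 1\<close> and \<open>2 * u - 1\<close> for \<open>\<kappa> = 2\<close>; from
    here on the cases are no longer distinguished.\<close>
  have "\<exists>L \<kappa>. detection_model f L \<kappa> \<and> g = (\<lambda>u. 1 - \<kappa> * (1 - u)) \<and> assumption_1 f s astar \<delta>"
    using assms(5)
  proof (elim disjE conjE)
    assume A: "assumption_1A f s astar \<delta>" and g: "g = (\<lambda>u. u)"
    obtain L where "detection_model f L 1" using detection_model_one_sided[OF assms(1) A] .
    moreover have "assumption_1 f s astar \<delta>" using A by (simp only: assumption_1A_def)
    ultimately show ?thesis unfolding g by (intro exI[of _ L] exI[of _ 1]) simp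
  next
    assume B: "assumption_1B f s astar \<delta>" and even: "\<forall>a x. df f (- a) x = df f a x"
      and g: "g = (\<lambda>u. 2 * u - 1)"
    obtain L where "detection_model f L 2"
      using detection_model_two_sided[OF assms(1) B even[rule_format]] .
    moreover have "assumption_1 f s astar \<delta>" using B by (simp only: assumption_1B_def)
    ultimately show ?thesis unfolding g by (intro exI[of _ L] exI[of _ 2]) (simp add: algebra_simps)
  qed
  then obtain L \<kappa> where model: "detection_model f L \<kappa>" and g: "g = (\<lambda>u. 1 - \<kappa> * (1 - u))"
    and asm: "assumption_1 f s astar \<delta>" by blast
  interpret detection_model f L \<kappa> by (rule model)
  note asm' = asm[unfolded assumption_1_def]
  interpret sparse_asymptotics f L \<kappa> s astar \<delta>
  proof
    from asm' show "filterlim (\<lambda>n. real n / real (s n) * tail f 0 (astar n - \<delta> n)) at_top sequentially"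
      by (elim conjE)
    from asm' show "(\<lambda>n. real n / real (s n) * tail f 0 (astar n)) \<longlonglongrightarrow> 0" by (elim conjE)
    from asm' show "filterlim astar at_top sequentially" by (elim conjE)
    from asm' show "\<delta> \<longlonglongrightarrow> 0" by (elim conjE)
    from asm' have "\<forall>n. 0 < astar n" by (elim conjE)
    then show "0 < astar n" for n ..
    from asm' have "\<forall>n. 0 < \<delta> n" by (elim conjE)
    then show "0 < \<delta> n" for n ..
  qed (rule le top)+
  have g_gap: "g = gap" by (simp add: g gap_def[abs_def])
  show ?thesis
    unfolding g_gap
  proof (intro conjI allI impI)
    fix \<alpha> :: "nat \<Rightarrow> real"
    show "\<forall>\<^sub>F n in sequentially. \<forall>\<theta>\<in>vectors n. card (nonzero n \<theta>) = s n \<longrightarrow>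
        level (\<alpha> n) n (lam_vec n \<theta>) \<longrightarrow> risk f n \<theta> (BH f n (\<alpha> n)) \<le>
          lam_vec n \<theta> + \<alpha> n + exp (- ((1 - lam_vec n \<theta>)\<^sup>2 / 32 * real (s n)))"
      by (rule risk_BH_eventually)
  next
    fix a :: "nat \<Rightarrow> nat \<Rightarrow> real" assume "\<forall>n. \<forall>j\<in>{1..s n}. 0 < a n j"
    then have a: "\<And>n j. j \<in> {1..s n} \<Longrightarrow> 0 < a n j" by blast
    from a show "(\<lambda>n. minimax_risk f n (s n) (a n) - lam_sig n (a n)) \<longlonglongrightarrow> 0"
      by (rule tendsto_minimax_risk)
    fix \<alpha> :: "nat \<Rightarrow> real"
    assume lev: "\<forall>\<^sub>F n in sequentially. \<forall>\<theta>\<in>signal_class n (s n) (a n). level (\<alpha> n) n (lam_vec n \<theta>)"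
    {
      assume \<alpha>: "\<alpha> \<longlonglongrightarrow> 0"
      show "\<exists>\<epsilon>. \<epsilon> \<longlonglongrightarrow> 0 \<and> (\<forall>\<^sub>F n in sequentially.
          worst_risk f n (s n) (a n) (BH f n (\<alpha> n)) \<le> lam_sig n (a n) + \<epsilon> n)"
      proof (intro exI conjI)
        show "(\<lambda>n. \<alpha> n + excess (s n)) \<longlonglongrightarrow> 0" using tendsto_add[OF \<alpha> tendsto_excess_s] by simp
        show "\<forall>\<^sub>F n in sequentially. worst_risk f n (s n) (a n) (BH f n (\<alpha> n))
            \<le> lam_sig n (a n) + (\<alpha> n + excess (s n))"
          using a lev by (rule worst_risk_BH_excess)
      qed
    }
    assume "\<exists>c<1. \<forall>\<^sub>F n in sequentially. lam_sig n (a n) \<le> c"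
    then obtain c where c: "c < 1" "\<forall>\<^sub>F n in sequentially. lam_sig n (a n) \<le> c" by blast
    show "\<forall>\<^sub>F n in sequentially. worst_risk f n (s n) (a n) (BH f n (\<alpha> n))
        \<le> lam_sig n (a n) + (\<alpha> n + exp (- ((1 - lam_sig n (a n))\<^sup>2 * real (s n) / 32)))"
      using a lev by (rule worst_risk_BH_eventually)
    assume \<alpha>: "\<alpha> \<longlonglongrightarrow> 0"
    show "(\<lambda>n. \<alpha> n + exp (- ((1 - lam_sig n (a n))\<^sup>2 * real (s n) / 32))) \<longlonglongrightarrow> 0"
      by (rule tendsto_remainder[OF c \<alpha>])
  next
    show "\<exists>\<alpha>. \<alpha> \<longlonglongrightarrow> 0 \<and>
        (\<forall>a. (\<forall>n. \<forall>j\<in>{1..s n}. 0 < a n j) \<longrightarrow>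
           ((\<exists>c<1. \<forall>\<^sub>F n in sequentially. lam_sig n (a n) \<le> c) \<longrightarrow>
              (\<forall>\<^sub>F n in sequentially. \<forall>\<theta>\<in>signal_class n (s n) (a n). level (\<alpha> n) n (lam_vec n \<theta>)))
           \<and> (\<exists>\<epsilon>. \<epsilon> \<longlonglongrightarrow> 0 \<and> (\<forall>\<^sub>F n in sequentially.
                 worst_risk f n (s n) (a n) (BH f n (\<alpha> n)) \<le> lam_sig n (a n) + \<epsilon> n)))"
    \<comment> \<open>\<open>opt_level\<close> is built from \<open>n\<close>, \<open>s n\<close>,
      \<open>astar n\<close> and the null tail only, so the same levels serve all arrays.\<close>
    proof (rule exI[of _ opt_level], intro conjI allI impI tendsto_opt_level)
      fix a :: "nat \<Rightarrow> nat \<Rightarrow> real" assume "\<forall>n. \<forall>j\<in>{1..s n}. 0 < a n j"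
      then have a: "\<And>n j. j \<in> {1..s n} \<Longrightarrow> 0 < a n j" by blast
      {
        assume "\<exists>c<1. \<forall>\<^sub>F n in sequentially. lam_sig n (a n) \<le> c"
        then obtain c where c: "c < 1" "\<forall>\<^sub>F n in sequentially. lam_sig n (a n) \<le> c" by blast
        from a c show "\<forall>\<^sub>F n in sequentially. \<forall>\<theta>\<in>signal_class n (s n) (a n). level (opt_level n) n (lam_vec n \<theta>)"
          by (rule level_opt_level)
      }
      show "\<exists>\<epsilon>. \<epsilon> \<longlonglongrightarrow> 0 \<and> (\<forall>\<^sub>F n in sequentially.
          worst_risk f n (s n) (a n) (BH f n (opt_level n)) \<le> lam_sig n (a n) + \<epsilon> n)"
      proof (intro exI conjI)
        show "\<forall>\<^sub>F n in sequentially. worst_risk f n (s n) (a n) (BH f n (opt_level n))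
            \<le> lam_sig n (a n) + (4 * opt_level n + excess (s n))"
          using a by (rule worst_risk_opt_level)
      qed (rule tendsto_opt_excess)
    qed
  qed
qed

end
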